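(* For every integer $n\ge1$, the inverse $Z$-polynomial $Y_{F_n}(t)$ of the fan graph $F_n$ is a polynomial of degree $n$, and for each integer $k$ with $0\le k\le n$ the coefficient of $t^k$ in $Y_{F_n}(t)$ equals $$d_{n,k}=2^{n-1}\binom{n}{k}+\sum_{j=1}^{\lfloor n/2\rfloor}\sum_{r=1}^{j}2^{\,n-2j-1}\,\frac{(-1)^{r}\,r\,(2r+n-2j)}{(2j-r)(r+n-2j)}\binom{n-2j}{k-j}\binom{2j-r}{j}\binom{r+n-2j}{r}.$$
   Context: All graphs are finite and loopless (parallel edges allowed). For a graph $G$, $c(G)$ is its number of connected components and $\mathrm{rk}(G)=|V(G)|-c(G)$ is the rank of its graphic matroid $\mathsf{M}(G)$. A composition of $G$ is a partition of $V(G)$ into vertex sets of connected induced subgraphs; $\mathcal{C}(G)$ is the set of compositions and $|C|$ is the number of parts of $C$. Compositions correspond bijectively to flats of $\mathsf{M}(G)$: $C$ corresponds to the set of edges with both endpoints in a common part of $C$. For $C\in\mathcal{C}(G)$, $G[C]$ is the subgraph whose edge set is that flat and whose vertices are the endpoints of these edges, with $\mathrm{rk}(G[C])=|V(G)|-|C|$, and $G/C$ is the graph obtained from $G$ by contracting all edges of that flat. $\chi_G(t)$ is the chromatic polynomial of $G$. The inverse Kazhdan--Lusztig polynomials $Q_G(t)\in\mathbb{Z}[t]$ are uniquely determined by: (i) if $\mathrm{rk}(G)=0$ then $Q_G(t)=1$; (ii) if $\mathrm{rk}(G)>0$ then $\deg Q_G(t)<\frac12\mathrm{rk}(G)$ and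 $$(-t)^{\mathrm{rk}(G)}Q_G(t^{-1})=\sum_{C\in\mathcal{C}(G)}(-1)^{\mathrm{rk}(G[C])}Q_{G[C]}(t)\cdot t^{|C|}\chi_{G/C}(t^{-1}).$$ The inverse $Z$-polynomial of $G$ is $$Y_G(t):=(-1)^{\mathrm{rk}(G)}\sum_{C\in\mathcal{C}(G)}(-1)^{\mathrm{rk}(G[C])}Q_{G[C]}(t)\cdot t^{\mathrm{rk}(G/C)}\mu_{G/C},$$ where $\mu_G$ is the Möbius invariant of $\mathsf{M}(G)$, i.e. the Möbius function $\mu(\hat0,\hat1)$ of its lattice of flats. For $n\ge1$ the fan graph $F_n$ is the graph on vertices $0,1,\dots,n$ obtained from the path $1,2,\dots,n$ by joining vertex $0$ to every vertex of the path. Binomial coefficients $\binom{a}{b}$ with integer $a\ge 0$ are zero when $b<0$ or $b>a$; empty sums are zero. *)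

theory Defs
  imports
    Complex_Main
    "HOL-Computational_Algebra.Polynomial"
    "HOL-Library.Disjoint_Sets"
    "HOL-Library.FuncSet"
begin

text \<open>Undirected graphs with possible parallel edges: distinct edges may have the same set of ends.\<close>

record ('v, 'e) mgraph =
  verts :: "'v set"
  edges :: "'e set"
  ends :: "'e \<Rightarrow> 'v set"

text \<open>Two-element sets of ends exclude loops.\<close>

definition finite_loopless :: "('v, 'e) mgraph \<Rightarrow> bool" where
  "finite_loopless G \<longleftrightarrow> finite (verts G) \<and> finite (edges G) \<and>
     (\<forall>e \<in> edges G. ends G e \<subseteq> verts G \<and> card (ends G e) = 2)"

definition joined :: "('v, 'e) mgraph \<Rightarrow> ('v \<times> 'v) set" where
  "joined G = {(u, v). u \<in> verts G \<and> v \<in> verts G \<and> (\<exists>e \<in> edges G. ends G e = {u, v})}"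

definition reachable :: "('v, 'e) mgraph \<Rightarrow> ('v \<times> 'v) set" where
  "reachable G = {(u, v). u \<in> verts G \<and> v \<in> verts G \<and> (u, v) \<in> (joined G)\<^sup>*}"

definition num_components :: "('v, 'e) mgraph \<Rightarrow> nat" where
  "num_components G = card (verts G // reachable G)"

definition connected_graph :: "('v, 'e) mgraph \<Rightarrow> bool" where
  "connected_graph G \<longleftrightarrow> num_components G = 1"

definition graph_rank :: "('v, 'e) mgraph \<Rightarrow> nat" where
  "graph_rank G = card (verts G) - num_components G"

definition induced :: "('v, 'e) mgraph \<Rightarrow> 'v set \<Rightarrow> ('v, 'e) mgraph" where
  "induced G W = \<lparr>verts = W, edges = {e \<in> edges G. ends G e \<subseteq> W}, ends = ends G\<rparr>"

definition compositions :: "('v, 'e) mgraph \<Rightarrow> 'v set set set" where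
  "compositions G = {C. partition_on (verts G) C \<and> (\<forall>W \<in> C. connected_graph (induced G W))}"

definition flat_of :: "('v, 'e) mgraph \<Rightarrow> 'v set set \<Rightarrow> 'e set" where
  "flat_of G C = {e \<in> edges G. \<exists>W \<in> C. ends G e \<subseteq> W}"

text \<open>The graph \<open>G[C]\<close>; vertices that become isolated are dropped.\<close>

definition restriction :: "('v, 'e) mgraph \<Rightarrow> 'v set set \<Rightarrow> ('v, 'e) mgraph" where
  "restriction G C =
     \<lparr>verts = (\<Union>e \<in> flat_of G C. ends G e), edges = flat_of G C, ends = ends G\<rparr>"

text \<open>The graph \<open>G/C\<close>. The parts of a composition are connected by edges of its flat, so contracting
  that flat collapses each part to a single vertex.\<close>

definition contraction :: "('v, 'e) mgraph \<Rightarrow> 'v set set \<Rightarrow> ('v set, 'e) mgraph" where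
  "contraction G C =
     \<lparr>verts = C, edges = edges G - flat_of G C, ends = (\<lambda>e. {W \<in> C. W \<inter> ends G e \<noteq> {}})\<rparr>"

definition proper_colorings :: "('v, 'e) mgraph \<Rightarrow> nat \<Rightarrow> ('v \<Rightarrow> nat) set" where
  "proper_colorings G q =
     {f \<in> verts G \<rightarrow>\<^sub>E {..<q}. \<forall>e \<in> edges G. \<forall>u v. ends G e = {u, v} \<longrightarrow> f u \<noteq> f v}"

definition chromatic_poly :: "('v, 'e) mgraph \<Rightarrow> int poly" where
  "chromatic_poly G = (THE p. \<forall>q. poly p (int q) = int (card (proper_colorings G q)))"

text \<open>The Moebius function of a finite set of elements of an ordered type, with the induced order.\<close>

function moebius :: "'a::order set \<Rightarrow> 'a \<Rightarrow> 'a \<Rightarrow> int" where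
  "moebius P x y =
     (if \<not> finite P \<or> x \<notin> P \<or> y \<notin> P \<or> \<not> x \<le> y then 0
      else if x = y then 1
      else - (\<Sum>z \<in> {z \<in> P. x \<le> z \<and> z < y}. moebius P x z))"
  by pat_completeness auto
termination
proof (relation "measure (\<lambda>(P, x, y). card {z \<in> P. z < y})")
  fix P :: "'a set" and x y z
  assume "\<not> (\<not> finite P \<or> x \<notin> P \<or> y \<notin> P \<or> \<not> x \<le> y)" and "z \<in> {z \<in> P. x \<le> z \<and> z < y}"
  then have "finite {w \<in> P. w < y}" "{w \<in> P. w < z} \<subset> {w \<in> P. w < y}"
    by auto
  then show "((P, x, z), (P, x, y)) \<in> measure (\<lambda>(P, x, y). card {z \<in> P. z < y})"
    by (simp add: psubset_card_mono)
qed simp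

declare moebius.simps [simp del]

text \<open>The rank function, the flats and the Moebius invariant of the graphic matroid. For a loopless
  graph the least flat is the empty set.\<close>

definition edge_rank :: "('v, 'e) mgraph \<Rightarrow> 'e set \<Rightarrow> nat" where
  "edge_rank G A = graph_rank \<lparr>verts = verts G, edges = A, ends = ends G\<rparr>"

definition flats :: "('v, 'e) mgraph \<Rightarrow> 'e set set" where
  "flats G = {F. F \<subseteq> edges G \<and> (\<forall>e \<in> edges G - F. edge_rank G F < edge_rank G (insert e F))}"

definition moebius_invariant :: "('v, 'e) mgraph \<Rightarrow> int" where
  "moebius_invariant G = moebius (flats G) {} (edges G)"

text \<open>The two defining conditions of the inverse Kazhdan--Lusztig polynomials, for all finite
  loopless graphs over the given types at once. The identity of Laurent polynomials is stated as an
  identity of their values at all nonzero real numbers.\<close>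

definition inverse_KL_family :: "(('v, 'e) mgraph \<Rightarrow> int poly) \<Rightarrow> bool" where
  "inverse_KL_family Q \<longleftrightarrow> (\<forall>G. finite_loopless G \<longrightarrow>
     (graph_rank G = 0 \<longrightarrow> Q G = 1) \<and>
     (graph_rank G > 0 \<longrightarrow>
        real (degree (Q G)) < real (graph_rank G) / 2 \<and>
        (\<forall>t::real. t \<noteq> 0 \<longrightarrow>
           (- t) ^ graph_rank G * poly (map_poly real_of_int (Q G)) (inverse t) =
           (\<Sum>C \<in> compositions G.
              (- 1) ^ graph_rank (restriction G C) * poly (map_poly real_of_int (Q (restriction G C))) t *
              (t ^ card C * poly (map_poly real_of_int (chromatic_poly (contraction G C))) (inverse t))))))"

text \<open>The conditions determine the family on finite loopless graphs, but not elsewhere, so the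
  description is applied to the value at \<open>G\<close> and not to the family.\<close>

definition inverse_KL_poly :: "('v, 'e) mgraph \<Rightarrow> int poly" where
  "inverse_KL_poly G = (THE p. \<exists>Q. inverse_KL_family Q \<and> Q G = p)"

definition inverse_Z_poly :: "('v, 'e) mgraph \<Rightarrow> int poly" where
  "inverse_Z_poly G = (- 1) ^ graph_rank G *
     (\<Sum>C \<in> compositions G.
        (- 1) ^ graph_rank (restriction G C) * inverse_KL_poly (restriction G C) *
        monom (moebius_invariant (contraction G C)) (graph_rank (contraction G C)))"

definition fan_graph :: "nat \<Rightarrow> (nat, nat set) mgraph" where
  "fan_graph n =
     \<lparr>verts = {0..n},
      edges = {{i, i + 1} | i. 1 \<le> i \<and> i < n} \<union> {{0, i} | i. 1 \<le> i \<and> i \<le> n},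
      ends = (\<lambda>e. e)\<rparr>"

text \<open>The binomial coefficient with integer lower index, zero for a negative one.\<close>

definition choose_int :: "nat \<Rightarrow> int \<Rightarrow> nat" where
  "choose_int a b = (if b < 0 then 0 else a choose nat b)"

end

theory Submission
  imports Defs "HOL-Computational_Algebra.Formal_Power_Series"
begin

text \<open>Write \<open>\<rho>\<close> for the rank of a flat, and \<open>Q\<^sub>F\<close>, \<open>Y\<^sub>F\<close> for the inverse Kazhdan--Lusztig polynomial and the
  inverse Z-polynomial of the restriction to a flat \<open>F\<close>. By definition
  \<open>Y\<^sub>H = \<Sum>\<^bsub>F \<le> H\<^esub> \<mu>(F,H) (-t)\<^bsup>\<rho>H - \<rho>F\<^esup> Q\<^sub>F\<close>, and Moebius inversion turns this into
  \<open>Q\<^sub>H = \<Sum>\<^bsub>F \<le> H\<^esub> (-t)\<^bsup>\<rho>H - \<rho>F\<^esup> Y\<^sub>F\<close>. A chromatic polynomial is itself a Moebius sum over flats, so that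
  the right-hand side of the defining identity of \<open>Q\<close> is the signed sum of all \<open>Y\<^sub>F\<close>. The identities for all
  flats together therefore say no more than that every \<open>Y\<^sub>F\<close> is palindromic, \<open>t\<^bsup>\<rho>F\<^esup> Y\<^sub>F(1/t) = Y\<^sub>F(t)\<close>
  (\<open>inverse_KL_family_iff\<close>).

  Palindromic \<open>Y\<^sub>F\<close> for which all \<open>Q\<^sub>H\<close> have degree below \<open>\<rho>H/2\<close> exist: once the
  \<open>Y\<^sub>F\<close> of smaller flats are known, the degree bound prescribes the upper half of \<open>Y\<^sub>H\<close>, and the lower half is its
  mirror image. They are unique, because the difference of two solutions would be palindromic of too small a
  degree. Hence it suffices to guess \<open>Y\<^sub>F\<close> for the flats of one graph and to check both properties
  (\<open>inverse_Z_poly_characterization\<close>).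

  A flat of the fan is encoded by a word with one letter for each vertex of the path: the vertex is connected to
  the hub, or it starts a new piece of the path, or it is joined to the piece of its predecessor. The restriction
  to the flat is a one-point union of a smaller fan for each run of vertices connected to the hub and of
  one edge for each join. The candidate is therefore a product of polynomials \<open>y\<^sub>k\<close>, one for each run of length
  \<open>k\<close>, and factors \<open>1 + t\<close>. The sum for \<open>Q\<close> factors in the same way (\<open>below_sum_append\<close>), which leaves
  the runs, that is, the sum \<open>q\<^sub>k\<close> over all words of length \<open>k\<close>.

  Put \<open>u = (1 + t) x\<close>, and let \<open>p\<close> be the power series in \<open>v = t x\<^sup>2\<close> without constant term and with
  \<open>p - p\<^sup>2 = v\<close>. Decomposing words into runs and gaps gives
  \<open>q (1 - u + t x y) = y (1 - u)\<close> for the generating functions (\<open>all_words_fps\<close>). With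
  \<open>y = (1 - u) / (1 + p - 2u)\<close> this becomes \<open>q = (1 - p - x) / (1 - p - 2x)\<close>. Each monomial of \<open>q - 1\<close> is \<open>x\<close>
  times a monomial in \<open>x\<close> and \<open>t x\<^sup>2\<close>, which is the degree bound, and \<open>y\<close> is a power series in
  \<open>(1 + t) x\<close> and \<open>t x\<^sup>2\<close>, which makes the \<open>y\<^sub>k\<close> palindromic. The formula is the expansion
  of \<open>y = 1/2 + (1 - p) / (2 (1 + p - 2u))\<close>, first in powers of \<open>u\<close>, then in powers of \<open>p\<close>, and
  finally in powers of \<open>v\<close> by the ballot numbers.\<close>

section \<open>Moebius functions of finite posets\<close>

lemma moebius_sum:
  assumes "finite P" "x \<in> P" "y \<in> P" "x \<le> y"
  shows "(\<Sum>z \<in> {z \<in> P. x \<le> z \<and> z \<le> y}. moebius P x z) = (if x = y then 1 else 0)"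
proof (cases "x = y")
  case True
  then have "{z \<in> P. x \<le> z \<and> z \<le> y} = {y}"
    using assms by auto
  then show ?thesis
    using True assms by (simp add: moebius.simps)
next
  case False
  have "{z \<in> P. x \<le> z \<and> z \<le> y} = insert y {z \<in> P. x \<le> z \<and> z < y}"
    using assms by auto
  then show ?thesis
    using False assms by (simp add: moebius.simps[of P x y])
qed

text \<open>The recursion that defines \<open>\<mu>\<close> says that it is a right inverse of the zeta function in the incidence
  algebra. That it is also a left inverse follows by induction from associativity.\<close>

lemma moebius_sum_dual:
  fixes P :: "'a::order set"
  assumes P: "finite P" and xy: "x \<in> P" "y \<in> P" "x \<le> y"
  shows "(\<Sum>z \<in> {z \<in> P. x \<le> z \<and> z \<le> y}. moebius P z y) = (if x = y then 1 else 0)"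
  using xy
proof (induction "card {z \<in> P. x \<le> z}" arbitrary: x rule: less_induct)
  case less
  define I where "I x = {z \<in> P. x \<le> z \<and> z \<le> y}" for x
  define \<nu> where "\<nu> x = (\<Sum>z \<in> I x. moebius P z y)" for x
  have fin: "finite (I x)" for x
    using P by (simp add: I_def)
  have IH: "\<nu> z = (if z = y then 1 else 0)" if "z \<in> I x" "z \<noteq> x" for z
  proof -
    have "{w \<in> P. z \<le> w} \<subset> {w \<in> P. x \<le> w}"
    proof
      show "{w \<in> P. z \<le> w} \<subseteq> {w \<in> P. x \<le> w}"
        using that by (auto simp: I_def)
      have "x \<in> {w \<in> P. x \<le> w}" "x \<notin> {w \<in> P. z \<le> w}"
        using that less.prems by (auto simp: I_def)
      then show "{w \<in> P. z \<le> w} \<noteq> {w \<in> P. x \<le> w}"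
        by blast
    qed
    then have "card {w \<in> P. z \<le> w} < card {w \<in> P. x \<le> w}"
      using P by (simp add: psubset_card_mono)
    from less.hyps[OF this] that less.prems show ?thesis
      by (simp add: I_def \<nu>_def)
  qed
  show ?case
  proof (cases "x = y")
    case True
    then have "{z \<in> P. x \<le> z \<and> z \<le> y} = {y}"
      using less.prems by auto
    then show ?thesis
      using True less.prems P by (simp add: moebius.simps)
  next
    case False
    have xI: "x \<in> I x" "y \<in> I x"
      using less.prems by (auto simp: I_def)
    \<comment> \<open>Both sides are the double sum of \<open>\<mu>(x,z) \<mu>(w,y)\<close> over \<open>x \<le> z \<le> w \<le> y\<close>.\<close>
    have "(\<Sum>z \<in> I x. moebius P x z * \<nu> z)
      = (\<Sum>z \<in> I x. \<Sum>w \<in> {w \<in> I x. z \<le> w}. moebius P x z * moebius P w y)"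
    proof (rule sum.cong)
      fix z assume "z \<in> I x"
      then have "I z = {w \<in> I x. z \<le> w}"
        by (auto simp: I_def)
      then show "moebius P x z * \<nu> z = (\<Sum>w \<in> {w \<in> I x. z \<le> w}. moebius P x z * moebius P w y)"
        by (simp add: \<nu>_def sum_distrib_left)
    qed simp
    also have "\<dots> = (\<Sum>w \<in> I x. \<Sum>z \<in> {z \<in> I x. z \<le> w}. moebius P x z * moebius P w y)"
      by (rule sum.swap_restrict[OF fin fin])
    also have "\<dots> = (\<Sum>w \<in> I x. (if w = x then moebius P w y else 0))"
    proof (rule sum.cong)
      fix w assume w: "w \<in> I x"
      then have "{z \<in> I x. z \<le> w} = {z \<in> P. x \<le> z \<and> z \<le> w}"
        by (auto simp: I_def)
      then show "(\<Sum>z \<in> {z \<in> I x. z \<le> w}. moebius P x z * moebius P w y)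
          = (if w = x then moebius P w y else 0)"
        using moebius_sum[OF P less.prems(1), of w] w
        by (simp add: I_def flip: sum_distrib_right)
    qed simp
    also have "\<dots> = moebius P x y"
      using xI fin by simp
    finally have *: "(\<Sum>z \<in> I x. moebius P x z * \<nu> z) = moebius P x y" .
    have "(\<Sum>z \<in> I x. moebius P x z * \<nu> z)
      = moebius P x x * \<nu> x + (\<Sum>z \<in> I x - {x}. moebius P x z * \<nu> z)"
      using fin xI by (simp add: sum.remove)
    also have "(\<Sum>z \<in> I x - {x}. moebius P x z * \<nu> z)
      = (\<Sum>z \<in> I x - {x}. if z = y then moebius P x z else 0)"
      by (rule sum.cong) (auto simp: IH)
    also have "\<dots> = moebius P x y"
      using False fin xI by simp
    finally have "moebius P x x * \<nu> x = 0"
      using * by simp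
    then have "\<nu> x = 0"
      using P less.prems by (simp add: moebius.simps[of P x x])
    then show ?thesis
      using False by (simp add: \<nu>_def I_def)
  qed
qed

text \<open>\<open>\<mu>(x, y)\<close> depends only on the interval between \<open>x\<close> and \<open>y\<close>. This carries Moebius values from a graph
  to its restrictions and contractions, whose flats form intervals.\<close>

lemma moebius_order_iso:
  fixes P :: "'a::order set" and P' :: "'b::order set"
  assumes fin: "finite P" "finite P'" and "x \<in> P" "y \<in> P" "x \<le> y"
    and ord: "\<And>z w. z \<in> P \<Longrightarrow> w \<in> P \<Longrightarrow> x \<le> z \<Longrightarrow> z \<le> y \<Longrightarrow> x \<le> w \<Longrightarrow> w \<le> y \<Longrightarrow> f z \<le> f w \<longleftrightarrow> z \<le> w"
    and img: "f ` {z \<in> P. x \<le> z \<and> z \<le> y} = {z \<in> P'. f x \<le> z \<and> z \<le> f y}"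
  shows "moebius P' (f x) (f y) = moebius P x y"
proof -
  define I where "I = {z \<in> P. x \<le> z \<and> z \<le> y}"
  have ord': "f z \<le> f w \<longleftrightarrow> z \<le> w" if "z \<in> I" "w \<in> I" for z w
    using ord that by (auto simp: I_def)
  have inj: "inj_on f I"
    by (rule inj_onI) (metis order_antisym ord' order_refl)
  have xI: "x \<in> I"
    using assms by (auto simp: I_def)
  have IP': "f z \<in> P'" "f x \<le> f z" "f z \<le> f y" if "z \<in> I" for z
    using img that by (auto simp: I_def)
  have "moebius P' (f x) (f z) = moebius P x z" if "z \<in> I" for z
    using that
  proof (induction "card {w \<in> I. w < z}" arbitrary: z rule: less_induct)
    case less
    have z: "z \<in> P" "x \<le> z" "z \<le> y"
      using less.prems by (auto simp: I_def)
    show ?case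
    proof (cases "x = z")
      case True
      then show ?thesis
        using less.prems assms xI IP' by (simp add: moebius.simps)
    next
      case False
      have ne: "f x \<noteq> f z"
        using False inj xI less.prems by (auto dest: inj_onD)
      have *: "{w \<in> P'. f x \<le> w \<and> w < f z} = f ` {w \<in> P. x \<le> w \<and> w < z}"
      proof (intro set_eqI iffI)
        fix w' assume w': "w' \<in> {w \<in> P'. f x \<le> w \<and> w < f z}"
        then have "w' \<in> {w \<in> P'. f x \<le> w \<and> w \<le> f y}"
          using IP'[OF less.prems] by auto
        then obtain w where "w \<in> I" "w' = f w"
          using img by (auto simp: I_def)
        then show "w' \<in> f ` {w \<in> P. x \<le> w \<and> w < z}"
          using w' ord'[OF _ less.prems, of w] by (auto simp: I_def less_le)
      next
        fix w' assume "w' \<in> f ` {w \<in> P. x \<le> w \<and> w < z}"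
        then obtain w where w: "w' = f w" "w \<in> P" "x \<le> w" "w < z"
          by auto
        then have "w \<in> I"
          using z by (auto simp: I_def)
        then show "w' \<in> {w \<in> P'. f x \<le> w \<and> w < f z}"
          using w IP'[of w] ord'[OF _ less.prems, of w] inj less.prems by (auto simp: less_le dest: inj_onD)
      qed
      have "(\<Sum>w' \<in> {w \<in> P'. f x \<le> w \<and> w < f z}. moebius P' (f x) w')
        = (\<Sum>w \<in> {w \<in> P. x \<le> w \<and> w < z}. moebius P' (f x) (f w))"
        unfolding * by (rule sum.reindex_cong[OF _ refl refl], rule inj_on_subset[OF inj]) (use z in \<open>auto simp: I_def\<close>)
      also have "\<dots> = (\<Sum>w \<in> {w \<in> P. x \<le> w \<and> w < z}. moebius P x w)"
      proof (rule sum.cong)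
        fix w assume w: "w \<in> {w \<in> P. x \<le> w \<and> w < z}"
        then have wI: "w \<in> I"
          using z by (auto simp: I_def)
        have "{v \<in> I. v < w} \<subset> {v \<in> I. v < z}"
          using w wI by auto
        then have "card {v \<in> I. v < w} < card {v \<in> I. v < z}"
          using fin by (intro psubset_card_mono) (auto simp: I_def)
        then show "moebius P' (f x) (f w) = moebius P x w"
          using less.hyps wI by blast
      qed simp
      finally show ?thesis
        using False ne z less.prems IP' xI assms by (simp add: moebius.simps[of _ "f x"] moebius.simps[of _ x z])
    qed
  qed
  then show ?thesis
    using assms by (auto simp: I_def)
qed

text \<open>If \<open>a\<close> is a left inverse of \<open>b\<close> in the incidence algebra, the transform by \<open>a\<close> undoes the transform by \<open>b\<close>.\<close>

lemma incidence_inverse: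
  fixes a b :: "'b::order \<Rightarrow> 'b \<Rightarrow> 'c::comm_ring_1"
  assumes P: "finite P" and H: "H \<in> P"
    and inv: "\<And>E. E \<in> P \<Longrightarrow> E \<le> H \<Longrightarrow>
      (\<Sum>F \<in> {F \<in> P. E \<le> F \<and> F \<le> H}. a F H * b E F) = (if E = H then 1 else 0)"
    and z: "\<And>F. F \<in> P \<Longrightarrow> z F = (\<Sum>E \<in> {E \<in> P. E \<le> F}. b E F * y E)"
  shows "(\<Sum>F \<in> {F \<in> P. F \<le> H}. a F H * z F) = y H"
proof -
  let ?D = "{F \<in> P. F \<le> H}"
  have "(\<Sum>F \<in> ?D. a F H * z F) = (\<Sum>F \<in> ?D. \<Sum>E \<in> {E \<in> ?D. E \<le> F}. a F H * b E F * y E)"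
  proof (rule sum.cong)
    fix F assume F: "F \<in> ?D"
    then have "{E \<in> P. E \<le> F} = {E \<in> ?D. E \<le> F}"
      by auto
    then show "a F H * z F = (\<Sum>E \<in> {E \<in> ?D. E \<le> F}. a F H * b E F * y E)"
      using F by (simp add: z sum_distrib_left mult.assoc)
  qed simp
  also have "\<dots> = (\<Sum>E \<in> ?D. \<Sum>F \<in> {F \<in> ?D. E \<le> F}. a F H * b E F * y E)"
    by (rule sum.swap_restrict) (use P in auto)
  also have "\<dots> = (\<Sum>E \<in> ?D. if E = H then y E else 0)"
  proof (rule sum.cong)
    fix E assume E: "E \<in> ?D"
    have "{F \<in> ?D. E \<le> F} = {F \<in> P. E \<le> F \<and> F \<le> H}"
      by auto
    then show "(\<Sum>F \<in> {F \<in> ?D. E \<le> F}. a F H * b E F * y E) = (if E = H then y E else 0)"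
      using E inv[of E] by (simp flip: sum_distrib_right)
  qed simp
  also have "\<dots> = y H"
    using H P by simp
  finally show ?thesis .
qed

text \<open>Twisting zeta and Moebius function by a multiplicative \<open>T\<close> leaves them inverse to each other. The
  relevant case is \<open>T F H = (-t)\<^bsup>\<rho>H - \<rho>F\<^esup>\<close>.\<close>

lemma moebius_inversion:
  fixes P :: "'b::order set" and T :: "'b \<Rightarrow> 'b \<Rightarrow> 'c::comm_ring_1" and y q :: "'b \<Rightarrow> 'c"
  assumes P: "finite P"
    and T_refl: "\<And>x. x \<in> P \<Longrightarrow> T x x = 1"
    and T_mult: "\<And>x z w. x \<in> P \<Longrightarrow> z \<in> P \<Longrightarrow> w \<in> P \<Longrightarrow> x \<le> z \<Longrightarrow> z \<le> w \<Longrightarrow> T x z * T z w = T x w"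
  shows "(\<forall>H \<in> P. q H = (\<Sum>F \<in> {F \<in> P. F \<le> H}. T F H * y F)) \<longleftrightarrow>
    (\<forall>H \<in> P. y H = (\<Sum>F \<in> {F \<in> P. F \<le> H}. of_int (moebius P F H) * T F H * q F))"
proof -
  let ?M = "\<lambda>F H. of_int (moebius P F H) * T F H"
  have MT: "(\<Sum>F \<in> {F \<in> P. E \<le> F \<and> F \<le> H}. ?M F H * T E F) = (if E = H then 1 else 0)"
    if "H \<in> P" "E \<in> P" "E \<le> H" for E H
  proof -
    have "(\<Sum>F \<in> {F \<in> P. E \<le> F \<and> F \<le> H}. ?M F H * T E F)
      = of_int (\<Sum>F \<in> {F \<in> P. E \<le> F \<and> F \<le> H}. moebius P F H) * T E H"
      unfolding of_int_sum sum_distrib_right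
    proof (rule sum.cong)
      fix F assume "F \<in> {F \<in> P. E \<le> F \<and> F \<le> H}"
      then have "T E F * T F H = T E H"
        using that T_mult by simp
      then show "?M F H * T E F = of_int (moebius P F H) * T E H"
        by (metis mult.assoc mult.commute)
    qed simp
    then show ?thesis
      using that T_refl by (simp add: moebius_sum_dual[OF P])
  qed
  have TM: "(\<Sum>F \<in> {F \<in> P. E \<le> F \<and> F \<le> H}. T F H * ?M E F) = (if E = H then 1 else 0)"
    if "H \<in> P" "E \<in> P" "E \<le> H" for E H
  proof -
    have "(\<Sum>F \<in> {F \<in> P. E \<le> F \<and> F \<le> H}. T F H * ?M E F)
      = of_int (\<Sum>F \<in> {F \<in> P. E \<le> F \<and> F \<le> H}. moebius P E F) * T E H"
      unfolding of_int_sum sum_distrib_right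
    proof (rule sum.cong)
      fix F assume "F \<in> {F \<in> P. E \<le> F \<and> F \<le> H}"
      then have "T E F * T F H = T E H"
        using that T_mult by simp
      then show "T F H * ?M E F = of_int (moebius P E F) * T E H"
        by (metis mult.assoc mult.commute)
    qed simp
    then show ?thesis
      using that T_refl by (simp add: moebius_sum[OF P])
  qed
  show ?thesis
  proof (intro iffI ballI)
    fix H assume "H \<in> P" and "\<forall>H \<in> P. q H = (\<Sum>F \<in> {F \<in> P. F \<le> H}. T F H * y F)"
    then show "y H = (\<Sum>F \<in> {F \<in> P. F \<le> H}. ?M F H * q F)"
      by (intro incidence_inverse[OF P, of H ?M T, symmetric] MT) auto
  next
    fix H assume "H \<in> P" and "\<forall>H \<in> P. y H = (\<Sum>F \<in> {F \<in> P. F \<le> H}. ?M F H * q F)"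
    then show "q H = (\<Sum>F \<in> {F \<in> P. F \<le> H}. T F H * y F)"
      by (intro incidence_inverse[OF P, of H T ?M, symmetric] TM) auto
  qed
qed

section \<open>Palindromic polynomials\<close>

text \<open>The polynomial \<open>t\<^sup>r p(1/t)\<close>, given by its coefficients so that no Laurent polynomials are needed.
  It is meaningful if \<open>degree p \<le> r\<close>; higher coefficients are cut off.\<close>

definition reversal :: "nat \<Rightarrow> 'a::comm_ring_1 poly \<Rightarrow> 'a poly" where
  "reversal r p = (\<Sum>k\<le>r. monom (coeff p (r - k)) k)"

lemma coeff_reversal: "coeff (reversal r p) k = (if k \<le> r then coeff p (r - k) else 0)"
  by (simp add: reversal_def coeff_sum)

lemma degree_reversal: "degree (reversal r p) \<le> r"
  by (rule degree_le) (simp add: coeff_reversal)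

lemma reversal_reversal: "degree p \<le> r \<Longrightarrow> reversal r (reversal r p) = p"
  by (rule poly_eqI) (simp add: coeff_reversal coeff_eq_0)

lemma reversal_sum: "reversal r (\<Sum>x \<in> A. f x) = (\<Sum>x \<in> A. reversal r (f x))"
  by (rule poly_eqI) (simp add: coeff_reversal coeff_sum)

lemma reversal_diff: "reversal r (p - q) = reversal r p - reversal r q"
  by (rule poly_eqI) (simp add: coeff_reversal)

lemma reversal_smult: "reversal r (smult c p) = smult c (reversal r p)"
  by (rule poly_eqI) (simp add: coeff_reversal)

lemma reversal_monom_mult:
  assumes "d \<le> r"
  shows "reversal r (monom c d * p) = smult c (reversal (r - d) p)"
  using assms by (intro poly_eqI) (auto simp: coeff_reversal coeff_monom_mult add.commute)

lemma reversal_monom_shift: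
  assumes "degree p \<le> r"
  shows "reversal (d + r) p = monom 1 d * reversal r p"
proof (rule poly_eqI)
  fix k
  show "coeff (reversal (d + r) p) k = coeff (monom 1 d * reversal r p) k"
    using assms by (auto simp: coeff_reversal coeff_monom_mult coeff_eq_0 add.commute)
qed

text \<open>Both sides are linear in \<open>p\<close>, so a monomial \<open>p\<close> suffices.\<close>

lemma reversal_mult:
  assumes "degree p \<le> r" "degree q \<le> s"
  shows "reversal (r + s) (p * q) = reversal r p * reversal s q"
proof -
  have "p = (\<Sum>i\<le>r. monom (coeff p i) i)"
    using assms by (simp add: poly_as_sum_of_monoms')
  then have "reversal (r + s) (p * q) = (\<Sum>i\<le>r. reversal (r + s) (monom (coeff p i) i * q))"
    by (metis (no_types) reversal_sum sum_distrib_right)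
  also have "\<dots> = (\<Sum>i\<le>r. monom (coeff p i) (r - i) * reversal s q)"
  proof (rule sum.cong)
    fix i assume "i \<in> {..r}"
    then have "reversal (r + s) (monom (coeff p i) i * q) = smult (coeff p i) (reversal ((r - i) + s) q)"
      by (subst reversal_monom_mult) auto
    then show "reversal (r + s) (monom (coeff p i) i * q) = monom (coeff p i) (r - i) * reversal s q"
      using assms by (simp add: reversal_monom_shift smult_monom flip: mult_smult_left)
  qed simp
  also have "\<dots> = (\<Sum>i\<le>r. monom (coeff p (r - i)) i) * reversal s q"
    unfolding sum_distrib_right
    by (rule sum.reindex_bij_witness[of _ "\<lambda>i. r - i" "\<lambda>i. r - i"]) auto
  finally show ?thesis
    by (simp add: reversal_def)
qed

definition palindromic :: "nat \<Rightarrow> 'a::comm_ring_1 poly \<Rightarrow> bool" where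
  "palindromic r p \<longleftrightarrow> reversal r p = p"

lemma palindromic_degree: "palindromic r p \<Longrightarrow> degree p \<le> r"
  by (metis degree_reversal palindromic_def)

lemma palindromic_1: "palindromic 0 1"
  by (simp add: palindromic_def reversal_def)

lemma palindromic_mult:
  "palindromic r p \<Longrightarrow> palindromic s q \<Longrightarrow> palindromic (r + s) (p * q)"
  using palindromic_degree[of r p] palindromic_degree[of s q]
  by (simp add: palindromic_def reversal_mult)

lemma palindromic_sum:
  "(\<And>x. x \<in> A \<Longrightarrow> palindromic r (f x)) \<Longrightarrow> palindromic r (\<Sum>x \<in> A. f x)"
  by (simp add: palindromic_def reversal_sum)

lemma palindromic_smult: "palindromic r p \<Longrightarrow> palindromic r (smult c p)"
  by (simp add: palindromic_def reversal_smult)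

lemma palindromic_one_plus_X: "palindromic 1 [:1, 1 :: real:]"
  by (auto simp: palindromic_def poly_eq_iff coeff_reversal coeff_pCons split: nat.splits)

text \<open>The degree condition on an inverse Kazhdan--Lusztig polynomial of a graph of rank \<open>r\<close>, together with its
  initial value in rank \<open>0\<close>.\<close>

definition KL_bounded :: "nat \<Rightarrow> 'a::comm_ring_1 poly \<Rightarrow> bool" where
  "KL_bounded r p \<longleftrightarrow> (if r = 0 then p = 1 else 2 * degree p < r)"

lemma KL_bounded_degree: "KL_bounded r p \<Longrightarrow> degree p \<le> r"
  by (auto simp: KL_bounded_def split: if_splits)

lemma KL_bounded_mult:
  assumes "KL_bounded r p" "KL_bounded s q"
  shows "KL_bounded (r + s) (p * q)"
  using assms degree_mult_le[of p q] by (auto simp: KL_bounded_def split: if_splits)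

lemma palindromic_small_degree_eq_0:
  assumes "palindromic r p" "2 * degree p < r"
  shows "p = 0"
proof (rule poly_eqI)
  fix k
  have "coeff p k = (if k \<le> r then coeff p (r - k) else 0)"
    using assms(1) coeff_reversal[of r p k] by (simp add: palindromic_def)
  then show "coeff p k = coeff 0 k"
    using assms(2) by (cases "degree p < k") (auto simp: coeff_eq_0)
qed

text \<open>By induction, two solutions \<open>y\<close>, \<open>y'\<close> agree below \<open>H\<close>. Then \<open>y H - y' H\<close> is the difference of the two
  bounded sums, so it is palindromic with respect to \<open>\<rho> H\<close> but of degree less than \<open>\<rho> H / 2\<close>, and vanishes.\<close>

lemma palindromic_system_unique:
  fixes P :: "'b::order set" and \<rho> :: "'b \<Rightarrow> nat" and y y' :: "'b \<Rightarrow> 'a::comm_ring_1 poly"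
  assumes P: "finite P"
    and pal: "\<And>H. H \<in> P \<Longrightarrow> palindromic (\<rho> H) (y H)" "\<And>H. H \<in> P \<Longrightarrow> palindromic (\<rho> H) (y' H)"
    and bound: "\<And>H. H \<in> P \<Longrightarrow> KL_bounded (\<rho> H) (\<Sum>F \<in> {F \<in> P. F \<le> H}. [:0, -1:] ^ (\<rho> H - \<rho> F) * y F)"
      "\<And>H. H \<in> P \<Longrightarrow> KL_bounded (\<rho> H) (\<Sum>F \<in> {F \<in> P. F \<le> H}. [:0, -1:] ^ (\<rho> H - \<rho> F) * y' F)"
    and "H \<in> P"
  shows "y H = y' H"
  using \<open>H \<in> P\<close>
proof (induction "card {F \<in> P. F \<le> H}" arbitrary: H rule: less_induct)
  case less
  define q where "q y = (\<Sum>F \<in> {F \<in> P. F \<le> H}. [:0, -1:] ^ (\<rho> H - \<rho> F) * y F)" for y :: "'b \<Rightarrow> 'a poly"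
  define B where "B y = (\<Sum>F \<in> {F \<in> P. F < H}. [:0, -1:] ^ (\<rho> H - \<rho> F) * y F)" for y :: "'b \<Rightarrow> 'a poly"
  have "{F \<in> P. F \<le> H} = insert H {F \<in> P. F < H}"
    using less.prems by auto
  then have qB: "q y = y H + B y" for y
    using P by (simp add: q_def B_def)
  have "B y = B y'"
    unfolding B_def
  proof (rule sum.cong)
    fix F assume F: "F \<in> {F \<in> P. F < H}"
    then have "{E \<in> P. E \<le> F} \<subseteq> {E \<in> P. E \<le> H}" "H \<in> {E \<in> P. E \<le> H}" "H \<notin> {E \<in> P. E \<le> F}"
      using less.prems by auto
    then have "{E \<in> P. E \<le> F} \<subset> {E \<in> P. E \<le> H}"
      by blast
    then have "card {E \<in> P. E \<le> F} < card {E \<in> P. E \<le> H}"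
      using P by (simp add: psubset_card_mono)
    then show "[:0, -1:] ^ (\<rho> H - \<rho> F) * y F = [:0, -1:] ^ (\<rho> H - \<rho> F) * y' F"
      using less.hyps F by auto
  qed simp
  then have diff: "y H - y' H = q y - q y'"
    by (simp add: qB)
  have bd: "KL_bounded (\<rho> H) (q y)" "KL_bounded (\<rho> H) (q y')"
    using bound less.prems by (auto simp: q_def)
  show ?case
  proof (cases "\<rho> H = 0")
    case True
    then show ?thesis
      using bd diff by (simp add: KL_bounded_def)
  next
    case False
    then have "2 * degree (q y - q y') < \<rho> H"
      using bd degree_diff_le_max[of "q y" "q y'"] by (auto simp: KL_bounded_def)
    moreover have "palindromic (\<rho> H) (y H - y' H)"
      using pal[OF less.prems] by (simp add: palindromic_def reversal_diff)
    ultimately show ?thesis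
      using palindromic_small_degree_eq_0[of "\<rho> H" "y H - y' H"] diff by simp
  qed
qed

text \<open>The palindromic polynomial that cancels the upper half of \<open>p\<close> when it is added to \<open>p\<close>. The index
  \<open>max k (r - k)\<close> is the one of \<open>k\<close> and its mirror image that lies in the upper half.\<close>

definition palindromic_completion :: "nat \<Rightarrow> 'a::comm_ring_1 poly \<Rightarrow> 'a poly" where
  "palindromic_completion r p = (\<Sum>k\<le>r. monom (- coeff p (max k (r - k))) k)"

lemma coeff_palindromic_completion:
  "coeff (palindromic_completion r p) k = (if k \<le> r then - coeff p (max k (r - k)) else 0)"
  by (simp add: palindromic_completion_def coeff_sum)

lemma palindromic_palindromic_completion: "palindromic r (palindromic_completion r p)"
  by (auto simp: palindromic_def poly_eq_iff coeff_reversal coeff_palindromic_completion max.commute)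

lemma degree_palindromic_completion:
  assumes "degree p \<le> r" "r > 0"
  shows "2 * degree (p + palindromic_completion r p) < r"
proof -
  have "coeff (p + palindromic_completion r p) k = 0" if "k > (r - 1) div 2" for k
  proof -
    have "max k (r - k) = k"
      using that assms by auto
    then show ?thesis
      using assms by (auto simp: coeff_palindromic_completion coeff_eq_0)
  qed
  then have "degree (p + palindromic_completion r p) \<le> (r - 1) div 2"
    by (intro degree_le) auto
  then show ?thesis
    using assms by linarith
qed

section \<open>Edge ranks and flats\<close>

lemma equiv_reachable: "equiv (verts G) (reachable G)"
proof -
  have sym: "sym ((joined G)\<^sup>*)"
    by (rule sym_rtrancl) (auto simp: sym_def joined_def insert_commute)
  show ?thesis
    by (rule equivI) (use sym in \<open>auto simp: reachable_def refl_on_def sym_def intro: transI\<close>)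
qed

lemma reachable_refl: "v \<in> verts G \<Longrightarrow> (v, v) \<in> reachable G"
  by (simp add: reachable_def)

lemma reachable_edge:
  "e \<in> edges G \<Longrightarrow> ends G e = {u, v} \<Longrightarrow> u \<in> verts G \<Longrightarrow> v \<in> verts G \<Longrightarrow> (u, v) \<in> reachable G"
  by (auto simp: reachable_def joined_def)

lemma reachable_least:
  assumes R: "equiv V R" and V: "verts G \<subseteq> V"
    and edge: "\<And>e u v. e \<in> edges G \<Longrightarrow> ends G e = {u, v} \<Longrightarrow> u \<in> verts G \<Longrightarrow> v \<in> verts G \<Longrightarrow> (u, v) \<in> R"
  shows "reachable G \<subseteq> R"
proof (rule subrelI)
  fix u v assume uv: "(u, v) \<in> reachable G"
  then have "(u, v) \<in> (joined G)\<^sup>*" "u \<in> verts G"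
    by (auto simp: reachable_def)
  then show "(u, v) \<in> R"
  proof (induction rule: rtrancl_induct)
    case base
    then show ?case
      using R V by (auto simp: equiv_def refl_on_def)
  next
    case (step w v)
    then have "(w, v) \<in> R"
      using edge by (auto simp: joined_def)
    then show ?case
      using step R by (meson equivE transE)
  qed
qed

lemma card_quotient_kernel:
  assumes "\<And>u v. (u, v) \<in> R \<longleftrightarrow> u \<in> V \<and> v \<in> V \<and> f u = f v"
  shows "card (V // R) = card (f ` V)"
proof -
  have cls: "R `` {v} = {u \<in> V. f u = f v}" if "v \<in> V" for v
    using assms that by auto
  have "bij_betw (\<lambda>y. {u \<in> V. f u = y}) (f ` V) (V // R)"
    unfolding bij_betw_def
  proof
    show "inj_on (\<lambda>y. {u \<in> V. f u = y}) (f ` V)"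
      by (rule inj_onI) blast
    show "(\<lambda>y. {u \<in> V. f u = y}) ` f ` V = V // R"
      unfolding quotient_def using cls by auto
  qed
  then show ?thesis
    by (simp add: bij_betw_same_card)
qed

text \<open>A coarser equivalence relation has no more classes, and strictly fewer if it is really coarser. Ranks of
  edge sets are compared through this lemma, without counting the effect of a single edge.\<close>

lemma card_quotient_mono:
  assumes V: "finite V" and R: "equiv V R" and R': "equiv V R'" and sub: "R \<subseteq> R'"
  shows "card (V // R') \<le> card (V // R)" and "R \<noteq> R' \<Longrightarrow> card (V // R') < card (V // R)"
proof -
  have fin: "finite (V // R)"
    using V by (simp add: finite_quotient equiv_type[OF R])
  have img: "(\<lambda>X. R' `` X) ` (V // R) = V // R'"
  proof -
    have "R' `` (R `` {v}) = R' `` {v}" if "v \<in> V" for v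
      using sub R R' that by (auto simp: equiv_def refl_on_def dest: transD)
    then show ?thesis
      unfolding quotient_def by (auto simp: image_iff)
  qed
  then show "card (V // R') \<le> card (V // R)"
    by (metis card_image_le fin)
  assume "R \<noteq> R'"
  then obtain u v where uv: "(u, v) \<in> R'" "(u, v) \<notin> R"
    using sub by auto
  then have V': "u \<in> V" "v \<in> V"
    using equiv_type[OF R'] by auto
  have "\<not> inj_on (\<lambda>X. R' `` X) (V // R)"
  proof
    assume inj: "inj_on (\<lambda>X. R' `` X) (V // R)"
    have "R' `` (R `` {w}) = R' `` {w}" if "w \<in> V" for w
      using sub R R' that by (auto simp: equiv_def refl_on_def dest: transD)
    then have "R' `` (R `` {u}) = R' `` (R `` {v})"
      using V' uv equiv_class_eq[OF R'] by simp
    then have "R `` {u} = R `` {v}"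
      using inj V' by (auto simp: inj_on_def quotientI)
    then show False
      using uv V' R by (simp add: eq_equiv_class_iff)
  qed
  then show "card (V // R') < card (V // R)"
    by (metis img fin card_image_le eq_card_imp_inj_on le_neq_implies_less)
qed

lemma card_quotient_le:
  assumes "finite V" "equiv V R"
  shows "card (V // R) \<le> card V"
proof -
  have "V // R = (\<lambda>v. R `` {v}) ` V"
    by (auto simp: quotient_def)
  then show ?thesis
    by (simp add: card_image_le assms)
qed

text \<open>Connectedness by edges of \<open>A\<close> on the full vertex set. The flats of a graph and the parts of its compositions
  are both described by this relation.\<close>

definition conn :: "('v, 'e) mgraph \<Rightarrow> 'e set \<Rightarrow> ('v \<times> 'v) set" where
  "conn G A = reachable \<lparr>verts = verts G, edges = A, ends = ends G\<rparr>"

lemma edge_rank_eq: "edge_rank G A = card (verts G) - card (verts G // conn G A)"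
  by (simp add: edge_rank_def graph_rank_def num_components_def conn_def)

lemma graph_rank_eq: "graph_rank G = edge_rank G (edges G)"
  by (cases G) (simp add: edge_rank_def)

lemma equiv_conn: "equiv (verts G) (conn G A)"
  using equiv_reachable[of "\<lparr>verts = verts G, edges = A, ends = ends G\<rparr>"] by (simp add: conn_def)

lemma conn_refl: "v \<in> verts G \<Longrightarrow> (v, v) \<in> conn G A"
  by (simp add: conn_def reachable_refl)

lemma conn_sym: "(u, v) \<in> conn G A \<Longrightarrow> (v, u) \<in> conn G A"
  by (meson equivE equiv_conn symD)

lemma conn_trans: "(u, v) \<in> conn G A \<Longrightarrow> (v, w) \<in> conn G A \<Longrightarrow> (u, w) \<in> conn G A"
  by (meson equivE equiv_conn transD)

lemma conn_verts: "(u, v) \<in> conn G A \<Longrightarrow> u \<in> verts G \<and> v \<in> verts G"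
  by (simp add: conn_def reachable_def)

lemma conn_edge:
  "e \<in> A \<Longrightarrow> ends G e = {u, v} \<Longrightarrow> u \<in> verts G \<Longrightarrow> v \<in> verts G \<Longrightarrow> (u, v) \<in> conn G A"
  unfolding conn_def by (rule reachable_edge) auto

lemma conn_least:
  assumes "equiv (verts G) R"
    and "\<And>e u v. e \<in> A \<Longrightarrow> ends G e = {u, v} \<Longrightarrow> u \<in> verts G \<Longrightarrow> v \<in> verts G \<Longrightarrow> (u, v) \<in> R"
  shows "conn G A \<subseteq> R"
  unfolding conn_def by (rule reachable_least[OF assms(1)]) (use assms(2) in auto)

lemma conn_mono: "A \<subseteq> B \<Longrightarrow> conn G A \<subseteq> conn G B"
  by (rule conn_least[OF equiv_conn]) (auto intro: conn_edge)

lemma finite_loopless_ends: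
  assumes "finite_loopless G" "e \<in> edges G"
  obtains u v where "ends G e = {u, v}" "u \<noteq> v" "u \<in> verts G" "v \<in> verts G"
  using assms unfolding finite_loopless_def by (metis card_2_iff insert_subset)

lemma conn_empty: "conn G {} = Id_on (verts G)"
proof
  show "conn G {} \<subseteq> Id_on (verts G)"
    by (rule conn_least) (auto simp: equiv_def refl_on_def sym_def trans_def)
qed (auto intro: conn_refl)

lemma edge_rank_empty: "edge_rank G {} = 0"
proof -
  have "card (verts G // conn G {}) = card ((\<lambda>v. v) ` verts G)"
    by (rule card_quotient_kernel) (auto simp: conn_empty)
  then show ?thesis
    by (simp add: edge_rank_eq)
qed

lemma card_conn_le: "finite (verts G) \<Longrightarrow> card (verts G // conn G A) \<le> card (verts G)"
  by (simp add: card_quotient_le equiv_conn)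

lemma card_conn_eq: "finite (verts G) \<Longrightarrow> card (verts G // conn G A) = card (verts G) - edge_rank G A"
  using card_conn_le[of G A] by (simp add: edge_rank_eq)

lemma edge_rank_mono:
  assumes "finite (verts G)" "A \<subseteq> B"
  shows "edge_rank G A \<le> edge_rank G B"
  using card_quotient_mono(1)[OF assms(1) equiv_conn equiv_conn conn_mono[OF assms(2)]]
  by (simp add: edge_rank_eq diff_le_mono2)

lemma edge_rank_insert_less_iff:
  assumes G: "finite (verts G)" and e: "ends G e = {u, v}" "u \<in> verts G" "v \<in> verts G"
  shows "edge_rank G A < edge_rank G (insert e A) \<longleftrightarrow> (u, v) \<notin> conn G A"
proof
  assume less: "edge_rank G A < edge_rank G (insert e A)"
  show "(u, v) \<notin> conn G A"
  proof
    assume uv: "(u, v) \<in> conn G A"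
    have "conn G (insert e A) \<subseteq> conn G A"
    proof (rule conn_least[OF equiv_conn])
      fix e' u' v' assume "e' \<in> insert e A" "ends G e' = {u', v'}" "u' \<in> verts G" "v' \<in> verts G"
      then show "(u', v') \<in> conn G A"
        using uv conn_sym[OF uv] e by (cases "e' = e") (auto simp: doubleton_eq_iff intro: conn_edge)
    qed
    then have "conn G (insert e A) = conn G A"
      using conn_mono[of A "insert e A" G] by auto
    then show False
      using less by (simp add: edge_rank_eq)
  qed
next
  assume uv: "(u, v) \<notin> conn G A"
  have "(u, v) \<in> conn G (insert e A)"
    using e by (auto intro: conn_edge)
  then have "card (verts G // conn G (insert e A)) < card (verts G // conn G A)"
    using uv by (intro card_quotient_mono(2)[OF G equiv_conn equiv_conn conn_mono]) auto
  then show "edge_rank G A < edge_rank G (insert e A)"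
    using card_conn_le[OF G, of A] by (simp add: edge_rank_eq)
qed

text \<open>An edge raises the rank of \<open>F\<close> exactly if its ends lie in different components, so a flat is an edge set that
  contains every edge within one of its components.\<close>

lemma flats_iff_closed:
  assumes G: "finite_loopless G"
  shows "F \<in> flats G \<longleftrightarrow> F \<subseteq> edges G \<and>
    (\<forall>e \<in> edges G. \<forall>u v. ends G e = {u, v} \<longrightarrow> (u, v) \<in> conn G F \<longrightarrow> e \<in> F)"
    (is "_ \<longleftrightarrow> _ \<and> ?C")
proof -
  have fin: "finite (verts G)"
    using G by (simp add: finite_loopless_def)
  have "?C \<longleftrightarrow> (\<forall>e \<in> edges G - F. edge_rank G F < edge_rank G (insert e F))"
  proof (rule iffI, rule ballI)
    fix e assume C: ?C and e: "e \<in> edges G - F"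
    obtain u v where "ends G e = {u, v}" "u \<in> verts G" "v \<in> verts G"
      using G e by (auto elim: finite_loopless_ends)
    then show "edge_rank G F < edge_rank G (insert e F)"
      using C e edge_rank_insert_less_iff[OF fin] by blast
  next
    assume *: "\<forall>e \<in> edges G - F. edge_rank G F < edge_rank G (insert e F)"
    show ?C
    proof (intro ballI allI impI, rule ccontr)
      fix e u v assume "e \<in> edges G" "ends G e = {u, v}" "(u, v) \<in> conn G F" "e \<notin> F"
      then show False
        using * edge_rank_insert_less_iff[OF fin, of e u v F] conn_verts[of u v G F] by auto
    qed
  qed
  then show ?thesis
    by (auto simp: flats_def)
qed

lemma finite_flats: "finite_loopless G \<Longrightarrow> finite (flats G)"
  by (rule finite_subset[of _ "Pow (edges G)"]) (auto simp: flats_def finite_loopless_def)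

lemma edges_in_flats: "edges G \<in> flats G"
  by (simp add: flats_def)

lemma empty_in_flats: "finite_loopless G \<Longrightarrow> {} \<in> flats G"
  by (auto simp: flats_iff_closed conn_empty finite_loopless_def)

lemma flats_subset: "F \<in> flats G \<Longrightarrow> F \<subseteq> edges G"
  by (simp add: flats_def)

lemma edge_rank_strict_mono:
  assumes G: "finite_loopless G" and F: "F \<in> flats G" and sub: "F \<subset> A" "A \<subseteq> edges G"
  shows "edge_rank G F < edge_rank G A"
proof -
  obtain e where e: "e \<in> A - F"
    using sub by auto
  then have "edge_rank G F < edge_rank G (insert e F)"
    using F sub by (auto simp: flats_def)
  also have "\<dots> \<le> edge_rank G A"
    using G e sub by (intro edge_rank_mono) (auto simp: finite_loopless_def)
  finally show ?thesis .
qed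

section \<open>Compositions, restrictions and contractions\<close>

text \<open>An isolated vertex adds one vertex and one component. Thus the rank of a restriction may be computed
  with or without the vertices that the restriction drops.\<close>

lemma graph_rank_isolated_vertices:
  assumes V: "finite V" "V' \<subseteq> V" and A: "\<And>e. e \<in> A \<Longrightarrow> en e \<subseteq> V'"
  shows "graph_rank \<lparr>verts = V', edges = A, ends = en\<rparr> = graph_rank \<lparr>verts = V, edges = A, ends = en\<rparr>"
proof -
  let ?G = "\<lparr>verts = V, edges = A, ends = en\<rparr>" and ?G' = "\<lparr>verts = V', edges = A, ends = en\<rparr>"
  have joined: "joined ?G = joined ?G'"
  proof -
    have "u \<in> V' \<and> v \<in> V'" if "e \<in> A" "en e = {u, v}" for e u v
      using A[OF that(1)] that(2) by simp
    then show ?thesis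
      using V(2) unfolding joined_def mgraph.simps by blast
  qed
  have j: "joined ?G \<subseteq> V' \<times> V'"
    using joined by (auto simp: joined_def)
  have cls: "reachable ?G `` {v} = {v}" if "v \<in> V - V'" for v
  proof -
    have "w = v" if "(v, w) \<in> (joined ?G)\<^sup>*" for w
      using that \<open>v \<in> V - V'\<close> j by (cases rule: converse_rtranclE) auto
    then show ?thesis
      using that by (auto simp: reachable_def)
  qed
  have cls': "reachable ?G `` {v} = reachable ?G' `` {v}" if "v \<in> V'" for v
  proof -
    have "w \<in> V'" if "(v, w) \<in> (joined ?G)\<^sup>*" for w
      using that \<open>v \<in> V'\<close> j by (cases rule: rtranclE) auto
    then show ?thesis
      using that V joined by (auto simp: reachable_def)
  qed
  have "V // reachable ?G = (\<lambda>v. reachable ?G `` {v}) ` (V' \<union> (V - V'))"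
    using V by (auto simp: quotient_def Un_absorb1)
  also have "\<dots> = V' // reachable ?G' \<union> (\<lambda>v. {v}) ` (V - V')"
    unfolding image_Un using cls cls' by (auto simp: quotient_def)
  finally have eq: "V // reachable ?G = V' // reachable ?G' \<union> (\<lambda>v. {v}) ` (V - V')" .
  have eqv': "equiv V' (reachable ?G')"
    using equiv_reachable[of ?G'] by simp
  have fin: "finite (V' // reachable ?G')"
    using V eqv' by (meson finite_quotient equiv_type finite_subset)
  have "X \<subseteq> V'" if "X \<in> V' // reachable ?G'" for X
    using that by (auto simp: quotient_def reachable_def)
  then have "V' // reachable ?G' \<inter> (\<lambda>v. {v}) ` (V - V') = {}"
    by auto
  then have "card (V // reachable ?G) = card (V' // reachable ?G') + card (V - V')"
    using V fin by (simp add: eq card_Un_disjoint card_image)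
  moreover have "card V = card V' + card (V - V')"
    using V by (metis card_Diff_subset card_mono finite_subset le_add_diff_inverse)
  ultimately show ?thesis
    by (simp add: graph_rank_def num_components_def)
qed

text \<open>The restriction to an edge set instead of a composition. Restricting twice is then literally the same as
  restricting once.\<close>

definition subgraph :: "('v, 'e) mgraph \<Rightarrow> 'e set \<Rightarrow> ('v, 'e) mgraph" where
  "subgraph G F = \<lparr>verts = (\<Union>e \<in> F. ends G e), edges = F, ends = ends G\<rparr>"

lemma edges_subgraph [simp]: "edges (subgraph G F) = F"
  by (simp add: subgraph_def)

lemma subgraph_subgraph: "subgraph (subgraph G F) F' = subgraph G F'"
  by (simp add: subgraph_def)

lemma restriction_eq_subgraph: "restriction G C = subgraph G (flat_of G C)"
  by (simp add: restriction_def subgraph_def)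

lemma finite_loopless_subgraph:
  assumes "finite_loopless G" "F \<subseteq> edges G"
  shows "finite_loopless (subgraph G F)"
proof -
  have "(\<Union>e \<in> F. ends G e) \<subseteq> verts G"
    using assms by (auto simp: finite_loopless_def)
  then show ?thesis
    using assms unfolding finite_loopless_def subgraph_def
    by (auto intro: finite_subset)
qed

lemma edge_rank_subgraph:
  assumes "finite_loopless G" "F \<subseteq> edges G" "A \<subseteq> F"
  shows "edge_rank (subgraph G F) A = edge_rank G A"
proof -
  have "(\<Union>e \<in> F. ends G e) \<subseteq> verts G" "finite (verts G)"
    using assms by (auto simp: finite_loopless_def)
  then show ?thesis
    unfolding edge_rank_def subgraph_def mgraph.simps
    using assms by (intro graph_rank_isolated_vertices) auto
qed

lemma graph_rank_subgraph:
  "finite_loopless G \<Longrightarrow> F \<subseteq> edges G \<Longrightarrow> graph_rank (subgraph G F) = edge_rank G F"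
  by (simp add: graph_rank_eq edge_rank_subgraph)

lemma flats_subgraph:
  assumes G: "finite_loopless G" and F: "F \<in> flats G"
  shows "flats (subgraph G F) = {A \<in> flats G. A \<subseteq> F}"
proof (intro set_eqI iffI)
  have sub: "F \<subseteq> edges G"
    using F by (rule flats_subset)
  fix A
  have *: "A \<in> flats (subgraph G F) \<longleftrightarrow> A \<subseteq> F \<and> (\<forall>e \<in> F - A. edge_rank G A < edge_rank G (insert e A))"
  proof (cases "A \<subseteq> F")
    case True
    then have "edge_rank (subgraph G F) (insert e A) = edge_rank G (insert e A)" if "e \<in> F" for e
      using that by (intro edge_rank_subgraph[OF G sub]) auto
    then show ?thesis
      using True edge_rank_subgraph[OF G sub True] by (auto simp: flats_def)
  qed (simp add: flats_def)
  {
    assume "A \<in> {A \<in> flats G. A \<subseteq> F}"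
    then show "A \<in> flats (subgraph G F)"
      using sub unfolding * by (auto simp: flats_def)
  }
  assume A: "A \<in> flats (subgraph G F)"
  have "edge_rank G A < edge_rank G (insert e A)" if eF: "e \<in> edges G - F" for e
  proof -
    obtain u v where e: "ends G e = {u, v}" "u \<in> verts G" "v \<in> verts G"
      using G eF by (auto elim: finite_loopless_ends)
    have fin: "finite (verts G)"
      using G by (simp add: finite_loopless_def)
    have "(u, v) \<notin> conn G F"
      using F eF edge_rank_insert_less_iff[OF fin e] by (auto simp: flats_def)
    then show ?thesis
      using A conn_mono[of A F G] edge_rank_insert_less_iff[OF fin e] by (auto simp: *)
  qed
  then show "A \<in> {A \<in> flats G. A \<subseteq> F}"
    using A sub unfolding * by (auto simp: flats_def)
qed

text \<open>A part of a composition is connected inside itself, hence by edges of the flat; and edges of the flat do not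
  leave the parts.\<close>

lemma conn_flat_of:
  assumes G: "finite_loopless G" and C: "C \<in> compositions G"
  shows "conn G (flat_of G C) = {(u, v). \<exists>W \<in> C. u \<in> W \<and> v \<in> W}"
proof
  have part: "partition_on (verts G) C" and con: "\<And>W. W \<in> C \<Longrightarrow> connected_graph (induced G W)"
    using C by (auto simp: compositions_def)
  show "conn G (flat_of G C) \<subseteq> {(u, v). \<exists>W \<in> C. u \<in> W \<and> v \<in> W}"
    by (rule conn_least[OF equiv_partition_on[OF part]]) (auto simp: flat_of_def)
  show "{(u, v). \<exists>W \<in> C. u \<in> W \<and> v \<in> W} \<subseteq> conn G (flat_of G C)"
  proof clarify
    fix u v W assume W: "W \<in> C" "u \<in> W" "v \<in> W"
    let ?R = "reachable (induced G W)"
    have eqv: "equiv W ?R"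
      using equiv_reachable[of "induced G W"] by (simp add: induced_def)
    have "card (W // ?R) = 1"
      using con[OF W(1)] by (simp add: connected_graph_def num_components_def induced_def)
    then have "?R `` {u} = ?R `` {v}"
      using W by (metis card_1_singletonE quotientI singletonD)
    then have "(u, v) \<in> ?R"
      using eqv W by (simp add: eq_equiv_class_iff)
    moreover have "?R \<subseteq> conn G (flat_of G C)"
    proof (rule reachable_least[OF equiv_conn])
      show "verts (induced G W) \<subseteq> verts G"
        using part W by (auto simp: induced_def partition_on_def)
      then show "(u, v) \<in> conn G (flat_of G C)" if "e \<in> edges (induced G W)" "ends (induced G W) e = {u, v}"
          "u \<in> verts (induced G W)" "v \<in> verts (induced G W)" for e u v
        using that W by (intro conn_edge[of e]) (auto simp: induced_def flat_of_def)
    qed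
    ultimately show "(u, v) \<in> conn G (flat_of G C)"
      by blast
  qed
qed

lemma quotient_conn_flat_of:
  assumes "finite_loopless G" "C \<in> compositions G"
  shows "verts G // conn G (flat_of G C) = C"
  using assms by (simp add: conn_flat_of partition_on_eq_quotient compositions_def)

lemma flat_of_in_flats:
  assumes "finite_loopless G" "C \<in> compositions G"
  shows "flat_of G C \<in> flats G"
  using assms by (auto simp: flats_iff_closed conn_flat_of) (auto simp: flat_of_def)

text \<open>The inverse of the passage from compositions to flats: the components of a flat.\<close>

lemma composition_of_flat:
  assumes G: "finite_loopless G" and F: "F \<in> flats G"
  shows "verts G // conn G F \<in> compositions G" and "flat_of G (verts G // conn G F) = F"
proof -
  have F_sub: "F \<subseteq> edges G"
    and closed: "\<And>e u v. e \<in> edges G \<Longrightarrow> ends G e = {u, v} \<Longrightarrow> (u, v) \<in> conn G F \<Longrightarrow> e \<in> F"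
    using F flats_iff_closed[OF G] by auto
  have ends: "\<exists>u v. ends G e = {u, v} \<and> (u, v) \<in> conn G F" if "e \<in> F" for e
  proof -
    obtain u v where "ends G e = {u, v}" "u \<in> verts G" "v \<in> verts G"
      using F_sub \<open>e \<in> F\<close> by (auto intro: finite_loopless_ends[OF G])
    then show ?thesis
      using \<open>e \<in> F\<close> by (blast intro: conn_edge)
  qed
  have "connected_graph (induced G W)" if W: "W \<in> verts G // conn G F" for W
  proof -
    obtain w where w: "w \<in> verts G" "W = conn G F `` {w}"
      using W by (auto simp: quotient_def)
    then have W_verts: "W \<subseteq> verts G"
      by (auto dest: conn_verts)
    have stay: "x \<in> W \<longleftrightarrow> y \<in> W" if "(x, y) \<in> conn G F" for x y
      using that w by (auto dest: conn_trans conn_sym)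
    let ?R = "reachable (induced G W)"
    have eqv: "equiv W ?R"
      using equiv_reachable[of "induced G W"] by (simp add: induced_def)
    \<comment> \<open>A path of edges of \<open>F\<close> that starts in \<open>W\<close> never leaves \<open>W\<close>.\<close>
    \<comment> \<open>The complement of \<open>W\<close> is lumped together to obtain an equivalence relation on all vertices.\<close>
    let ?S = "?R \<union> (verts G - W) \<times> (verts G - W)"
    have "equiv (verts G) ?S"
      using eqv W_verts unfolding equiv_def refl_on_def sym_def trans_def by blast
    moreover have "(x, y) \<in> ?S" if "e \<in> F" "ends G e = {x, y}" "x \<in> verts G" "y \<in> verts G" for e x y
    proof (cases "x \<in> W")
      case True
      have "(x, y) \<in> conn G F"
        using that by (auto intro: conn_edge)
      then have "y \<in> W"
        using stay True by blast
      then show ?thesis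
        using True that F_sub by (auto simp: induced_def intro!: reachable_edge[of e])
    next
      case False
      have "(x, y) \<in> conn G F"
        using that by (auto intro: conn_edge)
      then have "y \<notin> W"
        using stay False by blast
      then show ?thesis
        using False that by auto
    qed
    ultimately have "conn G F \<subseteq> ?S"
      by (rule conn_least)
    then have "W \<subseteq> ?R `` {w}"
      using w conn_refl[of w G F] by auto
    moreover have "w \<in> W"
      using w by (auto intro: conn_refl)
    ultimately have "?R `` {v} = W" if "v \<in> W" for v
      using eqv that equiv_type[OF eqv] equiv_class_eq[OF eqv, of w v] by auto
    then have "W // ?R = {W}"
      using \<open>w \<in> W\<close> by (auto simp: quotient_def)
    then show ?thesis
      by (simp add: connected_graph_def num_components_def induced_def)
  qed
  then show "verts G // conn G F \<in> compositions G"
    by (auto simp: compositions_def intro: partition_on_quotient[OF equiv_conn])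
  show "flat_of G (verts G // conn G F) = F"
  proof (intro set_eqI iffI)
    fix e assume "e \<in> flat_of G (verts G // conn G F)"
    then obtain w where w: "e \<in> edges G" "ends G e \<subseteq> conn G F `` {w}"
      by (auto simp: flat_of_def elim!: quotientE)
    moreover obtain u v where "ends G e = {u, v}"
      using G w by (auto elim: finite_loopless_ends)
    ultimately show "e \<in> F"
      using closed[of e u v] conn_sym[of w u] conn_trans[of u w G F v] by auto
  next
    fix e assume e: "e \<in> F"
    then obtain u v where uv: "ends G e = {u, v}" "(u, v) \<in> conn G F"
      using ends by blast
    then have "conn G F `` {u} \<in> verts G // conn G F" "ends G e \<subseteq> conn G F `` {u}"
      by (auto intro: quotientI conn_refl dest: conn_verts)
    then show "e \<in> flat_of G (verts G // conn G F)"
      using e F_sub by (auto simp: flat_of_def)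
  qed
qed

lemma bij_betw_flat_of:
  assumes "finite_loopless G"
  shows "bij_betw (flat_of G) (compositions G) (flats G)"
  by (rule bij_betw_byWitness[of _ "\<lambda>F. verts G // conn G F"])
    (use assms in \<open>auto simp: quotient_conn_flat_of composition_of_flat flat_of_in_flats\<close>)

lemma card_composition:
  assumes "finite_loopless G" "C \<in> compositions G"
  shows "card C = card (verts G) - edge_rank G (flat_of G C)"
  using assms card_conn_eq[of G "flat_of G C"] by (simp add: quotient_conn_flat_of finite_loopless_def)

text \<open>In \<open>G/C\<close> an edge joins the components of its old ends.\<close>

lemma contraction_ends:
  assumes G: "finite_loopless G" and C: "C \<in> compositions G" and e: "ends G e = {u, v}" "u \<in> verts G" "v \<in> verts G"
  shows "ends (contraction G C) e = {conn G (flat_of G C) `` {u}, conn G (flat_of G C) `` {v}}"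
proof -
  let ?R = "conn G (flat_of G C)"
  have "{W \<in> C. x \<in> W} = {?R `` {x}}" if "x \<in> verts G" for x
  proof -
    have "W = ?R `` {x}" if "W \<in> C" "x \<in> W" for W
      using quotient_conn_flat_of[OF G C] that equiv_class_eq[OF equiv_conn]
      by (metis (no_types, lifting) Image_singleton_iff quotientE)
    moreover have "?R `` {x} \<in> C" "x \<in> ?R `` {x}"
      using quotient_conn_flat_of[OF G C] that by (auto intro: quotientI conn_refl)
    ultimately show ?thesis
      by blast
  qed
  then have "{W \<in> C. u \<in> W} \<union> {W \<in> C. v \<in> W} = {?R `` {u}, ?R `` {v}}"
    using e by auto
  moreover have "ends (contraction G C) e = {W \<in> C. u \<in> W} \<union> {W \<in> C. v \<in> W}"
    by (auto simp: contraction_def e)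
  ultimately show ?thesis
    by simp
qed

lemma finite_loopless_contraction:
  assumes G: "finite_loopless G" and C: "C \<in> compositions G"
  shows "finite_loopless (contraction G C)"
proof -
  let ?R = "conn G (flat_of G C)"
  have "finite C"
    using G quotient_conn_flat_of[OF G C] finite_quotient[OF _ equiv_type[OF equiv_conn]]
    by (metis finite_loopless_def)
  moreover have "ends (contraction G C) e \<subseteq> C \<and> card (ends (contraction G C) e) = 2"
    if e: "e \<in> edges G - flat_of G C" for e
  proof -
    obtain u v where uv: "ends G e = {u, v}" "u \<in> verts G" "v \<in> verts G"
      using G e by (auto elim: finite_loopless_ends)
    then have "(u, v) \<notin> ?R"
      using flat_of_in_flats[OF G C] e flats_iff_closed[OF G] by blast
    then have "?R `` {u} \<noteq> ?R `` {v}"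
      using uv by (simp add: eq_equiv_class_iff[OF equiv_conn])
    moreover have "?R `` {u} \<in> C" "?R `` {v} \<in> C"
      using uv quotient_conn_flat_of[OF G C] by (auto intro: quotientI)
    ultimately show ?thesis
      by (simp add: contraction_ends[OF G C uv])
  qed
  ultimately show ?thesis
    using G unfolding finite_loopless_def by (simp add: contraction_def)
qed

lemma edges_contraction: "edges (contraction G C) = edges G - flat_of G C"
  by (simp add: contraction_def)

text \<open>Mapping a vertex to the component of its part in \<open>G/C\<close> identifies exactly those vertices that are
  connected by \<open>A\<close> together with the contracted flat.\<close>

lemma card_conn_contraction:
  assumes G: "finite_loopless G" and C: "C \<in> compositions G" and A: "A \<subseteq> edges G - flat_of G C"
  shows "card (C // conn (contraction G C) A) = card (verts G // conn G (A \<union> flat_of G C))"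
proof -
  let ?F = "flat_of G C" and ?K = "contraction G C"
  define cls where "cls v = conn G ?F `` {v}" for v
  define f where "f v = conn ?K A `` {cls v}" for v
  have verts_K [simp]: "verts ?K = C"
    by (simp add: contraction_def)
  have C_eq: "C = cls ` verts G"
  proof -
    have "verts G // conn G ?F = cls ` verts G"
      unfolding quotient_def cls_def by auto
    then show ?thesis
      using quotient_conn_flat_of[OF G C] by (rule trans[OF sym, rotated])
  qed
  have cls_eq: "cls u = cls v \<longleftrightarrow> (u, v) \<in> conn G ?F" if "u \<in> verts G" "v \<in> verts G" for u v
    using that by (simp add: cls_def eq_equiv_class_iff[OF equiv_conn])
  have cls_C: "cls v \<in> C" if "v \<in> verts G" for v
    using that by (simp add: C_eq)
  have eqvK: "equiv C (conn ?K A)"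
    using equiv_conn[of ?K A] by simp
  have f_eq: "f u = f v \<longleftrightarrow> (cls u, cls v) \<in> conn ?K A" if "u \<in> verts G" "v \<in> verts G" for u v
  proof -
    show ?thesis
      unfolding f_def by (rule eq_equiv_class_iff[OF eqvK cls_C cls_C]) (use that in simp_all)
  qed
  let ?S = "{(u, v). u \<in> verts G \<and> v \<in> verts G \<and> f u = f v}"
  have "conn G (A \<union> ?F) \<subseteq> ?S"
  proof (rule conn_least)
    show "equiv (verts G) ?S"
      by (auto simp: equiv_def refl_on_def sym_def trans_def)
    fix e u v assume e: "e \<in> A \<union> ?F" "ends G e = {u, v}" "u \<in> verts G" "v \<in> verts G"
    have "(cls u, cls v) \<in> conn ?K A"
    proof (cases "e \<in> A")
      case True
      then show ?thesis
        using contraction_ends[OF G C e(2-4)] cls_C e by (intro conn_edge[of e]) (simp_all add: cls_def)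
    next
      case False
      then have "cls u = cls v"
        using e by (subst cls_eq) (auto intro: conn_edge)
      then show ?thesis
        using cls_C e conn_refl[of "cls v" ?K A] by simp
    qed
    then show "(u, v) \<in> ?S"
      using e f_eq by auto
  qed
  moreover have "?S \<subseteq> conn G (A \<union> ?F)"
  proof -
    let ?T = "{(W, W'). \<exists>u \<in> verts G. \<exists>v \<in> verts G. W = cls u \<and> W' = cls v \<and> (u, v) \<in> conn G (A \<union> ?F)}"
    have cls_conn: "(u, v) \<in> conn G (A \<union> ?F)" if "cls u = cls v" "u \<in> verts G" "v \<in> verts G" for u v
      using that cls_eq conn_mono[of ?F "A \<union> ?F" G] by auto
    have T: "(cls u, cls v) \<in> ?T \<longleftrightarrow> (u, v) \<in> conn G (A \<union> ?F)" if uv: "u \<in> verts G" "v \<in> verts G" for u v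
    proof
      assume "(cls u, cls v) \<in> ?T"
      then obtain u' v' where "u' \<in> verts G" "v' \<in> verts G" "cls u = cls u'" "cls v = cls v'" "(u', v') \<in> conn G (A \<union> ?F)"
        by auto
      then show "(u, v) \<in> conn G (A \<union> ?F)"
        using uv cls_conn[of u u'] cls_conn[of v' v] by (auto intro: conn_trans)
    qed (use uv in auto)
    have "conn ?K A \<subseteq> ?T"
    proof (rule conn_least)
      show "equiv (verts ?K) ?T"
      proof (rule equivI)
        show "?T \<subseteq> verts ?K \<times> verts ?K"
          using cls_C by auto
        show "refl_on (verts ?K) ?T"
        proof (rule refl_onI)
          fix X assume "X \<in> verts ?K"
          then obtain v where "v \<in> verts G" "X = cls v"
            unfolding verts_K by (auto simp: C_eq)
          then show "(X, X) \<in> ?T"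
            using T by (simp add: conn_refl)
        qed
        show "sym ?T"
          by (auto simp: sym_def intro: conn_sym)
        show "trans ?T"
        proof (rule transI)
          fix X Y Z assume "(X, Y) \<in> ?T" "(Y, Z) \<in> ?T"
          then obtain u v v' w where *: "u \<in> verts G" "v \<in> verts G" "v' \<in> verts G" "w \<in> verts G"
              "X = cls u" "Y = cls v" "Y = cls v'" "Z = cls w"
              "(u, v) \<in> conn G (A \<union> ?F)" "(v', w) \<in> conn G (A \<union> ?F)"
            by fastforce
          have "(u, w) \<in> conn G (A \<union> ?F)"
            using * cls_conn[of v v'] by (auto intro: conn_trans)
          then show "(X, Z) \<in> ?T"
            using * T by simp
        qed
      qed
      fix e X Y assume e: "e \<in> A" "ends ?K e = {X, Y}"
      then obtain u v where uv: "ends G e = {u, v}" "u \<in> verts G" "v \<in> verts G"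
        using G A by (meson DiffD1 finite_loopless_ends subsetD)
      then have "{X, Y} = {cls u, cls v}"
        using contraction_ends[OF G C uv] e by (simp add: cls_def)
      moreover have "(u, v) \<in> conn G (A \<union> ?F)"
        using uv e by (auto intro: conn_edge)
      ultimately show "(X, Y) \<in> ?T"
        using T[OF uv(2,3)] T[OF uv(3,2)] conn_sym[of u v G] unfolding doubleton_eq_iff by blast
    qed
    then have "(u, v) \<in> conn G (A \<union> ?F)" if "u \<in> verts G" "v \<in> verts G" "f u = f v" for u v
      using T[OF that(1,2)] f_eq[OF that(1,2)] that(3) by (meson subsetD)
    then show ?thesis
      by auto
  qed
  ultimately have "conn G (A \<union> ?F) = ?S"
    by (rule antisym)
  then have "card (verts G // conn G (A \<union> ?F)) = card (f ` verts G)"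
    by (intro card_quotient_kernel) auto
  also have "f ` verts G = C // conn ?K A"
    unfolding quotient_def f_def by (subst C_eq) auto
  finally show ?thesis ..
qed

lemma edge_rank_contraction:
  assumes G: "finite_loopless G" and C: "C \<in> compositions G" and A: "A \<subseteq> edges G - flat_of G C"
  shows "edge_rank (contraction G C) A = edge_rank G (A \<union> flat_of G C) - edge_rank G (flat_of G C)"
proof -
  have fin: "finite (verts G)"
    using G by (simp add: finite_loopless_def)
  have "verts (contraction G C) = C"
    by (simp add: contraction_def)
  then show ?thesis
    using card_conn_contraction[OF G C A] quotient_conn_flat_of[OF G C]
      card_conn_le[OF fin, of "flat_of G C"] card_conn_le[OF fin, of "A \<union> flat_of G C"]
    by (simp add: edge_rank_eq)
qed

text \<open>The rank of \<open>A\<close> in \<open>G/C\<close> is the rank of \<open>A \<union> F\<close> in \<open>G\<close> up to a constant, where \<open>F\<close> is the contracted flat.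
  So flats above \<open>F\<close> become flats of \<open>G/C\<close> when \<open>F\<close> is removed from them.\<close>

lemma flats_contraction:
  assumes G: "finite_loopless G" and C: "C \<in> compositions G"
  shows "flats (contraction G C) = (\<lambda>F. F - flat_of G C) ` {F \<in> flats G. flat_of G C \<subseteq> F}"
proof -
  let ?F = "flat_of G C" and ?K = "contraction G C"
  have fin: "finite (verts G)"
    using G by (simp add: finite_loopless_def)
  have F: "?F \<in> flats G"
    by (rule flat_of_in_flats[OF G C])
  have less: "edge_rank ?K A < edge_rank ?K (insert e A) \<longleftrightarrow>
      edge_rank G (A \<union> ?F) < edge_rank G (insert e (A \<union> ?F))" if "A \<subseteq> edges G - ?F" "e \<in> edges G - ?F" for A e
    using that edge_rank_contraction[OF G C, of A] edge_rank_contraction[OF G C, of "insert e A"]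
      edge_rank_mono[OF fin, of ?F "A \<union> ?F"] edge_rank_mono[OF fin, of ?F "insert e (A \<union> ?F)"]
    by auto
  have iff: "A \<in> flats ?K \<longleftrightarrow> A \<subseteq> edges G - ?F \<and> A \<union> ?F \<in> flats G" for A
  proof (cases "A \<subseteq> edges G - ?F")
    case True
    have "A \<in> flats ?K \<longleftrightarrow> (\<forall>e \<in> edges G - (A \<union> ?F). edge_rank ?K A < edge_rank ?K (insert e A))"
      using True by (auto simp: flats_def edges_contraction)
    also have "\<dots> \<longleftrightarrow> (\<forall>e \<in> edges G - (A \<union> ?F). edge_rank G (A \<union> ?F) < edge_rank G (insert e (A \<union> ?F)))"
      using less[OF True] by auto
    also have "\<dots> \<longleftrightarrow> A \<union> ?F \<in> flats G"
      using True flats_subset[OF F] by (auto simp: flats_def)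
    finally show ?thesis
      using True by simp
  qed (auto simp: flats_def edges_contraction)
  show ?thesis
  proof (intro set_eqI iffI)
    fix A assume "A \<in> flats ?K"
    then have "A = (A \<union> ?F) - ?F" "A \<union> ?F \<in> flats G"
      using iff by auto
    then show "A \<in> (\<lambda>F. F - ?F) ` {F \<in> flats G. ?F \<subseteq> F}"
      by (metis (mono_tags, lifting) Un_upper2 imageI mem_Collect_eq)
  next
    fix A assume "A \<in> (\<lambda>F. F - ?F) ` {F \<in> flats G. ?F \<subseteq> F}"
    then obtain B where B: "A = B - ?F" "B \<in> flats G" "?F \<subseteq> B"
      by auto
    then have "A \<union> ?F = B"
      by auto
    then show "A \<in> flats ?K"
      using B flats_subset[of B G] iff by auto
  qed
qed

lemma moebius_contraction:
  assumes G: "finite_loopless G" and C: "C \<in> compositions G" and B: "B \<in> flats G" "flat_of G C \<subseteq> B"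
  shows "moebius (flats (contraction G C)) {} (B - flat_of G C) = moebius (flats G) (flat_of G C) B"
proof -
  let ?F = "flat_of G C"
  have "moebius (flats (contraction G C)) (?F - ?F) (B - ?F) = moebius (flats G) ?F B"
    by (rule moebius_order_iso)
      (use B G C in \<open>auto simp: finite_flats finite_loopless_contraction flat_of_in_flats flats_contraction\<close>)
  then show ?thesis
    by simp
qed

section \<open>The chromatic polynomial as a Moebius sum\<close>

text \<open>The edges with equally coloured ends. They always form a flat, and a colouring is proper if this flat
  is empty.\<close>

definition mono_edges :: "('v, 'e) mgraph \<Rightarrow> ('v \<Rightarrow> nat) \<Rightarrow> 'e set" where
  "mono_edges G f = {e \<in> edges G. \<forall>u v. ends G e = {u, v} \<longrightarrow> f u = f v}"

lemma subset_mono_edges_iff: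
  assumes G: "finite_loopless G" and A: "A \<subseteq> edges G"
  shows "A \<subseteq> mono_edges G f \<longleftrightarrow> (\<forall>(u, v) \<in> conn G A. f u = f v)"
proof
  assume sub: "A \<subseteq> mono_edges G f"
  have "conn G A \<subseteq> {(u, v). u \<in> verts G \<and> v \<in> verts G \<and> f u = f v}"
  proof (rule conn_least)
    show "equiv (verts G) {(u, v). u \<in> verts G \<and> v \<in> verts G \<and> f u = f v}"
      by (auto simp: equiv_def refl_on_def sym_def trans_def)
  qed (use sub in \<open>auto simp: mono_edges_def\<close>)
  then show "\<forall>(u, v) \<in> conn G A. f u = f v"
    by auto
next
  assume eq: "\<forall>(u, v) \<in> conn G A. f u = f v"
  show "A \<subseteq> mono_edges G f"
  proof
    fix e assume e: "e \<in> A"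
    have "f u = f v" if "ends G e = {u, v}" for u v
    proof -
      have "ends G e \<subseteq> verts G"
        using G A e by (auto simp: finite_loopless_def)
      then have "u \<in> verts G" "v \<in> verts G"
        using that by auto
      then have "(u, v) \<in> conn G A"
        using e that by (auto intro: conn_edge)
      then show ?thesis
        using eq by auto
    qed
    then show "e \<in> mono_edges G f"
      using e A by (auto simp: mono_edges_def)
  qed
qed

lemma mono_edges_in_flats:
  assumes G: "finite_loopless G"
  shows "mono_edges G f \<in> flats G"
proof -
  have "mono_edges G f \<subseteq> edges G"
    by (auto simp: mono_edges_def)
  then have const: "f u = f v" if "(u, v) \<in> conn G (mono_edges G f)" for u v
    using that subset_mono_edges_iff[OF G, of "mono_edges G f" f] by auto
  have "e \<in> mono_edges G f"
    if "e \<in> edges G" "ends G e = {u, v}" "(u, v) \<in> conn G (mono_edges G f)" for e u v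
    using that(1,2) const[OF that(3)] unfolding mono_edges_def by (auto simp: doubleton_eq_iff)
  then show ?thesis
    unfolding flats_iff_closed[OF G] using \<open>mono_edges G f \<subseteq> edges G\<close> by blast
qed

lemma card_colorings_constant_on_classes:
  assumes V: "finite V" and R: "equiv V R"
  shows "card {f \<in> V \<rightarrow>\<^sub>E {..<q::nat}. \<forall>(u, v) \<in> R. f u = f v} = q ^ card (V // R)"
proof -
  let ?S = "{f \<in> V \<rightarrow>\<^sub>E {..<q}. \<forall>(u, v) \<in> R. f u = f v}"
  let ?h = "\<lambda>g. \<lambda>v\<in>V. g (R `` {v})"
  have cls: "R `` {v} \<in> V // R" if "v \<in> V" for v
    using that by (rule quotientI)
  have R_V: "u \<in> V" "v \<in> V" "R `` {u} = R `` {v}" if "(u, v) \<in> R" for u v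
    using that R equiv_type[OF R] by (auto simp: equiv_class_eq)
  have "bij_betw ?h (V // R \<rightarrow>\<^sub>E {..<q}) ?S"
    unfolding bij_betw_def
  proof
    show "inj_on ?h (V // R \<rightarrow>\<^sub>E {..<q})"
    proof (rule inj_onI)
      fix g g' assume g: "g \<in> V // R \<rightarrow>\<^sub>E {..<q}" "g' \<in> V // R \<rightarrow>\<^sub>E {..<q}" and eq: "?h g = ?h g'"
      show "g = g'"
      proof (rule PiE_ext[OF g])
        fix X assume "X \<in> V // R"
        then obtain v where "v \<in> V" "X = R `` {v}"
          by (auto simp: quotient_def)
        then show "g X = g' X"
          using fun_cong[OF eq, of v] by simp
      qed
    qed
    show "?h ` (V // R \<rightarrow>\<^sub>E {..<q}) = ?S"
    proof (intro equalityI subsetI)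
      fix f assume "f \<in> ?h ` (V // R \<rightarrow>\<^sub>E {..<q})"
      then obtain g where "g \<in> V // R \<rightarrow>\<^sub>E {..<q}" "f = ?h g"
        by auto
      then show "f \<in> ?S"
        using cls R_V by (auto simp: PiE_iff)
    next
      fix f assume f: "f \<in> ?S"
      define g where "g = (\<lambda>X \<in> V // R. f (SOME v. v \<in> X))"
      have g_cls: "g (R `` {v}) = f v" if v: "v \<in> V" for v
      proof -
        have "v \<in> R `` {v}"
          using R v by (auto simp: equiv_def refl_on_def)
        then have "(SOME w. w \<in> R `` {v}) \<in> R `` {v}"
          by (rule someI)
        then have "(v, SOME w. w \<in> R `` {v}) \<in> R"
          by blast
        then have "f v = f (SOME w. w \<in> R `` {v})"
          using f by blast
        then show ?thesis
          using cls[OF v] by (simp add: g_def)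
      qed
      have "g \<in> V // R \<rightarrow>\<^sub>E {..<q}"
      proof (rule PiE_I)
        fix X assume "X \<in> V // R"
        then obtain v where "v \<in> V" "X = R `` {v}"
          by (auto simp: quotient_def)
        then show "g X \<in> {..<q}"
          using f g_cls by (auto simp: PiE_iff)
      qed (simp add: g_def)
      moreover have "f = ?h g"
        using f g_cls by (auto simp: PiE_iff extensional_def fun_eq_iff)
      ultimately show "f \<in> ?h ` (V // R \<rightarrow>\<^sub>E {..<q})"
        by blast
    qed
  qed
  then have "card ?S = card (V // R \<rightarrow>\<^sub>E {..<q})"
    by (simp add: bij_betw_same_card)
  also have "\<dots> = q ^ card (V // R)"
    using V equiv_type[OF R] by (simp add: card_PiE finite_quotient)
  finally show ?thesis .
qed

text \<open>The sum of \<open>\<mu>({}, F)\<close> over the flats \<open>F\<close> inside the flat of monochromatic edges of a colouring is \<open>1\<close> if that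
  flat is empty and \<open>0\<close> otherwise. Summation over all colourings and exchange of the sums give the formula,
  because a colouring with \<open>F\<close> monochromatic is a colouring of the components of \<open>F\<close>.\<close>

lemma card_proper_colorings:
  assumes G: "finite_loopless G"
  shows "int (card (proper_colorings G q)) =
    (\<Sum>F \<in> flats G. moebius (flats G) {} F * int q ^ card (verts G // conn G F))"
proof -
  let ?Col = "verts G \<rightarrow>\<^sub>E {..<q}"
  have fin: "finite ?Col" "finite (flats G)"
    using G finite_flats by (auto simp: finite_loopless_def intro!: finite_PiE)
  have "(\<Sum>F \<in> flats G. moebius (flats G) {} F * int q ^ card (verts G // conn G F))
    = (\<Sum>F \<in> flats G. \<Sum>f \<in> {f \<in> ?Col. F \<subseteq> mono_edges G f}. moebius (flats G) {} F)"
  proof (rule sum.cong)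
    fix F assume "F \<in> flats G"
    then have "F \<subseteq> mono_edges G f \<longleftrightarrow> (\<forall>(u, v) \<in> conn G F. f u = f v)" for f
      by (intro subset_mono_edges_iff[OF G] flats_subset)
    then have "{f \<in> ?Col. F \<subseteq> mono_edges G f} = {f \<in> ?Col. \<forall>(u, v) \<in> conn G F. f u = f v}"
      by simp
    moreover have "finite (verts G)"
      using G by (simp add: finite_loopless_def)
    ultimately have "card {f \<in> ?Col. F \<subseteq> mono_edges G f} = q ^ card (verts G // conn G F)"
      by (simp only: card_colorings_constant_on_classes[OF _ equiv_conn])
    then show "moebius (flats G) {} F * int q ^ card (verts G // conn G F)
      = (\<Sum>f \<in> {f \<in> ?Col. F \<subseteq> mono_edges G f}. moebius (flats G) {} F)"
      by simp
  qed simp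
  also have "\<dots> = (\<Sum>f \<in> ?Col. \<Sum>F \<in> {F \<in> flats G. F \<subseteq> mono_edges G f}. moebius (flats G) {} F)"
    using fin by (intro sum.swap_restrict) auto
  also have "\<dots> = (\<Sum>f \<in> ?Col. if mono_edges G f = {} then 1 else 0)"
    using moebius_sum[OF fin(2) empty_in_flats[OF G] mono_edges_in_flats[OF G]]
    by (intro sum.cong) (auto simp: eq_commute)
  also have "\<dots> = int (card {f \<in> ?Col. mono_edges G f = {}})"
    using fin by (simp add: sum.If_cases Int_def)
  also have "{f \<in> ?Col. mono_edges G f = {}} = proper_colorings G q"
  proof -
    have "mono_edges G f = {} \<longleftrightarrow> (\<forall>e \<in> edges G. \<forall>u v. ends G e = {u, v} \<longrightarrow> f u \<noteq> f v)" for f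
    proof -
      have "(\<forall>u v. ends G e = {u, v} \<longrightarrow> f u \<noteq> f v) \<longleftrightarrow> \<not> (\<forall>u v. ends G e = {u, v} \<longrightarrow> f u = f v)"
        if "e \<in> edges G" for e
      proof -
        obtain x y where xy: "ends G e = {x, y}"
          using finite_loopless_ends[OF G \<open>e \<in> edges G\<close>] by blast
        have "(\<forall>u v. ends G e = {u, v} \<longrightarrow> f u \<noteq> f v) \<longleftrightarrow> f x \<noteq> f y"
          "(\<forall>u v. ends G e = {u, v} \<longrightarrow> f u = f v) \<longleftrightarrow> f x = f y"
          unfolding xy doubleton_eq_iff by auto
        then show ?thesis
          by simp
      qed
      then show ?thesis
        by (auto simp: mono_edges_def)
    qed
    then show ?thesis
      by (auto simp: proper_colorings_def)
  qed
  finally show ?thesis ..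
qed

lemma int_poly_eqI:
  fixes p p' :: "int poly"
  assumes "\<And>q. poly p (int q) = poly p' (int q)"
  shows "p = p'"
proof (rule ccontr)
  assume "p \<noteq> p'"
  then have "finite {x. poly (p - p') x = 0}"
    by (intro poly_roots_finite) simp
  moreover have "range int \<subseteq> {x. poly (p - p') x = 0}"
    using assms by auto
  ultimately show False
    by (meson finite_subset infinite_UNIV_nat finite_imageD inj_of_nat)
qed

lemma chromatic_poly_eq:
  assumes "finite_loopless G"
  shows "chromatic_poly G =
    (\<Sum>F \<in> flats G. monom (moebius (flats G) {} F) (card (verts G) - edge_rank G F))"
proof -
  let ?p = "\<Sum>F \<in> flats G. monom (moebius (flats G) {} F) (card (verts G) - edge_rank G F)"
  have *: "poly ?p (int q) = int (card (proper_colorings G q))" for q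
    using assms card_conn_eq[of G]
    by (simp add: card_proper_colorings poly_sum poly_monom finite_loopless_def)
  show ?thesis
    unfolding chromatic_poly_def using * by (intro the_equality) (auto intro!: int_poly_eqI)
qed

lemma chromatic_poly_contraction:
  assumes G: "finite_loopless G" and C: "C \<in> compositions G"
  shows "chromatic_poly (contraction G C) =
    (\<Sum>F \<in> {F \<in> flats G. flat_of G C \<subseteq> F}.
      monom (moebius (flats G) (flat_of G C) F) (card (verts G) - edge_rank G F))"
proof -
  let ?F = "flat_of G C" and ?K = "contraction G C"
  have fin: "finite (verts G)"
    using G by (simp add: finite_loopless_def)
  have inj: "inj_on (\<lambda>F. F - ?F) {F \<in> flats G. ?F \<subseteq> F}"
    by (rule inj_onI) blast
  have "card (verts ?K) - edge_rank ?K (F - ?F) = card (verts G) - edge_rank G F"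
    if "F \<in> flats G" "?F \<subseteq> F" for F
  proof -
    have F: "F - ?F \<union> ?F = F" "F - ?F \<subseteq> edges G - ?F"
      using that flats_subset by auto
    have "edge_rank G ?F \<le> edge_rank G F"
      by (rule edge_rank_mono[OF fin that(2)])
    moreover have "card (verts ?K) = card (verts G) - edge_rank G ?F"
      using card_composition[OF G C] by (simp add: contraction_def)
    ultimately show ?thesis
      using F edge_rank_contraction[OF G C F(2)] by simp
  qed
  then show ?thesis
    unfolding chromatic_poly_eq[OF finite_loopless_contraction[OF G C]]
    unfolding flats_contraction[OF G C] sum.reindex[OF inj]
    using moebius_contraction[OF G C]
    by (intro sum.cong) (auto simp flip: flats_contraction[OF G C])
qed

section \<open>Existence and uniqueness of inverse Kazhdan--Lusztig polynomials\<close>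

text \<open>The inverse Z-polynomial by recursion on restrictions: the sum over the smaller flats is the known part of the
  inverse Kazhdan--Lusztig polynomial, and the palindromic completion is the only way to meet the degree bound.\<close>

function inverse_Z_rec :: "('v, 'e) mgraph \<Rightarrow> int poly" where
  "inverse_Z_rec G =
    (if \<not> finite_loopless G \<or> edges G = {} then 1
     else palindromic_completion (graph_rank G)
       (\<Sum>F \<in> flats G - {edges G}. [:0, -1:] ^ (graph_rank G - edge_rank G F) * inverse_Z_rec (subgraph G F)))"
  by pat_completeness auto
termination
proof (relation "measure (\<lambda>G. card (edges G))")
  fix G :: "('v, 'e) mgraph" and F
  assume "\<not> (\<not> finite_loopless G \<or> edges G = {})" and "F \<in> flats G - {edges G}"
  then have "finite (edges G)" "F \<subset> edges G"
    using flats_subset[of F G] by (auto simp: finite_loopless_def)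
  then show "(subgraph G F, G) \<in> measure (\<lambda>G. card (edges G))"
    by (simp add: psubset_card_mono)
qed simp

declare inverse_Z_rec.simps [simp del]

definition inverse_KL_rec :: "('v, 'e) mgraph \<Rightarrow> int poly" where
  "inverse_KL_rec G =
    (\<Sum>F \<in> flats G. [:0, -1:] ^ (graph_rank G - edge_rank G F) * inverse_Z_rec (subgraph G F))"

lemma rank_eq_0_iff:
  assumes "finite_loopless G"
  shows "graph_rank G = 0 \<longleftrightarrow> edges G = {}"
  using edge_rank_strict_mono[OF assms empty_in_flats[OF assms], of "edges G"] edge_rank_empty[of G]
  by (cases "edges G = {}") (auto simp: graph_rank_eq psubset_eq)

lemma edge_rank_le_rank:
  assumes "finite_loopless G" "F \<in> flats G"
  shows "edge_rank G F \<le> graph_rank G"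
  using assms by (simp add: graph_rank_eq edge_rank_mono flats_subset finite_loopless_def)

lemma flats_of_edgeless:
  assumes "edges G = {}"
  shows "flats G = {{}}"
  using assms by (auto simp: flats_def)

lemma palindromic_inverse_Z_rec: "finite_loopless G \<Longrightarrow> palindromic (graph_rank G) (inverse_Z_rec G)"
  using rank_eq_0_iff[of G]
  by (auto simp: inverse_Z_rec.simps[of G] palindromic_palindromic_completion palindromic_1)

lemma flats_subgraph_edges: "finite_loopless G \<Longrightarrow> flats (subgraph G (edges G)) = flats G"
  using flats_subset by (subst flats_subgraph) (auto simp: edges_in_flats)

text \<open>Restriction to all edges drops isolated vertices, so it may differ from \<open>G\<close> as a graph.\<close>

lemma inverse_Z_rec_subgraph_edges:
  assumes "finite_loopless G"
  shows "inverse_Z_rec (subgraph G (edges G)) = inverse_Z_rec G"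
proof -
  have "(\<Sum>F \<in> flats G - {edges G}. [:0, -1:] ^ (graph_rank G - edge_rank (subgraph G (edges G)) F) * inverse_Z_rec (subgraph G F))
    = (\<Sum>F \<in> flats G - {edges G}. [:0, -1:] ^ (graph_rank G - edge_rank G F) * inverse_Z_rec (subgraph G F))"
    using assms flats_subset by (intro sum.cong) (auto simp: edge_rank_subgraph)
  then show ?thesis
    using assms
    by (simp add: inverse_Z_rec.simps[of G] inverse_Z_rec.simps[of "subgraph G (edges G)"]
        finite_loopless_subgraph flats_subgraph_edges graph_rank_subgraph subgraph_subgraph flip: graph_rank_eq)
qed

lemma degree_power_neg_X: "degree ([:0, -1:] ^ d :: int poly) \<le> d"
  using degree_power_le[of "[:0, -1:] :: int poly" d] by simp

lemma KL_bounded_inverse_KL_rec: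
  assumes G: "finite_loopless G"
  shows "KL_bounded (graph_rank G) (inverse_KL_rec G)"
proof (cases "edges G = {}")
  case True
  then have "inverse_Z_rec (subgraph G {}) = 1" "graph_rank G = 0"
    using G rank_eq_0_iff by (auto simp: inverse_Z_rec.simps)
  then show ?thesis
    using True by (simp add: KL_bounded_def inverse_KL_rec_def flats_of_edgeless edge_rank_empty)
next
  case False
  let ?B = "\<Sum>F \<in> flats G - {edges G}. [:0, -1:] ^ (graph_rank G - edge_rank G F) * inverse_Z_rec (subgraph G F)"
  have "inverse_KL_rec G = inverse_Z_rec (subgraph G (edges G)) + ?B"
    using finite_flats[OF G] edges_in_flats[of G]
    by (simp add: inverse_KL_rec_def sum.remove[of _ "edges G"] graph_rank_eq)
  also have "\<dots> = ?B + palindromic_completion (graph_rank G) ?B"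
    using False G by (simp add: inverse_Z_rec_subgraph_edges inverse_Z_rec.simps[of G])
  finally have eq: "inverse_KL_rec G = ?B + palindromic_completion (graph_rank G) ?B" .
  have "degree ?B \<le> graph_rank G"
  proof (rule degree_sum_le)
    show "finite (flats G - {edges G})"
      using finite_flats[OF G] by simp
    fix F assume F: "F \<in> flats G - {edges G}"
    then have "palindromic (edge_rank G F) (inverse_Z_rec (subgraph G F))"
      using palindromic_inverse_Z_rec[of "subgraph G F"] G flats_subset[of F G]
      by (simp add: finite_loopless_subgraph graph_rank_subgraph)
    then have "degree (inverse_Z_rec (subgraph G F)) \<le> edge_rank G F"
      by (rule palindromic_degree)
    moreover have "edge_rank G F \<le> graph_rank G"
      using F G by (simp add: edge_rank_le_rank)
    ultimately show "degree ([:0, -1:] ^ (graph_rank G - edge_rank G F) * inverse_Z_rec (subgraph G F)) \<le> graph_rank G"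
      using degree_mult_le[of "[:0, -1:] ^ (graph_rank G - edge_rank G F)" "inverse_Z_rec (subgraph G F)"]
        degree_power_neg_X[of "graph_rank G - edge_rank G F"] by linarith
  qed
  moreover have "graph_rank G > 0"
    using False G rank_eq_0_iff by auto
  ultimately show ?thesis
    unfolding eq by (simp add: KL_bounded_def degree_palindromic_completion)
qed

lemma inverse_KL_rec_subgraph:
  assumes G: "finite_loopless G" and F: "F \<in> flats G"
  shows "inverse_KL_rec (subgraph G F) =
    (\<Sum>A \<in> {A \<in> flats G. A \<subseteq> F}. [:0, -1:] ^ (edge_rank G F - edge_rank G A) * inverse_Z_rec (subgraph G A))"
  using G flats_subset[OF F]
  by (simp add: inverse_KL_rec_def flats_subgraph[OF G F] graph_rank_subgraph edge_rank_subgraph subgraph_subgraph)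

text \<open>For \<open>Q\<close> the inverse Kazhdan--Lusztig polynomials, this is the inverse Z-polynomial of the restriction to \<open>F\<close>.\<close>

definition moebius_transform ::
    "(('v, 'e) mgraph \<Rightarrow> int poly) \<Rightarrow> ('v, 'e) mgraph \<Rightarrow> 'e set \<Rightarrow> int poly" where
  "moebius_transform Q G F =
    (\<Sum>A \<in> {A \<in> flats G. A \<subseteq> F}.
      of_int (moebius (flats G) A F) * [:0, -1:] ^ (edge_rank G F - edge_rank G A) * Q (subgraph G A))"

lemma moebius_transform_inversion:
  assumes G: "finite_loopless G"
  shows "(\<forall>F \<in> flats G. Q (subgraph G F) =
      (\<Sum>A \<in> {A \<in> flats G. A \<subseteq> F}. [:0, -1:] ^ (edge_rank G F - edge_rank G A) * y A)) \<longleftrightarrow>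
    (\<forall>F \<in> flats G. y F = moebius_transform Q G F)"
  unfolding moebius_transform_def
proof (rule moebius_inversion)
  have "finite (verts G)"
    using G by (simp add: finite_loopless_def)
  then show "[:0, -1:] ^ (edge_rank G A - edge_rank G B) * [:0, -1:] ^ (edge_rank G F - edge_rank G A)
      = ([:0, -1:] :: int poly) ^ (edge_rank G F - edge_rank G B)" if "B \<subseteq> A" "A \<subseteq> F" for A B F
    using that edge_rank_mono[of G B A] edge_rank_mono[of G A F] by (simp flip: power_add)
qed (simp_all add: finite_flats[OF G])

lemma moebius_transform_inverse_KL_rec:
  "finite_loopless G \<Longrightarrow> F \<in> flats G \<Longrightarrow> moebius_transform inverse_KL_rec G F = inverse_Z_rec (subgraph G F)"
  using moebius_transform_inversion[of G inverse_KL_rec "\<lambda>F. inverse_Z_rec (subgraph G F)"]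
  by (simp add: inverse_KL_rec_subgraph)

lemma moebius_transform_subgraph:
  assumes G: "finite_loopless G" and F: "F \<in> flats G" "A \<in> flats G" "A \<subseteq> F"
  shows "moebius_transform Q (subgraph G F) A = moebius_transform Q G A"
proof -
  have sub: "F \<subseteq> edges G"
    using F by (simp add: flats_subset)
  have "{B \<in> flats (subgraph G F). B \<subseteq> A} = {B \<in> flats G. B \<subseteq> A}"
    using F by (auto simp: flats_subgraph[OF G F(1)])
  moreover have "moebius (flats (subgraph G F)) B A = moebius (flats G) B A" if "B \<in> flats G" "B \<subseteq> A" for B
  proof -
    have "moebius (flats G) (id B) (id A) = moebius (flats (subgraph G F)) B A"
      by (rule moebius_order_iso)
        (use that F finite_flats[OF G] finite_flats[OF finite_loopless_subgraph[OF G sub]]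
          in \<open>auto simp: flats_subgraph[OF G F(1)]\<close>)
    then show ?thesis
      by simp
  qed
  ultimately show ?thesis
    unfolding moebius_transform_def using F
    by (auto intro!: sum.cong simp: edge_rank_subgraph[OF G sub] subgraph_subgraph)
qed

abbreviation real_poly :: "int poly \<Rightarrow> real poly" where
  "real_poly \<equiv> map_poly real_of_int"

lemma real_poly_sum: "real_poly (\<Sum>x \<in> A. f x) = (\<Sum>x \<in> A. real_poly (f x))"
  by (rule poly_eqI) (simp add: coeff_map_poly coeff_sum)

lemma real_poly_mult: "real_poly (p * q) = real_poly p * real_poly q"
  by (rule poly_eqI) (simp add: coeff_map_poly coeff_mult)

lemma real_poly_smult: "real_poly (smult c p) = smult (real_of_int c) (real_poly p)"
  by (rule poly_eqI) (simp add: coeff_map_poly)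

lemma real_poly_1: "real_poly 1 = 1"
  by (rule poly_eqI) (simp add: coeff_map_poly)

lemma real_poly_power: "real_poly (p ^ n) = real_poly p ^ n"
  by (induction n) (simp_all add: real_poly_mult real_poly_1)

lemma real_poly_neg_X: "real_poly [:0, -1:] = [:0, -1:]"
  by (simp add: map_poly_pCons)

lemma real_poly_eq_iff: "real_poly p = real_poly q \<longleftrightarrow> p = q"
  by (auto simp: poly_eq_iff coeff_map_poly)

lemma poly_reversal:
  fixes p :: "real poly"
  assumes "degree p \<le> r" "t \<noteq> 0"
  shows "poly (reversal r p) t = t ^ r * poly p (inverse t)"
proof -
  have "poly (reversal r p) t = (\<Sum>k\<le>r. coeff p (r - k) * t ^ k)"
    by (simp add: reversal_def poly_sum poly_monom)
  also have "\<dots> = (\<Sum>k\<le>r. coeff p k * t ^ (r - k))"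
    by (rule sum.reindex_bij_witness[of _ "\<lambda>k. r - k" "\<lambda>k. r - k"]) auto
  also have "\<dots> = (\<Sum>k\<le>r. t ^ r * (coeff p k * inverse t ^ k))"
    using assms by (intro sum.cong) (auto simp: power_diff field_simps)
  also have "\<dots> = t ^ r * poly (\<Sum>k\<le>r. monom (coeff p k) k) (inverse t)"
    by (simp add: poly_sum poly_monom sum_distrib_left)
  finally show ?thesis
    using assms by (simp add: poly_as_sum_of_monoms')
qed

lemma real_poly_reversal: "real_poly (reversal r p) = reversal r (real_poly p)"
  by (rule poly_eqI) (simp add: coeff_reversal coeff_map_poly)

lemma real_poly_eqI:
  fixes p q :: "real poly"
  assumes "\<And>t. t \<noteq> 0 \<Longrightarrow> poly p t = poly q t"
  shows "p = q"
proof (rule ccontr)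
  assume "p \<noteq> q"
  then have "finite {x. poly (p - q) x = 0}"
    by (intro poly_roots_finite) simp
  moreover have "UNIV - {0} \<subseteq> {x. poly (p - q) x = 0}"
    using assms by auto
  ultimately have "finite (UNIV - {0 :: real})"
    by (rule rev_finite_subset)
  then show False
    by (simp add: infinite_UNIV_char_0)
qed

lemma neg_X_power: "[:0, -1:] ^ d = (monom ((- 1) ^ d) d :: 'a::comm_ring_1 poly)"
  by (induction d) (simp_all add: monom_Suc mult_ac smult_monom flip: one_pCons)

text \<open>The factor \<open>t\<^bsup>|C|\<^esup> \<chi>\<^bsub>G/C\<^esub>(1/t)\<close> of the defining identity is the reversed characteristic polynomial of an upper
  interval of flats.\<close>

lemma chromatic_poly_contraction_reversed:
  assumes G: "finite_loopless G" and C: "C \<in> compositions G" and t: "t \<noteq> 0"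
  shows "t ^ card C * poly (real_poly (chromatic_poly (contraction G C))) (inverse t) =
    (\<Sum>F \<in> {F \<in> flats G. flat_of G C \<subseteq> F}.
      real_of_int (moebius (flats G) (flat_of G C) F) * t ^ (edge_rank G F - edge_rank G (flat_of G C)))"
proof -
  let ?F = "flat_of G C" and ?n = "card (verts G)"
  have fin: "finite (verts G)"
    using G by (simp add: finite_loopless_def)
  have "t ^ card C * poly (real_poly (chromatic_poly (contraction G C))) (inverse t) =
    (\<Sum>F \<in> {F \<in> flats G. ?F \<subseteq> F}.
      t ^ card C * (real_of_int (moebius (flats G) ?F F) * inverse t ^ (?n - edge_rank G F)))"
    by (simp add: chromatic_poly_contraction[OF G C] real_poly_sum poly_sum map_poly_monom poly_monom sum_distrib_left)
  also have "\<dots> = (\<Sum>F \<in> {F \<in> flats G. ?F \<subseteq> F}.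
      real_of_int (moebius (flats G) ?F F) * t ^ (edge_rank G F - edge_rank G ?F))"
  proof (rule sum.cong)
    fix F assume "F \<in> {F \<in> flats G. ?F \<subseteq> F}"
    then have "edge_rank G ?F \<le> edge_rank G F"
      by (intro edge_rank_mono[OF fin]) auto
    moreover have "edge_rank G F \<le> ?n"
      by (simp add: edge_rank_eq)
    ultimately have "card C = (edge_rank G F - edge_rank G ?F) + (?n - edge_rank G F)"
      by (simp add: card_composition[OF G C])
    then have "t ^ card C * inverse t ^ (?n - edge_rank G F) = t ^ (edge_rank G F - edge_rank G ?F)"
      using t by (simp add: power_add power_inverse)
    then show "t ^ card C * (real_of_int (moebius (flats G) ?F F) * inverse t ^ (?n - edge_rank G F))
      = real_of_int (moebius (flats G) ?F F) * t ^ (edge_rank G F - edge_rank G ?F)"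
      by (simp add: mult.left_commute)
  qed simp
  finally show ?thesis .
qed

lemma graph_rank_restriction:
  assumes "finite_loopless G" "C \<in> compositions G"
  shows "graph_rank (restriction G C) = edge_rank G (flat_of G C)"
  using assms flats_subset[OF flat_of_in_flats[OF assms]]
  by (simp add: restriction_eq_subgraph graph_rank_subgraph)

text \<open>After \<open>chromatic_poly_contraction_reversed\<close> is inserted, the double sum over flats \<open>A \<subseteq> F\<close> is collected by \<open>F\<close>. The inner
  sums are the Moebius transforms.\<close>

lemma inverse_KL_equation_iff:
  assumes G: "finite_loopless G" and deg: "degree (Q G) \<le> graph_rank G"
  shows "(\<forall>t::real. t \<noteq> 0 \<longrightarrow>
      (- t) ^ graph_rank G * poly (real_poly (Q G)) (inverse t) =
      (\<Sum>C \<in> compositions G.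
        (- 1) ^ graph_rank (restriction G C) * poly (real_poly (Q (restriction G C))) t *
        (t ^ card C * poly (real_poly (chromatic_poly (contraction G C))) (inverse t)))) \<longleftrightarrow>
    smult ((- 1) ^ graph_rank G) (reversal (graph_rank G) (Q G)) =
      (\<Sum>F \<in> flats G. smult ((- 1) ^ edge_rank G F) (moebius_transform Q G F))"
    (is "(\<forall>t. t \<noteq> 0 \<longrightarrow> ?lhs t = ?rhs t) \<longleftrightarrow> ?p = ?q")
proof -
  have fin: "finite (verts G)"
    using G by (simp add: finite_loopless_def)
  have p: "?lhs t = poly (real_poly ?p) t" if "t \<noteq> 0" for t
  proof -
    have "poly (real_poly ?p) t = (- 1) ^ graph_rank G * (t ^ graph_rank G * poly (real_poly (Q G)) (inverse t))"
      using that deg by (simp add: real_poly_smult real_poly_reversal poly_reversal degree_map_poly)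
    also have "\<dots> = ?lhs t"
      by (simp flip: mult.assoc power_mult_distrib)
    finally show ?thesis ..
  qed
  have q: "?rhs t = poly (real_poly ?q) t" if t: "t \<noteq> 0" for t
  proof -
    have "?rhs t = (\<Sum>C \<in> compositions G. (- 1) ^ edge_rank G (flat_of G C) * poly (real_poly (Q (subgraph G (flat_of G C)))) t *
       (\<Sum>F \<in> {F \<in> flats G. flat_of G C \<subseteq> F}.
          real_of_int (moebius (flats G) (flat_of G C) F) * t ^ (edge_rank G F - edge_rank G (flat_of G C))))"
      using graph_rank_restriction[OF G]
      by (intro sum.cong refl) (simp add: chromatic_poly_contraction_reversed[OF G _ t] restriction_eq_subgraph)
    also have "\<dots> = (\<Sum>A \<in> flats G. (- 1) ^ edge_rank G A * poly (real_poly (Q (subgraph G A))) t *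
       (\<Sum>F \<in> {F \<in> flats G. A \<subseteq> F}.
          real_of_int (moebius (flats G) A F) * t ^ (edge_rank G F - edge_rank G A)))"
      by (rule sum.reindex_bij_betw[OF bij_betw_flat_of[OF G]])
    also have "\<dots> = (\<Sum>A \<in> flats G. \<Sum>F \<in> {F \<in> flats G. A \<subseteq> F}.
        (- 1) ^ edge_rank G A * poly (real_poly (Q (subgraph G A))) t *
        (real_of_int (moebius (flats G) A F) * t ^ (edge_rank G F - edge_rank G A)))"
      by (simp add: sum_distrib_left)
    also have "\<dots> = (\<Sum>F \<in> flats G. \<Sum>A \<in> {A \<in> flats G. A \<subseteq> F}.
        (- 1) ^ edge_rank G A * poly (real_poly (Q (subgraph G A))) t *
        (real_of_int (moebius (flats G) A F) * t ^ (edge_rank G F - edge_rank G A)))"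
      by (rule sum.swap_restrict) (simp_all add: finite_flats[OF G])
    also have "\<dots> = (\<Sum>F \<in> flats G. \<Sum>A \<in> {A \<in> flats G. A \<subseteq> F}.
        (- 1) ^ edge_rank G F * poly (real_poly (of_int (moebius (flats G) A F) *
          [:0, -1:] ^ (edge_rank G F - edge_rank G A) * Q (subgraph G A))) t)"
    proof (intro sum.cong refl)
      fix F A assume "F \<in> flats G" and A: "A \<in> {A \<in> flats G. A \<subseteq> F}"
      then have le: "edge_rank G A \<le> edge_rank G F"
        by (intro edge_rank_mono[OF fin]) auto
      define d where "d = edge_rank G F - edge_rank G A"
      have F_eq: "edge_rank G F = edge_rank G A + d"
        using le by (simp add: d_def)
      have "real_poly (of_int c) = [:real_of_int c:]" for c
        by (simp add: of_int_poly map_poly_pCons)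
      then show "(- 1) ^ edge_rank G A * poly (real_poly (Q (subgraph G A))) t *
        (real_of_int (moebius (flats G) A F) * t ^ (edge_rank G F - edge_rank G A)) =
        (- 1) ^ edge_rank G F * poly (real_poly (of_int (moebius (flats G) A F) *
          [:0, -1:] ^ (edge_rank G F - edge_rank G A) * Q (subgraph G A))) t"
        unfolding F_eq
        by (simp add: real_poly_mult real_poly_power real_poly_neg_X power_add power_minus[of t] flip: mult.assoc)
    qed
    also have "\<dots> = poly (real_poly ?q) t"
      by (simp add: moebius_transform_def real_poly_smult real_poly_sum poly_sum sum_distrib_left)
    finally show ?thesis .
  qed
  have "(\<forall>t. t \<noteq> 0 \<longrightarrow> ?lhs t = ?rhs t) \<longleftrightarrow> (\<forall>t. t \<noteq> 0 \<longrightarrow> poly (real_poly ?p) t = poly (real_poly ?q) t)"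
    using p q by simp
  also have "\<dots> \<longleftrightarrow> real_poly ?p = real_poly ?q"
    using real_poly_eqI[of "real_poly ?p" "real_poly ?q"] by auto
  also have "\<dots> \<longleftrightarrow> ?p = ?q"
    by (rule real_poly_eq_iff)
  finally show ?thesis .
qed

lemma neg_one_power_diff:
  assumes "a \<le> b"
  shows "(- 1) ^ (b - a) = ((- 1) ^ b * (- 1) ^ a :: 'a::comm_ring_1)"
  using assms by (auto simp: minus_one_power_iff)

text \<open>Reversal with respect to \<open>r\<close> turns \<open>(-t)\<^bsup>r - \<rho>F\<^esup> y\<close> into \<open>\<plusminus>\<close> the reversal of \<open>y\<close> with respect to \<open>\<rho>F\<close>. Thus it
  replaces each summand of an inverse Kazhdan--Lusztig polynomial by its reversal, up to sign.\<close>

lemma smult_reversal_signed_sum: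
  assumes rho: "\<And>F. F \<in> P \<Longrightarrow> \<rho> F \<le> r"
  shows "smult ((- 1) ^ r) (reversal r (\<Sum>F \<in> P. [:0, -1:] ^ (r - \<rho> F) * y F)) =
    (\<Sum>F \<in> P. smult ((- 1) ^ \<rho> F) (reversal (\<rho> F) (y F :: 'a::comm_ring_1 poly)))"
proof -
  have "reversal r ([:0, -1:] ^ (r - \<rho> F) * y F) = smult ((- 1) ^ (r - \<rho> F)) (reversal (\<rho> F) (y F))"
    if "F \<in> P" for F
    using rho[OF that] by (simp add: neg_X_power reversal_monom_mult)
  moreover have "(- 1) ^ r * (- 1) ^ (r - \<rho> F) = ((- 1) ^ \<rho> F :: 'a)" if "F \<in> P" for F
    using rho[OF that] by (auto simp: minus_one_power_iff)
  moreover have "smult c (\<Sum>F \<in> P. z F) = (\<Sum>F \<in> P. smult c (z F))" for c :: 'a and z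
    by (rule poly_eqI) (simp add: coeff_sum sum_distrib_left)
  ultimately show ?thesis
    by (simp add: reversal_sum)
qed

text \<open>In this form the conditions are identities of integer polynomials, and they also cover rank \<open>0\<close>.\<close>

lemma inverse_KL_family_iff:
  fixes Q :: "('v, 'e) mgraph \<Rightarrow> int poly"
  shows "inverse_KL_family Q \<longleftrightarrow> (\<forall>G. finite_loopless G \<longrightarrow> KL_bounded (graph_rank G) (Q G) \<and>
    smult ((- 1) ^ graph_rank G) (reversal (graph_rank G) (Q G)) =
      (\<Sum>F \<in> flats G. smult ((- 1) ^ edge_rank G F) (moebius_transform Q G F)))"
    (is "_ \<longleftrightarrow> (\<forall>G. finite_loopless G \<longrightarrow> ?bd G \<and> ?eq G)")
proof -
  have bd: "?bd G \<longleftrightarrow> (graph_rank G = 0 \<longrightarrow> Q G = 1) \<and>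
      (graph_rank G > 0 \<longrightarrow> real (degree (Q G)) < real (graph_rank G) / 2)" for G
    by (auto simp: KL_bounded_def)
  have rank0: "?eq G" if G: "finite_loopless G" "graph_rank G = 0" and Q: "Q G = 1" "Q (subgraph G {}) = 1" for G
  proof -
    have "edges G = {}"
      using G rank_eq_0_iff by blast
    then have flats: "flats G = {{}}"
      by (rule flats_of_edgeless)
    then have "{A \<in> flats G. A \<subseteq> {}} = {{}}"
      by auto
    then show ?thesis
      using G(2) Q flats by (simp add: moebius_transform_def edge_rank_empty moebius.simps reversal_def)
  qed
  have sub0: "finite_loopless (subgraph G {})" "graph_rank (subgraph G {}) = 0" if "finite_loopless G" for G
    using that by (simp_all add: finite_loopless_subgraph graph_rank_subgraph edge_rank_empty)
  show ?thesis
  proof (intro iffI allI impI)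
    fix G :: "('v, 'e) mgraph" assume fam: "inverse_KL_family Q" and G: "finite_loopless G"
    show "?bd G \<and> ?eq G"
    proof
      show "?bd G"
        using fam G unfolding bd inverse_KL_family_def by blast
      then have deg: "degree (Q G) \<le> graph_rank G"
        by (rule KL_bounded_degree)
      show "?eq G"
      proof (cases "graph_rank G = 0")
        case True
        then show ?thesis
          using fam G sub0[OF G] unfolding inverse_KL_family_def by (intro rank0) blast+
      next
        case False
        then show ?thesis
          using fam G unfolding inverse_KL_family_def inverse_KL_equation_iff[where Q = Q, OF G deg, symmetric] by blast
      qed
    qed
  next
    assume *: "\<forall>G. finite_loopless G \<longrightarrow> ?bd G \<and> ?eq G"
    show "inverse_KL_family Q"
      unfolding inverse_KL_family_def
    proof (intro allI impI)
      fix G :: "('v, 'e) mgraph" assume G: "finite_loopless G"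
      have deg: "degree (Q G) \<le> graph_rank G"
        using * G KL_bounded_degree by blast
      have "?bd G" "?eq G"
        using * G by auto
      then show "(graph_rank G = 0 \<longrightarrow> Q G = 1) \<and> (0 < graph_rank G \<longrightarrow>
        real (degree (Q G)) < real (graph_rank G) / 2 \<and>
        (\<forall>t::real. t \<noteq> 0 \<longrightarrow>
           (- t) ^ graph_rank G * poly (map_poly real_of_int (Q G)) (inverse t) =
           (\<Sum>C \<in> compositions G.
              (- 1) ^ graph_rank (restriction G C) * poly (map_poly real_of_int (Q (restriction G C))) t *
              (t ^ card C * poly (map_poly real_of_int (chromatic_poly (contraction G C))) (inverse t)))))"
        unfolding bd inverse_KL_equation_iff[where Q = Q, OF G deg] by simp
    qed
  qed
qed

lemma inverse_KL_family_inverse_KL_rec: "inverse_KL_family inverse_KL_rec"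
  unfolding inverse_KL_family_iff
proof (intro allI impI conjI)
  fix G :: "('v, 'e) mgraph" assume G: "finite_loopless G"
  then show "KL_bounded (graph_rank G) (inverse_KL_rec G)"
    by (rule KL_bounded_inverse_KL_rec)
  have "reversal (edge_rank G F) (inverse_Z_rec (subgraph G F)) = moebius_transform inverse_KL_rec G F"
    if F: "F \<in> flats G" for F
  proof -
    have "palindromic (edge_rank G F) (inverse_Z_rec (subgraph G F))"
      using palindromic_inverse_Z_rec[of "subgraph G F"] G flats_subset[OF F]
      by (simp add: finite_loopless_subgraph graph_rank_subgraph)
    then show ?thesis
      using moebius_transform_inverse_KL_rec[OF G F] by (simp add: palindromic_def)
  qed
  then show "smult ((- 1) ^ graph_rank G) (reversal (graph_rank G) (inverse_KL_rec G)) =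
      (\<Sum>F \<in> flats G. smult ((- 1) ^ edge_rank G F) (moebius_transform inverse_KL_rec G F))"
    unfolding inverse_KL_rec_def[of G]
    by (subst smult_reversal_signed_sum) (auto simp: edge_rank_le_rank[OF G])
qed

lemma sum_below_eq_0:
  fixes P :: "'b::order set" and h :: "'b \<Rightarrow> 'a::comm_ring_1"
  assumes P: "finite P" and "\<And>H. H \<in> P \<Longrightarrow> (\<Sum>F \<in> {F \<in> P. F \<le> H}. h F) = 0" and "H \<in> P"
  shows "h H = 0"
  using moebius_inversion[OF P, of "\<lambda>_ _. 1" "\<lambda>_. 0" h] assms by simp

text \<open>The defining identities of all restrictions of \<open>G\<close>, compared with the reversed inversion formula, give
  \<open>\<Sum>\<^bsub>F \<le> H\<^esub> \<plusminus>(reversal W\<^sub>F - W\<^sub>F) = 0\<close> for all flats \<open>H\<close>, where \<open>W\<close> is the Moebius transform. Hence every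
  \<open>W\<^sub>F\<close> is palindromic, and the uniqueness of palindromic systems applies.\<close>

lemma inverse_KL_family_unique:
  assumes fam: "inverse_KL_family Q" and G: "finite_loopless G"
  shows "Q G = inverse_KL_rec G"
proof -
  let ?P = "flats G" and ?\<rho> = "edge_rank G" and ?W = "moebius_transform Q G"
  have bd: "\<And>G. finite_loopless G \<Longrightarrow> KL_bounded (graph_rank G) (Q G)"
    and eq: "\<And>G. finite_loopless G \<Longrightarrow> smult ((- 1) ^ graph_rank G) (reversal (graph_rank G) (Q G)) =
      (\<Sum>F \<in> flats G. smult ((- 1) ^ edge_rank G F) (moebius_transform Q G F))"
    using fam unfolding inverse_KL_family_iff by auto
  have fin: "finite ?P" "finite (verts G)"
    using G by (simp_all add: finite_flats finite_loopless_def)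
  have sub: "finite_loopless (subgraph G H)" "graph_rank (subgraph G H) = ?\<rho> H" if "H \<in> ?P" for H
    using that G flats_subset[OF that] by (simp_all add: finite_loopless_subgraph graph_rank_subgraph)
  have Q_sub: "Q (subgraph G H) = (\<Sum>F \<in> {F \<in> ?P. F \<subseteq> H}. [:0, -1:] ^ (?\<rho> H - ?\<rho> F) * ?W F)" if "H \<in> ?P" for H
    using that moebius_transform_inversion[OF G, of Q ?W] by blast
  have "reversal (?\<rho> H) (?W H) - ?W H = 0" if "H \<in> ?P" for H
  proof -
    have "(\<Sum>F \<in> {F \<in> ?P. F \<le> H}. smult ((- 1) ^ ?\<rho> F) (reversal (?\<rho> F) (?W F) - ?W F)) = 0" if H: "H \<in> ?P" for H
    proof -
      have "(\<Sum>F \<in> {F \<in> ?P. F \<subseteq> H}. smult ((- 1) ^ ?\<rho> F) (reversal (?\<rho> F) (?W F)))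
        = smult ((- 1) ^ ?\<rho> H) (reversal (?\<rho> H) (Q (subgraph G H)))"
        unfolding Q_sub[OF H] by (rule smult_reversal_signed_sum[symmetric]) (auto intro: edge_rank_mono[OF fin(2)])
      also have "\<dots> = (\<Sum>F \<in> {F \<in> ?P. F \<subseteq> H}. smult ((- 1) ^ ?\<rho> F) (?W F))"
        using eq[OF sub(1)[OF H]] H
        by (simp add: sub flats_subgraph[OF G H] edge_rank_subgraph[OF G flats_subset[OF H]]
            moebius_transform_subgraph[OF G H])
      finally show ?thesis
        by (simp add: smult_diff_right sum_subtractf)
    qed
    then have "smult ((- 1) ^ ?\<rho> H) (reversal (?\<rho> H) (?W H) - ?W H) = 0"
      using that by (rule sum_below_eq_0[OF fin(1)])
    then show ?thesis
      by simp
  qed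
  then have pal: "palindromic (?\<rho> H) (?W H)" if "H \<in> ?P" for H
    using that by (simp add: palindromic_def)
  have W_eq: "?W H = inverse_Z_rec (subgraph G H)" if H: "H \<in> ?P" for H
  proof (rule palindromic_system_unique[where P = ?P and \<rho> = ?\<rho>])
    fix F assume F: "F \<in> ?P"
    show "palindromic (?\<rho> F) (inverse_Z_rec (subgraph G F))"
      using palindromic_inverse_Z_rec[OF sub(1)[OF F]] by (simp add: sub F)
    show "KL_bounded (?\<rho> F) (\<Sum>A \<in> {A \<in> ?P. A \<subseteq> F}. [:0, -1:] ^ (?\<rho> F - ?\<rho> A) * ?W A)"
      using bd[OF sub(1)[OF F]] by (simp add: sub F flip: Q_sub)
    show "KL_bounded (?\<rho> F) (\<Sum>A \<in> {A \<in> ?P. A \<subseteq> F}. [:0, -1:] ^ (?\<rho> F - ?\<rho> A) * inverse_Z_rec (subgraph G A))"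
      using KL_bounded_inverse_KL_rec[OF sub(1)[OF F]] by (simp add: sub F inverse_KL_rec_subgraph[OF G F])
  qed (use fin pal H in auto)
  have "(\<Sum>F \<in> ?P. smult ((- 1) ^ ?\<rho> F) (?W F))
    = (\<Sum>F \<in> ?P. smult ((- 1) ^ ?\<rho> F) (moebius_transform inverse_KL_rec G F))"
    using W_eq moebius_transform_inverse_KL_rec[OF G] by simp
  then have "smult ((- 1) ^ graph_rank G) (reversal (graph_rank G) (Q G))
    = smult ((- 1) ^ graph_rank G) (reversal (graph_rank G) (inverse_KL_rec G))"
    using eq[OF G] inverse_KL_family_inverse_KL_rec G unfolding inverse_KL_family_iff by metis
  then have "reversal (graph_rank G) (Q G) = reversal (graph_rank G) (inverse_KL_rec G)"
    by (auto simp: poly_eq_iff)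
  then show ?thesis
    using reversal_reversal KL_bounded_degree[OF bd[OF G]] KL_bounded_degree[OF KL_bounded_inverse_KL_rec[OF G]]
    by metis
qed

lemma inverse_KL_poly_eq: "finite_loopless G \<Longrightarrow> inverse_KL_poly G = inverse_KL_rec G"
  unfolding inverse_KL_poly_def
  by (rule the_equality) (use inverse_KL_family_inverse_KL_rec inverse_KL_family_unique in blast)+

lemma inverse_Z_poly_eq:
  assumes G: "finite_loopless G"
  shows "inverse_Z_poly G = inverse_Z_rec G"
proof -
  let ?r = "graph_rank G" and ?\<rho> = "edge_rank G" and ?\<mu> = "moebius (flats G)"
  have term_eq: "(- 1) ^ graph_rank (restriction G C) * inverse_KL_poly (restriction G C) *
      monom (moebius_invariant (contraction G C)) (graph_rank (contraction G C)) =
    (- 1) ^ ?\<rho> (flat_of G C) * inverse_KL_rec (subgraph G (flat_of G C)) *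
      monom (?\<mu> (flat_of G C) (edges G)) (?r - ?\<rho> (flat_of G C))" if C: "C \<in> compositions G" for C
  proof -
    have F: "flat_of G C \<in> flats G" "flat_of G C \<subseteq> edges G"
      using flat_of_in_flats[OF G C] flats_subset by auto
    have "moebius_invariant (contraction G C) = ?\<mu> (flat_of G C) (edges G)"
      using moebius_contraction[OF G C edges_in_flats F(2)] by (simp add: moebius_invariant_def edges_contraction)
    moreover have "graph_rank (contraction G C) = ?r - ?\<rho> (flat_of G C)"
      using edge_rank_contraction[OF G C subset_refl] F(2)
      by (simp add: graph_rank_eq edges_contraction Un_absorb2)
    ultimately show ?thesis
      using F(2) graph_rank_restriction[OF G C]
      by (simp add: restriction_eq_subgraph inverse_KL_poly_eq finite_loopless_subgraph[OF G])
  qed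
  have "inverse_Z_poly G = (- 1) ^ ?r * (\<Sum>C \<in> compositions G. (- 1) ^ ?\<rho> (flat_of G C) *
      inverse_KL_rec (subgraph G (flat_of G C)) * monom (?\<mu> (flat_of G C) (edges G)) (?r - ?\<rho> (flat_of G C)))"
    unfolding inverse_Z_poly_def by (simp add: term_eq)
  also have "\<dots> = (- 1) ^ ?r * (\<Sum>F \<in> flats G. (- 1) ^ ?\<rho> F *
      inverse_KL_rec (subgraph G F) * monom (?\<mu> F (edges G)) (?r - ?\<rho> F))"
    by (subst sum.reindex_bij_betw[OF bij_betw_flat_of[OF G],
          of "\<lambda>F. (- 1) ^ ?\<rho> F * inverse_KL_rec (subgraph G F) * monom (?\<mu> F (edges G)) (?r - ?\<rho> F)"]) simp
  also have "\<dots> = moebius_transform inverse_KL_rec G (edges G)"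
    unfolding moebius_transform_def sum_distrib_left
  proof (rule sum.cong)
    show "flats G = {A \<in> flats G. A \<subseteq> edges G}"
      using flats_subset by auto
    fix F assume "F \<in> {A \<in> flats G. A \<subseteq> edges G}"
    then have "?\<rho> F \<le> ?r"
      using edge_rank_le_rank[OF G] by simp
    then have "(- 1) ^ ?r * (- 1) ^ ?\<rho> F * monom (?\<mu> F (edges G)) (?r - ?\<rho> F)
      = of_int (?\<mu> F (edges G)) * [:0, -1:] ^ (?r - ?\<rho> F)"
    proof -
      have "(- 1) ^ ?r * (- 1) ^ ?\<rho> F = (of_int ((- 1) ^ (?r - ?\<rho> F)) :: int poly)"
        using \<open>?\<rho> F \<le> ?r\<close> by (simp add: neg_one_power_diff)
      then show ?thesis
        by (simp add: of_int_poly neg_X_power smult_monom mult.commute del: of_int_power)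
    qed
    then show "(- 1) ^ ?r * ((- 1) ^ ?\<rho> F * inverse_KL_rec (subgraph G F) * monom (?\<mu> F (edges G)) (?r - ?\<rho> F))
      = of_int (?\<mu> F (edges G)) * [:0, -1:] ^ (?\<rho> (edges G) - ?\<rho> F) * inverse_KL_rec (subgraph G F)"
      by (simp add: graph_rank_eq mult_ac)
  qed
  also have "\<dots> = inverse_Z_rec G"
    by (simp add: moebius_transform_inverse_KL_rec[OF G edges_in_flats] inverse_Z_rec_subgraph_edges[OF G])
  finally show ?thesis .
qed

text \<open>The criterion by which the inverse Z-polynomial of a particular graph is verified. Real coefficients
  admit candidates that are not visibly integral.\<close>

theorem inverse_Z_poly_characterization:
  assumes G: "finite_loopless G"
    and pal: "\<And>F. F \<in> flats G \<Longrightarrow> palindromic (edge_rank G F) (y F)"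
    and bound: "\<And>F. F \<in> flats G \<Longrightarrow> KL_bounded (edge_rank G F)
      (\<Sum>A \<in> {A \<in> flats G. A \<subseteq> F}. [:0, -1:] ^ (edge_rank G F - edge_rank G A) * y A)"
  shows "real_poly (inverse_Z_poly G) = y (edges G)"
proof -
  have KL_real: "KL_bounded r (real_poly p)" if "KL_bounded r p" for r p
    using that by (auto simp: KL_bounded_def degree_map_poly real_poly_1 split: if_splits)
  have "real_poly (inverse_Z_rec (subgraph G (edges G))) = y (edges G)"
  proof (rule palindromic_system_unique[where P = "flats G" and \<rho> = "edge_rank G"])
    fix F assume F: "F \<in> flats G"
    have sub: "finite_loopless (subgraph G F)" "graph_rank (subgraph G F) = edge_rank G F"
      using F G flats_subset[OF F] by (simp_all add: finite_loopless_subgraph graph_rank_subgraph)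
    show "palindromic (edge_rank G F) (real_poly (inverse_Z_rec (subgraph G F)))"
      using palindromic_inverse_Z_rec[OF sub(1)] by (simp add: palindromic_def sub flip: real_poly_reversal)
    show "KL_bounded (edge_rank G F) (\<Sum>A \<in> {A \<in> flats G. A \<subseteq> F}.
        [:0, -1:] ^ (edge_rank G F - edge_rank G A) * real_poly (inverse_Z_rec (subgraph G A)))"
      using KL_real[OF KL_bounded_inverse_KL_rec[OF sub(1)]]
      by (simp add: sub inverse_KL_rec_subgraph[OF G F] real_poly_sum real_poly_mult real_poly_power real_poly_neg_X)
  qed (use G pal bound edges_in_flats finite_flats in auto)
  then show ?thesis
    by (simp add: inverse_Z_poly_eq[OF G] inverse_Z_rec_subgraph_edges[OF G])
qed

section \<open>Words and their weights\<close>

text \<open>The letter of a vertex of the path says whether it is connected to the hub, starts a new piece of the path, or is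
  joined to its predecessor without being connected to the hub.\<close>

datatype letter = Hub | New | Join

text \<open>A vertex can only be joined to a predecessor that exists and is not connected to the hub; \<open>j\<close> tells whether this
  is so for the first letter.\<close>

fun admissible :: "bool \<Rightarrow> letter list \<Rightarrow> bool" where
  "admissible j [] \<longleftrightarrow> True"
| "admissible j (a # w) \<longleftrightarrow> (a = Join \<longrightarrow> j) \<and> admissible (a \<noteq> Hub) w"

text \<open>The order of flats. The flag \<open>h\<close> tells whether the predecessor has the letter \<open>Hub\<close> in the larger word, in which
  case the path edge between two \<open>Hub\<close>s belongs to the larger flat.\<close>

fun below :: "bool \<Rightarrow> letter list \<Rightarrow> letter list \<Rightarrow> bool" where
  "below h [] [] \<longleftrightarrow> True"
| "below h (a # v) (b # w) \<longleftrightarrow>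
    (a = Hub \<longrightarrow> b = Hub) \<and> (a = Join \<longrightarrow> b = Join \<or> b = Hub \<and> h) \<and> below (b = Hub) v w"
| "below h _ _ \<longleftrightarrow> False"

definition news :: "letter list \<Rightarrow> nat" where
  "news w = length (filter (\<lambda>a. a = New) w)"

text \<open>The rank of the flat: each letter other than \<open>New\<close> merges its vertex with an earlier component.\<close>

definition word_rank :: "letter list \<Rightarrow> nat" where
  "word_rank w = length (filter (\<lambda>a. a \<noteq> New) w)"

definition words_below :: "letter list \<Rightarrow> letter list set" where
  "words_below w = {v. length v = length w \<and> admissible False v \<and> below False v w}"

text \<open>The candidate for the inverse Z-polynomial of the restriction, a product over its blocks. A maximal run
  of \<open>k\<close> letters \<open>Hub\<close> stands for a fan with \<open>k\<close> path vertices and an edge of the path for \<open>1 + t\<close>.\<close>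

function weight :: "(nat \<Rightarrow> real poly) \<Rightarrow> letter list \<Rightarrow> real poly" where
  "weight y [] = 1"
| "weight y (New # w) = weight y w"
| "weight y (Join # w) = [:1, 1:] * weight y w"
| "weight y (Hub # w) = y (Suc (length (takeWhile ((=) Hub) w))) * weight y (dropWhile ((=) Hub) w)"
  by pat_completeness auto
termination
  by (relation "measure (\<lambda>(y, w). length w)") (auto simp: le_imp_less_Suc length_dropWhile_le)

text \<open>The corresponding candidate for the inverse Kazhdan--Lusztig polynomial.\<close>

definition below_sum :: "(nat \<Rightarrow> real poly) \<Rightarrow> letter list \<Rightarrow> real poly" where
  "below_sum y w = (\<Sum>v \<in> words_below w. [:0, -1:] ^ (word_rank w - word_rank v) * weight y v)"

lemma news_simps [simp]:
  "news [] = 0" "news (a # w) = (if a = New then Suc (news w) else news w)" "news (v @ w) = news v + news w"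
  by (simp_all add: news_def)

lemma word_rank_simps [simp]:
  "word_rank [] = 0" "word_rank (a # w) = (if a = New then word_rank w else Suc (word_rank w))"
  "word_rank (v @ w) = word_rank v + word_rank w"
  by (simp_all add: word_rank_def)

lemma word_rank_replicate [simp]: "word_rank (replicate k a) = (if a = New then 0 else k)"
  by (induction k) auto

lemma word_rank_news: "word_rank w = length w - news w" "news w \<le> length w"
  by (induction w) (auto simp: Suc_diff_le)

lemma finite_words: "finite {v :: letter list. length v = k \<and> P v}"
proof -
  have "finite (UNIV :: letter set)"
    by (rule finite_subset[of _ "{Hub, New, Join}"]) (auto intro: letter.exhaust)
  then have "finite {v :: letter list. set v \<subseteq> UNIV \<and> length v = k}"
    by (rule finite_lists_length_eq)
  then show ?thesis
    by (rule rev_finite_subset) auto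
qed

lemma below_word_rank: "below h v w \<Longrightarrow> word_rank v \<le> word_rank w"
proof (induction h v w rule: below.induct)
  case (2 h a v b w)
  then show ?case
    by (cases a; cases b) auto
qed auto

lemma admissible_append:
  "admissible j (v @ w) \<longleftrightarrow> admissible j v \<and> admissible (if v = [] then j else last v \<noteq> Hub) w"
  by (induction v arbitrary: j) auto

lemma below_append:
  "length v = length w \<Longrightarrow>
    below h (v @ v') (w @ w') \<longleftrightarrow> below h v w \<and> below (if w = [] then h else last w = Hub) v' w'"
  by (induction v w arbitrary: h rule: list_induct2) auto

lemma below_last: "below h v w \<Longrightarrow> v \<noteq> [] \<Longrightarrow> last v = Hub \<Longrightarrow> last w = Hub"
proof (induction h v w rule: below.induct)
  case (2 h a v b w)
  then show ?case
    by (cases v; cases w) auto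
qed auto

lemma weight_append:
  "v = [] \<or> w = [] \<or> last v \<noteq> Hub \<or> hd w \<noteq> Hub \<Longrightarrow> weight y (v @ w) = weight y v * weight y w"
proof (induction y v rule: weight.induct)
  case (4 y v)
  show ?case
  proof (cases "\<forall>a \<in> set v. a = Hub")
    case True
    then have "last (Hub # v) = Hub"
      by (metis last_in_set list.distinct(1) set_ConsD)
    then have w: "w = [] \<or> hd w \<noteq> Hub"
      using 4 by auto
    then have "takeWhile ((=) Hub) w = []" "dropWhile ((=) Hub) w = w"
      by (cases w; auto)+
    then have runs: "takeWhile ((=) Hub) (v @ w) = v" "dropWhile ((=) Hub) (v @ w) = w"
      "takeWhile ((=) Hub) v = v" "dropWhile ((=) Hub) v = []"
      using True by (auto simp: takeWhile_append dropWhile_append takeWhile_eq_all_conv)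
    show ?thesis
      by (simp only: append_Cons weight.simps runs mult_1_right)
  next
    case False
    then obtain a where a: "a \<in> set v" "a \<noteq> Hub"
      by auto
    then have ne: "dropWhile ((=) Hub) v \<noteq> []"
      unfolding dropWhile_eq_Nil_conv by metis
    have "last (dropWhile ((=) Hub) v) = last v"
      using ne by (metis last_appendR takeWhile_dropWhile_id)
    moreover have "v \<noteq> []"
      using a by auto
    ultimately have "weight y (dropWhile ((=) Hub) v @ w) = weight y (dropWhile ((=) Hub) v) * weight y w"
      using 4 by auto
    moreover have "takeWhile ((=) Hub) (v @ w) = takeWhile ((=) Hub) v"
      "dropWhile ((=) Hub) (v @ w) = dropWhile ((=) Hub) v @ w"
      using a by (auto intro: takeWhile_append1 dropWhile_append1)
    ultimately show ?thesis
      by (simp add: mult.assoc)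
  qed
next
  case (2 y v)
  then show ?case
    by (cases v) auto
next
  case (3 y v)
  then have "weight y (v @ w) = weight y v * weight y w"
    by (cases v) auto
  then show ?case
    by (simp only: append_Cons weight.simps mult.assoc)
qed simp

lemma palindromic_weight:
  assumes "\<And>k. palindromic k (y k)"
  shows "palindromic (word_rank w) (weight y w)"
  using assms
proof (induction y w rule: weight.induct)
  case (3 y w)
  from palindromic_mult[OF palindromic_one_plus_X 3(1)[OF 3(2)]] show ?case
    by simp
next
  case (4 y w)
  let ?k = "length (takeWhile ((=) Hub) w)"
  have "takeWhile ((=) Hub) w = replicate ?k Hub"
    by (rule replicate_eqI) (auto dest: set_takeWhileD)
  then have "word_rank w = ?k + word_rank (dropWhile ((=) Hub) w)"
    by (metis takeWhile_dropWhile_id word_rank_simps(3) word_rank_replicate letter.distinct(1))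
  then show ?case
    using palindromic_mult[OF 4(2)[of "Suc ?k"] 4(1)[OF 4(2)]] by simp
qed (simp_all add: palindromic_1)

lemma words_below_append:
  assumes w': "admissible False w'" and border: "w = [] \<or> w' = [] \<or> last w \<noteq> Hub \<or> hd w' \<noteq> Hub"
  shows "words_below (w @ w') = (\<lambda>(v, v'). v @ v') ` (words_below w \<times> words_below w')"
proof -
  have *: "v @ v' \<in> words_below (w @ w') \<longleftrightarrow> v \<in> words_below w \<and> v' \<in> words_below w'"
    if len: "length v = length w" "length v' = length w'" for v v'
  proof (cases "w = [] \<or> w' = []")
    case True
    then show ?thesis
      using len by (auto simp: words_below_def)
  next
    case False
    then obtain b w'' where b: "w' = b # w''"
      by (cases w') auto
    then obtain a v'' where a: "v' = a # v''"
      using len by (cases v') auto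
    have "b \<noteq> Join" "b = Hub \<Longrightarrow> last w \<noteq> Hub"
      using w' border False b by auto
    then have "below (last w = Hub) v' w' \<longleftrightarrow> below False v' w'"
      and "below False v' w' \<Longrightarrow> admissible j v' \<longleftrightarrow> admissible False v'" for j
      unfolding a b by auto
    then show ?thesis
      using False len by (auto simp: words_below_def below_append admissible_append)
  qed
  show ?thesis
  proof (intro equalityI subsetI)
    fix u assume u: "u \<in> words_below (w @ w')"
    define v v' where "v = take (length w) u" and "v' = drop (length w) u"
    have "length v = length w" "length v' = length w'" "u = v @ v'"
      using u by (auto simp: v_def v'_def words_below_def)
    then show "u \<in> (\<lambda>(v, v'). v @ v') ` (words_below w \<times> words_below w')"
      using u * by blast
  next
    fix u assume "u \<in> (\<lambda>(v, v'). v @ v') ` (words_below w \<times> words_below w')"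
    then obtain v v' where "u = v @ v'" "v \<in> words_below w" "v' \<in> words_below w'"
      by auto
    then show "u \<in> words_below (w @ w')"
      using * by (auto simp: words_below_def)
  qed
qed

text \<open>If a word is cut where no run of \<open>Hub\<close>s is torn apart, the words below it are exactly the concatenations
  of words below its two parts, and weights and ranks follow.\<close>

lemma below_sum_append:
  assumes w': "admissible False w'" and border: "w = [] \<or> w' = [] \<or> last w \<noteq> Hub \<or> hd w' \<noteq> Hub"
  shows "below_sum y (w @ w') = below_sum y w * below_sum y w'"
proof -
  have inj: "inj_on (\<lambda>(v, v'). v @ v') (words_below w \<times> words_below w')"
    by (rule inj_onI) (auto simp: words_below_def)
  have "below_sum y (w @ w') = (\<Sum>(v, v') \<in> words_below w \<times> words_below w'.
      [:0, -1:] ^ (word_rank (w @ w') - word_rank (v @ v')) * weight y (v @ v'))"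
    unfolding below_sum_def words_below_append[OF assms] sum.reindex[OF inj] by (simp add: case_prod_unfold)
  also have "\<dots> = (\<Sum>(v, v') \<in> words_below w \<times> words_below w'.
      ([:0, -1:] ^ (word_rank w - word_rank v) * weight y v) *
      ([:0, -1:] ^ (word_rank w' - word_rank v') * weight y v'))"
  proof (intro sum.cong refl, clarify)
    fix v v' assume v: "v \<in> words_below w" and v': "v' \<in> words_below w'"
    have le: "word_rank v \<le> word_rank w" "word_rank v' \<le> word_rank w'"
      using v v' by (auto simp: words_below_def intro: below_word_rank)
    then have rank: "word_rank (w @ w') - word_rank (v @ v') = (word_rank w - word_rank v) + (word_rank w' - word_rank v')"
      by simp
    have "v = [] \<or> v' = [] \<or> last v \<noteq> Hub \<or> hd v' \<noteq> Hub"
    proof (rule ccontr)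
      assume contra: "\<not> ?thesis"
      then have "last w = Hub"
        using v by (auto simp: words_below_def dest: below_last)
      moreover have "hd w' = Hub"
        using contra v' by (cases v'; cases w') (auto simp: words_below_def)
      moreover have "w \<noteq> []" "w' \<noteq> []"
        using contra v v' by (auto simp: words_below_def)
      ultimately show False
        using border by auto
    qed
    then have "weight y (v @ v') = weight y v * weight y v'"
      by (rule weight_append)
    then show "[:0, -1:] ^ (word_rank (w @ w') - word_rank (v @ v')) * weight y (v @ v') =
      ([:0, -1:] ^ (word_rank w - word_rank v) * weight y v) *
      ([:0, -1:] ^ (word_rank w' - word_rank v') * weight y v')"
      unfolding rank power_add by (simp only: mult_ac)
  qed
  also have "\<dots> = below_sum y w * below_sum y w'"
    unfolding below_sum_def sum_product sum.cartesian_product by simp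
  finally show ?thesis .
qed

text \<open>Each \<open>Join\<close> may be kept or replaced by \<open>New\<close>, with contributions \<open>1 + t\<close> and \<open>-t\<close>. These add up to \<open>1\<close>, the
  inverse Kazhdan--Lusztig polynomial of an edge.\<close>

lemma below_sum_path_block: "below_sum y (New # replicate a Join) = 1"
proof -
  define D where "D a = {v. length v = a \<and> set v \<subseteq> {New, Join}}" for a
  have D_Suc: "D (Suc a) = (#) New ` D a \<union> (#) Join ` D a" for a
  proof (rule set_eqI)
    fix v show "v \<in> D (Suc a) \<longleftrightarrow> v \<in> (#) New ` D a \<union> (#) Join ` D a"
      by (cases v) (auto simp: D_def)
  qed
  have fin: "finite (D a)" for a
    unfolding D_def by (rule finite_words)
  have sum_D: "(\<Sum>v \<in> D a. [:0, -1:] ^ (a - word_rank v) * weight y v) = 1" for a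
  proof (induction a)
    case 0
    have "D 0 = {[]}"
      by (auto simp: D_def)
    then show ?case
      by simp
  next
    case (Suc a)
    have rank: "word_rank v \<le> a" if "v \<in> D a" for v
      using that word_rank_news(1)[of v] by (simp add: D_def)
    have "(\<Sum>v \<in> D (Suc a). [:0, -1:] ^ (Suc a - word_rank v) * weight y v)
      = (\<Sum>v \<in> D a. [:0, -1:] ^ (Suc a - word_rank v) * weight y v)
        + (\<Sum>v \<in> D a. [:0, -1:] ^ (a - word_rank v) * ([:1, 1:] * weight y v))"
      unfolding D_Suc using fin
      by (subst sum.union_disjoint) (auto simp: sum.reindex)
    also have "\<dots> = [:0, -1:] * (\<Sum>v \<in> D a. [:0, -1:] ^ (a - word_rank v) * weight y v)
        + [:1, 1:] * (\<Sum>v \<in> D a. [:0, -1:] ^ (a - word_rank v) * weight y v)"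
    proof -
      have "[:0, -1:] ^ (Suc a - word_rank v) * weight y v
        = [:0, -1:] * ([:0, -1:] ^ (a - word_rank v) * weight y v)" if "v \<in> D a" for v
        using rank[OF that] by (simp only: Suc_diff_le power_Suc mult.assoc)
      then show ?thesis
        unfolding sum_distrib_left by (intro arg_cong2[of _ _ _ _ "(+)"] sum.cong refl) (auto simp only: mult_ac)
    qed
    also have "\<dots> = 1"
      unfolding Suc.IH by (simp add: one_pCons)
    finally show ?case .
  qed
  have below: "below False v (replicate a Join) \<longleftrightarrow> v \<in> D a" for v a
  proof (induction a arbitrary: v)
    case 0
    then show ?case
      by (cases v) (auto simp: D_def)
  next
    case (Suc a)
    then show ?case
      by (cases v) (auto simp: D_def intro: letter.exhaust)
  qed
  have adm: "admissible True v" if "set v \<subseteq> {New, Join}" for v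
    using that by (induction v) auto
  have "words_below (New # replicate a Join) = (#) New ` D a"
  proof (rule set_eqI)
    fix v show "v \<in> words_below (New # replicate a Join) \<longleftrightarrow> v \<in> (#) New ` D a"
    proof (cases v)
      case (Cons x v')
      then show ?thesis
        using adm[of v'] by (cases x) (auto simp: words_below_def below D_def)
    qed (auto simp: words_below_def)
  qed
  then show ?thesis
    using sum_D[of a] by (simp add: below_sum_def sum.reindex)
qed

definition all_words_sum :: "(nat \<Rightarrow> real poly) \<Rightarrow> bool \<Rightarrow> nat \<Rightarrow> real poly" where
  "all_words_sum y j k = (\<Sum>v \<in> {v. length v = k \<and> admissible j v}. [:0, -1:] ^ news v * weight y v)"

lemma below_sum_hub_block: "below_sum y (replicate k Hub) = all_words_sum y False k"
proof -
  have "below True v (replicate k Hub) \<longleftrightarrow> length v = k" for v k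
    by (induction k arbitrary: v) (case_tac v; auto)+
  moreover have "below False v (replicate k Hub) \<longleftrightarrow> below True v (replicate k Hub)" if "admissible False v" for v k
    using that by (cases v; cases k) auto
  ultimately have "words_below (replicate k Hub) = {v. length v = k \<and> admissible False v}"
    by (auto simp: words_below_def)
  moreover have "k - word_rank v = news v" if "length v = k" for v
    using that word_rank_news[of v] by simp
  ultimately show ?thesis
    unfolding below_sum_def all_words_sum_def by (intro sum.cong) auto
qed

lemma KL_bounded_below_sum:
  assumes bound: "\<And>k. KL_bounded k (all_words_sum y False k)"
  shows "admissible False w \<Longrightarrow> KL_bounded (word_rank w) (below_sum y w)"
proof (induction "length w" arbitrary: w rule: less_induct)
  case less
  show ?case
  proof (cases w)
    case Nil
    have "words_below [] = {[]}"
      by (auto simp: words_below_def)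
    then show ?thesis
      using Nil by (simp add: below_sum_def KL_bounded_def)
  next
    case (Cons b w')
    \<comment> \<open>Split off the first maximal block, either \<open>Hub\<close>s or \<open>New\<close> followed by \<open>Join\<close>s.\<close>
    define c where "c = (if b = Hub then Hub else Join)"
    define k r where "k = length (takeWhile ((=) c) w')" and "r = dropWhile ((=) c) w'"
    have "takeWhile ((=) c) w' = replicate k c"
      unfolding k_def by (rule replicate_eqI) (auto dest: set_takeWhileD)
    then have w: "w = (b # replicate k c) @ r"
      using Cons by (metis append_Cons r_def takeWhile_dropWhile_id)
    have hd_r: "r = [] \<or> hd r \<noteq> c"
      using hd_dropWhile[of "(=) c" w'] by (metis r_def)
    have b: "b \<noteq> Join"
      using less.prems Cons by auto
    have r: "admissible False r"
    proof (cases r)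
      case Cons': (Cons a r')
      then show ?thesis
        using less.prems hd_r unfolding w admissible_append by (cases b) (auto simp: c_def split: if_splits)
    qed simp
    have border: "last (b # replicate k c) \<noteq> Hub \<or> r = [] \<or> hd r \<noteq> Hub"
      using hd_r b by (auto simp: c_def split: if_splits)
    have rest: "KL_bounded (word_rank r) (below_sum y r)"
      using less.hyps[of r] r by (simp add: w)
    have block: "KL_bounded (word_rank (b # replicate k c)) (below_sum y (b # replicate k c))"
    proof (cases "b = Hub")
      case True
      then have "b # replicate k c = replicate (Suc k) Hub"
        by (simp add: c_def)
      then show ?thesis
        using bound[of "Suc k"] by (simp only: below_sum_hub_block word_rank_replicate) simp
    next
      case False
      then have "b = New" "c = Join"
        using b by (auto simp: c_def intro: letter.exhaust)
      then show ?thesis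
        by (simp add: below_sum_path_block KL_bounded_def)
    qed
    have "below_sum y w = below_sum y (b # replicate k c) * below_sum y r"
      unfolding w using border by (intro below_sum_append[OF r]) blast
    then show ?thesis
      using KL_bounded_mult[OF block rest] by (simp only: w word_rank_simps(3))
  qed
qed

text \<open>Let \<open>A\<close> count the words that do not start with \<open>Hub\<close> and \<open>C\<close> those that may start with \<open>Join\<close>. Splitting off the
  initial run of \<open>Hub\<close>s gives \<open>B = Y A\<close>; splitting off one letter gives \<open>A = 1 - t x C\<close> and \<open>C = B + u C\<close>.\<close>

lemma all_words_fps:
  assumes y0: "y 0 = 1"
  defines "Y \<equiv> Abs_fps y" and "B \<equiv> Abs_fps (all_words_sum y False)"
    and "u \<equiv> fps_const [:1, 1:] * fps_X" and "s \<equiv> fps_const [:0, 1:] * fps_X"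
  shows "B * (1 - u + s * Y) = Y * (1 - u)"
proof -
  define val where "val v = [:0, -1:] ^ news v * weight y v" for v
  define words where "words j k = {v. length v = k \<and> admissible j v}" for j k
  define hubless where "hubless k = {v \<in> words False k. v = [] \<or> hd v \<noteq> Hub}" for k
  define A where "A = Abs_fps (\<lambda>k. sum val (hubless k))"
  define C where "C = Abs_fps (\<lambda>k. sum val (words True k))"
  have fin: "finite (words j k)" for j k
    unfolding words_def by (rule finite_words)
  have words_0: "words j 0 = {[]}" for j
    by (auto simp: words_def)
  have B_nth: "fps_nth B k = sum val (words False k)" for k
    by (simp add: B_def all_words_sum_def val_def words_def)
  have C: "C = B + u * C"
  proof (rule fps_ext)
    fix k
    show "fps_nth C k = fps_nth (B + u * C) k"
    proof (cases k)
      case 0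
      then show ?thesis
        by (simp add: C_def B_nth words_0 u_def)
    next
      case (Suc m)
      have "words True (Suc m) = words False (Suc m) \<union> (#) Join ` words True m"
      proof (rule set_eqI)
        fix v show "v \<in> words True (Suc m) \<longleftrightarrow> v \<in> words False (Suc m) \<union> (#) Join ` words True m"
          by (cases v) (auto simp: words_def)
      qed
      moreover have "words False (Suc m) \<inter> (#) Join ` words True m = {}"
        by (auto simp: words_def)
      ultimately have "sum val (words True (Suc m)) = sum val (words False (Suc m)) + (\<Sum>v \<in> words True m. val (Join # v))"
        using fin by (simp add: sum.union_disjoint sum.reindex)
      also have "(\<Sum>v \<in> words True m. val (Join # v)) = [:1, 1:] * sum val (words True m)"
        unfolding sum_distrib_left val_def by (intro sum.cong refl) (simp add: algebra_simps)
      finally show ?thesis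
        using Suc by (simp add: C_def B_nth u_def mult.assoc)
    qed
  qed
  have A: "A = 1 - s * C"
  proof (rule fps_ext)
    fix k
    show "fps_nth A k = fps_nth (1 - s * C) k"
    proof (cases k)
      case 0
      have "hubless 0 = {[]}"
        by (auto simp: hubless_def words_0)
      then show ?thesis
        using 0 by (simp add: A_def s_def val_def)
    next
      case (Suc m)
      have "hubless (Suc m) = (#) New ` words True m"
      proof (rule set_eqI)
        fix v show "v \<in> hubless (Suc m) \<longleftrightarrow> v \<in> (#) New ` words True m"
        proof (cases v)
          case (Cons a v')
          then show ?thesis
            by (cases a) (auto simp: words_def hubless_def)
        qed (auto simp: words_def hubless_def)
      qed
      then have "sum val (hubless (Suc m)) = (\<Sum>v \<in> words True m. val (New # v))"
        by (simp add: sum.reindex)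
      also have "\<dots> = [:0, -1:] * sum val (words True m)"
        unfolding sum_distrib_left val_def by (intro sum.cong refl) (simp add: algebra_simps)
      finally show ?thesis
        using Suc by (simp add: C_def A_def s_def mult.assoc)
    qed
  qed
  have B: "B = Y * A"
  proof (rule fps_ext)
    fix k
    have "sum val (words False k) = (\<Sum>(i, r) \<in> Sigma {..k} (\<lambda>i. hubless (k - i)). val (replicate i Hub @ r))"
    proof (rule sum.reindex_bij_witness[of _ "\<lambda>(i, r). replicate i Hub @ r"
          "\<lambda>v. (length (takeWhile ((=) Hub) v), dropWhile ((=) Hub) v)"])
      have takeWhile: "takeWhile ((=) Hub) v = replicate (length (takeWhile ((=) Hub) v)) Hub" for v
        by (rule replicate_eqI) (auto dest: set_takeWhileD)
      {
        fix v assume v: "v \<in> words False k"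
        show eq: "(case (length (takeWhile ((=) Hub) v), dropWhile ((=) Hub) v) of
            (i, r) \<Rightarrow> replicate i Hub @ r) = v"
          using takeWhile[of v] by simp
        define i r where "i = length (takeWhile ((=) Hub) v)" and "r = dropWhile ((=) Hub) v"
        have v_eq: "v = replicate i Hub @ r"
          using eq by (simp add: i_def r_def)
        have hd_r: "r = [] \<or> hd r \<noteq> Hub"
          using hd_dropWhile[of "(=) Hub" v] by (metis r_def)
        have "admissible False r"
          using v unfolding words_def v_eq by (cases i) (auto simp: admissible_append split: if_splits)
        then have "i \<le> k" "r \<in> hubless (k - i)"
          using v hd_r by (auto simp: hubless_def words_def v_eq)
        then show "(length (takeWhile ((=) Hub) v), dropWhile ((=) Hub) v) \<in> Sigma {..k} (\<lambda>i. hubless (k - i))"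
          by (simp add: i_def r_def)
        show "(case (length (takeWhile ((=) Hub) v), dropWhile ((=) Hub) v) of
            (i, r) \<Rightarrow> val (replicate i Hub @ r)) = val v"
          using eq by simp
      }
      fix p assume "p \<in> Sigma {..k} (\<lambda>i. hubless (k - i))"
      then obtain i r where p: "p = (i, r)" "i \<le> k" "r \<in> words False (k - i)" "r = [] \<or> hd r \<noteq> Hub"
        by (auto simp: hubless_def)
      have "takeWhile ((=) Hub) r = []" "dropWhile ((=) Hub) r = r"
        using p(4) by (cases r; auto)+
      then show "(length (takeWhile ((=) Hub) (case p of (i, r) \<Rightarrow> replicate i Hub @ r)),
          dropWhile ((=) Hub) (case p of (i, r) \<Rightarrow> replicate i Hub @ r)) = p"
        by (simp add: p(1) takeWhile_append dropWhile_append)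
      have "admissible j (replicate i Hub)" for j
        by (induction i arbitrary: j) auto
      moreover have "admissible j r \<longleftrightarrow> admissible False r" if "\<not> j" for j
        using that by simp
      ultimately show "(case p of (i, r) \<Rightarrow> replicate i Hub @ r) \<in> words False k"
        using p by (auto simp: words_def admissible_append)
    qed
    also have "\<dots> = (\<Sum>i\<le>k. \<Sum>r \<in> hubless (k - i). val (replicate i Hub @ r))"
      using fin by (subst sum.Sigma) (auto simp: hubless_def)
    also have "\<dots> = (\<Sum>i\<le>k. y i * sum val (hubless (k - i)))"
    proof (intro sum.cong refl)
      fix i assume "i \<in> {..k}"
      have "val (replicate i Hub @ r) = y i * val r" if "r \<in> hubless (k - i)" for r
      proof -
        have hd_r: "r = [] \<or> hd r \<noteq> Hub"
          using that by (simp add: hubless_def)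
        have "weight y (replicate i Hub) = y i"
          using y0 by (cases i) (simp_all add: takeWhile_replicate dropWhile_replicate)
        then have "weight y (replicate i Hub @ r) = y i * weight y r"
          using hd_r by (subst weight_append) auto
        moreover have "news (replicate i Hub) = 0"
          by (induction i) auto
        ultimately show ?thesis
          by (simp add: val_def mult.left_commute)
      qed
      then show "(\<Sum>r \<in> hubless (k - i). val (replicate i Hub @ r)) = y i * sum val (hubless (k - i))"
        by (simp add: sum_distrib_left)
    qed
    finally show "fps_nth B k = fps_nth (Y * A) k"
      by (simp add: B_nth fps_mult_nth Y_def A_def atMost_atLeast0)
  qed
  have "C * (1 - u) = C - u * C"
    by (simp add: algebra_simps)
  also have "\<dots> = B"
    using C by (metis add_diff_cancel_right')
  finally have C': "C * (1 - u) = B" .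
  have "B * (1 - u) = Y * (1 - u) - Y * s * (C * (1 - u))"
    unfolding B A by (simp add: algebra_simps)
  then show ?thesis
    unfolding C' by (simp add: algebra_simps)
qed

section \<open>Flats of fan graphs\<close>

text \<open>A function that is constant along edges and maps each vertex into its component describes connectedness.\<close>

lemma conn_eq_kernel:
  assumes edge: "\<And>e u v. e \<in> A \<Longrightarrow> ends G e = {u, v} \<Longrightarrow> u \<in> verts G \<Longrightarrow> v \<in> verts G \<Longrightarrow> f u = f v"
    and reach: "\<And>v. v \<in> verts G \<Longrightarrow> (v, f v) \<in> conn G A"
  shows "conn G A = {(u, v). u \<in> verts G \<and> v \<in> verts G \<and> f u = f v}"
proof
  show "conn G A \<subseteq> {(u, v). u \<in> verts G \<and> v \<in> verts G \<and> f u = f v}"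
  proof (rule conn_least)
    show "equiv (verts G) {(u, v). u \<in> verts G \<and> v \<in> verts G \<and> f u = f v}"
      by (auto simp: equiv_def refl_on_def sym_def trans_def)
  qed (use edge in auto)
  show "{(u, v). u \<in> verts G \<and> v \<in> verts G \<and> f u = f v} \<subseteq> conn G A"
  proof clarify
    fix u v assume "u \<in> verts G" "v \<in> verts G" "f u = f v"
    then show "(u, v) \<in> conn G A"
      using reach[of u] conn_sym[OF reach[of v]] by (auto intro: conn_trans)
  qed
qed

lemma verts_fan: "verts (fan_graph n) = {..n}" and ends_fan: "ends (fan_graph n) e = e"
  by (auto simp: fan_graph_def)

lemma spoke_in_fan: "{0, i} \<in> edges (fan_graph n) \<longleftrightarrow> 1 \<le> i \<and> i \<le> n"
  by (auto simp: fan_graph_def doubleton_eq_iff)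

lemma path_in_fan: "1 \<le> i \<Longrightarrow> {i, Suc i} \<in> edges (fan_graph n) \<longleftrightarrow> i < n"
  by (auto simp: fan_graph_def doubleton_eq_iff)

lemma fan_edge_cases:
  assumes "e \<in> edges (fan_graph n)"
  obtains (spoke) i where "e = {0, Suc i}" "i < n" | (path) i where "e = {i, Suc i}" "1 \<le> i" "i < n"
proof -
  consider i where "1 \<le> i" "i < n" "e = {i, i + 1}" | i where "1 \<le> i" "i \<le> n" "e = {0, i}"
    using assms by (auto simp: fan_graph_def)
  then show ?thesis
  proof cases
    case (2 i)
    then show ?thesis
      using spoke[of "i - 1"] by simp
  qed (use path in simp)
qed

lemma finite_loopless_fan: "finite_loopless (fan_graph n)"
proof -
  have "edges (fan_graph n) \<subseteq> Pow {..n}"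
    by (auto elim!: fan_edge_cases)
  then have "finite (edges (fan_graph n))"
    by (rule finite_subset) simp
  moreover have "e \<subseteq> {..n} \<and> card e = 2" if "e \<in> edges (fan_graph n)" for e
    using that by (cases rule: fan_edge_cases) auto
  ultimately show ?thesis
    by (simp add: finite_loopless_def verts_fan ends_fan)
qed

text \<open>Letters are numbered from \<open>0\<close>, so letter \<open>i\<close> belongs to the vertex \<open>i + 1\<close>, and the path edge \<open>{i, i + 1}\<close> joins
  the vertices of the letters \<open>i - 1\<close> and \<open>i\<close>.\<close>

definition fan_flat :: "letter list \<Rightarrow> nat set set" where
  "fan_flat w =
    {{0, Suc i} | i. i < length w \<and> w ! i = Hub} \<union>
    {{i, Suc i} | i. 1 \<le> i \<and> i < length w \<and> (w ! i = Join \<or> w ! i = Hub \<and> w ! (i - 1) = Hub)}"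

lemma spoke_in_fan_flat: "{0, Suc i} \<in> fan_flat w \<longleftrightarrow> i < length w \<and> w ! i = Hub"
  by (auto simp: fan_flat_def doubleton_eq_iff)

lemma path_in_fan_flat:
  "1 \<le> i \<Longrightarrow> {i, Suc i} \<in> fan_flat w \<longleftrightarrow>
    i < length w \<and> (w ! i = Join \<or> w ! i = Hub \<and> w ! (i - 1) = Hub)"
  by (auto simp: fan_flat_def doubleton_eq_iff)

lemma fan_flat_subset: "fan_flat w \<subseteq> edges (fan_graph (length w))"
  by (auto simp: fan_flat_def fan_graph_def)

text \<open>For an admissible word, the least vertex in the component of a vertex.\<close>

primrec leader :: "letter list \<Rightarrow> nat \<Rightarrow> nat" where
  "leader w 0 = 0"
| "leader w (Suc i) = (case w ! i of Hub \<Rightarrow> 0 | New \<Rightarrow> Suc i | Join \<Rightarrow> leader w i)"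

lemma admissible_nth:
  "admissible (x \<noteq> Hub) w \<longleftrightarrow> (\<forall>i < length w. w ! i = Join \<longrightarrow> (x # w) ! i \<noteq> Hub)"
proof (induction w arbitrary: x)
  case (Cons a w)
  show ?case
    by (simp add: Cons.IH All_less_Suc2 nth_Cons split: nat.split)
qed simp

lemma admissible_False_nth:
  "admissible False w \<longleftrightarrow> (\<forall>i < length w. w ! i = Join \<longrightarrow> 1 \<le> i \<and> w ! (i - 1) \<noteq> Hub)"
  using admissible_nth[of Hub w] by (auto simp: nth_Cons split: nat.splits)

lemma below_nth:
  "length v = length w \<Longrightarrow> below (x = Hub) v w \<longleftrightarrow>
    (\<forall>i < length w. (v ! i = Hub \<longrightarrow> w ! i = Hub) \<and>
      (v ! i = Join \<longrightarrow> w ! i = Join \<or> w ! i = Hub \<and> (x # w) ! i = Hub))"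
proof (induction v w arbitrary: x rule: list_induct2)
  case (Cons a v b w)
  show ?case
    by (simp add: Cons.IH[of b] All_less_Suc2)
qed simp

lemma leader_le: "leader w i \<le> i"
  by (induction i) (auto split: letter.split)

lemma leader_eq_0_iff:
  assumes "admissible False w" "i < length w"
  shows "leader w (Suc i) = 0 \<longleftrightarrow> w ! i = Hub"
  using assms(2)
proof (induction i)
  case 0
  then show ?case
    using assms(1) by (auto simp: admissible_False_nth split: letter.split)
next
  case (Suc i)
  then show ?case
    using assms(1) by (auto simp: admissible_False_nth split: letter.split)
qed

lemma conn_fan_flat:
  assumes w: "admissible False w"
  shows "conn (fan_graph (length w)) (fan_flat w) =
    {(u, v). u \<le> length w \<and> v \<le> length w \<and> leader w u = leader w v}"
proof -
  let ?G = "fan_graph (length w)"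
  have "conn ?G (fan_flat w) = {(u, v). u \<in> verts ?G \<and> v \<in> verts ?G \<and> leader w u = leader w v}"
  proof (rule conn_eq_kernel)
    fix e u v assume e: "e \<in> fan_flat w" "ends ?G e = {u, v}"
    consider i where "e = {0, Suc i}" "w ! i = Hub" | i where "e = {i, Suc i}" "w ! i = Join"
      | i where "e = {i, Suc i}" "1 \<le> i" "w ! i = Hub" "w ! (i - 1) = Hub"
      using e(1) by (auto simp: fan_flat_def)
    then have "\<exists>i j. e = {i, j} \<and> leader w i = leader w j"
    proof cases
      case (1 i)
      then show ?thesis
        by (intro exI[of _ 0] exI[of _ "Suc i"]) simp
    next
      case (2 i)
      then show ?thesis
        by (intro exI[of _ i] exI[of _ "Suc i"]) simp
    next
      case (3 i)
      then have "leader w i = 0"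
        by (cases i) auto
      then show ?thesis
        using 3 by (intro exI[of _ i] exI[of _ "Suc i"]) simp
    qed
    then show "leader w u = leader w v"
      using e(2) by (auto simp: ends_fan doubleton_eq_iff)
  next
    fix v assume "v \<in> verts ?G"
    then have "v \<le> length w"
      by (simp add: verts_fan)
    then show "(v, leader w v) \<in> conn ?G (fan_flat w)"
    proof (induction v)
      case 0
      then show ?case
        by (simp add: conn_refl verts_fan)
    next
      case (Suc i)
      show ?case
      proof (cases "w ! i")
        case Hub
        then have "{0, Suc i} \<in> fan_flat w"
          using Suc.prems by (simp add: spoke_in_fan_flat)
        then have "(0, Suc i) \<in> conn ?G (fan_flat w)"
          using Suc.prems by (intro conn_edge) (auto simp: ends_fan verts_fan)
        then show ?thesis
          using Hub by (auto intro: conn_sym)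
      next
        case New
        then show ?thesis
          using Suc.prems by (simp add: conn_refl verts_fan)
      next
        case Join
        then have "1 \<le> i"
          using w Suc.prems by (auto simp: admissible_False_nth)
        then have "{i, Suc i} \<in> fan_flat w"
          using Join Suc.prems by (simp add: path_in_fan_flat)
        then have "(Suc i, i) \<in> conn ?G (fan_flat w)"
          using Suc.prems by (intro conn_edge[of "{i, Suc i}"]) (auto simp: ends_fan verts_fan)
        then show ?thesis
          using Join Suc.IH Suc.prems by (auto intro: conn_trans)
      qed
    qed
  qed
  then show ?thesis
    by (simp add: verts_fan)
qed

lemma edge_rank_fan_flat:
  assumes w: "admissible False w"
  shows "edge_rank (fan_graph (length w)) (fan_flat w) = word_rank w"
proof -
  let ?G = "fan_graph (length w)" and ?N = "{i. i < length w \<and> w ! i = New}"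
  have "card (verts ?G // conn ?G (fan_flat w)) = card (leader w ` verts ?G)"
    by (rule card_quotient_kernel) (simp add: conn_fan_flat[OF w] verts_fan)
  also have "leader w ` verts ?G = insert 0 (Suc ` ?N)"
  proof (intro equalityI subsetI)
    fix x assume "x \<in> leader w ` verts ?G"
    then obtain v where "v \<le> length w" "x = leader w v"
      by (auto simp: verts_fan)
    then show "x \<in> insert 0 (Suc ` ?N)"
    proof (induction v arbitrary: x)
      case (Suc i)
      then show ?case
        by (cases "w ! i") auto
    qed simp
  next
    fix x assume "x \<in> insert 0 (Suc ` ?N)"
    then have "leader w x = x" "x \<in> verts ?G"
      by (auto simp: verts_fan)
    then show "x \<in> leader w ` verts ?G"
      by (metis image_eqI)
  qed
  also have "card (insert 0 (Suc ` ?N)) = Suc (card ?N)"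
    by (subst card_insert_disjoint) (auto simp: card_image)
  also have "card ?N = news w"
    by (simp add: news_def length_filter_conv_card)
  finally show ?thesis
    by (simp add: edge_rank_eq verts_fan word_rank_news)
qed

lemma fan_flat_in_flats:
  assumes w: "admissible False w"
  shows "fan_flat w \<in> flats (fan_graph (length w))"
  unfolding flats_iff_closed[OF finite_loopless_fan]
proof (intro conjI ballI allI impI)
  let ?G = "fan_graph (length w)"
  show "fan_flat w \<subseteq> edges ?G"
    by (rule fan_flat_subset)
  fix e u v assume e: "e \<in> edges ?G" "ends ?G e = {u, v}" "(u, v) \<in> conn ?G (fan_flat w)"
  then have eq: "leader w x = leader w y" if "e = {x, y}" for x y
    using that by (auto simp: conn_fan_flat[OF w] ends_fan doubleton_eq_iff)
  from e(1) show "e \<in> fan_flat w"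
  proof (cases rule: fan_edge_cases)
    case (spoke i)
    then show ?thesis
      using eq[of 0 "Suc i"] leader_eq_0_iff[OF w] by (simp add: spoke_in_fan_flat del: leader.simps(2))
  next
    case (path i)
    then have eq': "leader w i = leader w (Suc i)"
      using eq by blast
    show ?thesis
    proof (cases "w ! i")
      case Hub
      then have "leader w (Suc (i - 1)) = 0"
        using eq' path by simp
      then have "w ! (i - 1) = Hub"
        using leader_eq_0_iff[OF w, of "i - 1"] path by (simp del: leader.simps(2))
      then show ?thesis
        using Hub path by (simp add: path_in_fan_flat)
    next
      case New
      then show ?thesis
        using eq' leader_le[of w i] by simp
    next
      case Join
      then show ?thesis
        using path by (simp add: path_in_fan_flat)
    qed
  qed
qed

text \<open>The word is read off from the spokes and the path edges of the flat. Closedness of the flat is used for the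
  triangles formed by the hub and two neighbours on the path.\<close>

lemma flat_of_fan_is_fan_flat:
  assumes F: "F \<in> flats (fan_graph n)"
  obtains w where "length w = n" "admissible False w" "fan_flat w = F"
proof -
  let ?G = "fan_graph n"
  have F_sub: "F \<subseteq> edges ?G"
    and closed: "\<And>e u v. e \<in> edges ?G \<Longrightarrow> e = {u, v} \<Longrightarrow> (u, v) \<in> conn ?G F \<Longrightarrow> e \<in> F"
    using F unfolding flats_iff_closed[OF finite_loopless_fan] ends_fan by auto
  have edge: "(u, v) \<in> conn ?G F" if "{u, v} \<in> F" for u v
  proof -
    have "{u, v} \<subseteq> verts ?G"
      using that F_sub finite_loopless_fan[of n] unfolding finite_loopless_def ends_fan by blast
    then show ?thesis
      using that by (intro conn_edge) (auto simp: ends_fan)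
  qed
  \<comment> \<open>Two edges of a triangle \<open>0, i, i + 1\<close> force the third.\<close>
  have triangle: "{u, w} \<in> F" if "{u, v} \<in> F" "{v, w} \<in> F" "{u, w} \<in> edges ?G" for u v w
    using that closed[of "{u, w}" u w] edge[of u v] edge[of v w] by (auto intro: conn_trans)
  \<comment> \<open>An edge from the hub takes precedence: two neighbours that are both connected to the hub
    are also joined on the path.\<close>
  define w where "w = map (\<lambda>i. if {0, Suc i} \<in> F then Hub else if 1 \<le> i \<and> {i, Suc i} \<in> F then Join else New) [0..<n]"
  have len: "length w = n"
    by (simp add: w_def)
  have Hub: "w ! i = Hub \<longleftrightarrow> {0, Suc i} \<in> F" and Join: "w ! i = Join \<longleftrightarrow> {0, Suc i} \<notin> F \<and> 1 \<le> i \<and> {i, Suc i} \<in> F"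
    if "i < n" for i
    using that by (auto simp: w_def)
  have step: "{0, Suc i} \<in> F \<longleftrightarrow> {0, i} \<in> F" if "1 \<le> i" "i < n" "{i, Suc i} \<in> F" for i
    using that triangle[of 0 i "Suc i"] triangle[of 0 "Suc i" i] by (auto simp: spoke_in_fan insert_commute)
  have "admissible False w"
    unfolding admissible_False_nth len
  proof (intro allI impI)
    fix i assume i: "i < n" "w ! i = Join"
    then have J: "{0, Suc i} \<notin> F" "1 \<le> i" "{i, Suc i} \<in> F"
      by (auto simp: Join)
    then have "{0, i} \<notin> F"
      using step i by blast
    then show "1 \<le> i \<and> w ! (i - 1) \<noteq> Hub"
      using J i by (simp add: Hub)
  qed
  moreover have "fan_flat w = F"
  proof (intro set_eqI)
    fix e
    show "e \<in> fan_flat w \<longleftrightarrow> e \<in> F"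
    proof (cases "e \<in> edges ?G")
      case True
      then show ?thesis
      proof (cases rule: fan_edge_cases)
        case (spoke i)
        then show ?thesis
          by (simp add: spoke_in_fan_flat len Hub)
      next
        case (path i)
        have "{i, Suc i} \<in> F" if "{0, Suc i} \<in> F" "{0, i} \<in> F"
          using triangle[of i 0 "Suc i"] that path by (auto simp: path_in_fan insert_commute)
        then show ?thesis
          using path step[of i] by (auto simp: path_in_fan_flat len Hub Join)
      qed
    next
      case False
      then show ?thesis
        using F_sub fan_flat_subset[of w] len by auto
    qed
  qed
  ultimately show ?thesis
    using that len by blast
qed

lemma fan_flat_subset_iff:
  assumes v: "admissible False v" and w: "admissible False w" and len: "length v = length w"
  shows "fan_flat v \<subseteq> fan_flat w \<longleftrightarrow> below False v w"
proof -
  have below: "below False v w \<longleftrightarrow> (\<forall>i < length w. (v ! i = Hub \<longrightarrow> w ! i = Hub) \<and>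
      (v ! i = Join \<longrightarrow> w ! i = Join \<or> w ! i = Hub \<and> w ! (i - 1) = Hub))"
  proof -
    have *: "(New # w) ! i = w ! (i - 1)" if "v ! i = Join" "i < length w" for i
      using v that len by (auto simp: admissible_False_nth nth_Cons')
    show ?thesis
      using below_nth[OF len, of New] * by auto
  qed
  show ?thesis
  proof
    assume sub: "fan_flat v \<subseteq> fan_flat w"
    show "below False v w"
      unfolding below
    proof (intro allI impI conjI)
      fix i assume i: "i < length w"
      show "w ! i = Hub" if "v ! i = Hub"
      proof -
        have "{0, Suc i} \<in> fan_flat v"
          using that i len by (simp add: spoke_in_fan_flat)
        then have "{0, Suc i} \<in> fan_flat w"
          using sub by blast
        then show ?thesis
          by (simp add: spoke_in_fan_flat)
      qed
      show "w ! i = Join \<or> w ! i = Hub \<and> w ! (i - 1) = Hub" if "v ! i = Join"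
      proof -
        have "1 \<le> i"
          using v that i len by (simp add: admissible_False_nth)
        then have "{i, Suc i} \<in> fan_flat v"
          using that i len by (simp add: path_in_fan_flat)
        then have "{i, Suc i} \<in> fan_flat w"
          using sub by blast
        then show ?thesis
          using \<open>1 \<le> i\<close> by (simp add: path_in_fan_flat)
      qed
    qed
  next
    assume b: "below False v w"
    show "fan_flat v \<subseteq> fan_flat w"
    proof
      fix e assume e: "e \<in> fan_flat v"
      then have "e \<in> edges (fan_graph (length v))"
        using fan_flat_subset by blast
      then show "e \<in> fan_flat w"
      proof (cases rule: fan_edge_cases)
        case (spoke i)
        then show ?thesis
          using e b len unfolding below by (simp add: spoke_in_fan_flat)
      next
        case (path i)
        then have "i - 1 < length w"
          using len by simp
        then show ?thesis
          using path e b len unfolding below by (auto simp: path_in_fan_flat)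
      qed
    qed
  qed
qed

lemma fan_flat_inj:
  assumes v: "admissible False v" and w: "admissible False w" and len: "length v = length w"
    and eq: "fan_flat v = fan_flat w"
  shows "v = w"
proof (rule nth_equalityI[OF len])
  fix i assume i: "i < length v"
  have "v ! i = Hub \<longleftrightarrow> w ! i = Hub"
    using spoke_in_fan_flat[of i v] spoke_in_fan_flat[of i w] eq i len by simp
  moreover have "v ! i = Join \<longleftrightarrow> w ! i = Join"
  proof (cases "1 \<le> i")
    case True
    then show ?thesis
      using path_in_fan_flat[OF True, of v] path_in_fan_flat[OF True, of w] eq i len calculation by auto
  next
    case False
    then show ?thesis
      using v w i len by (auto simp: admissible_False_nth)
  qed
  ultimately show "v ! i = w ! i"
    by (cases "v ! i"; cases "w ! i") auto
qed

lemma fan_flat_replicate_Hub: "fan_flat (replicate n Hub) = edges (fan_graph n)"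
proof (intro equalityI subsetI)
  fix e assume "e \<in> edges (fan_graph n)"
  then show "e \<in> fan_flat (replicate n Hub)"
    by (cases rule: fan_edge_cases) (auto simp: spoke_in_fan_flat path_in_fan_flat)
qed (use fan_flat_subset[of "replicate n Hub"] in auto)

text \<open>The encoding transports the criterion from flats to words; the fan itself is the word that consists
  of \<open>Hub\<close>s only.\<close>

lemma inverse_Z_poly_fan:
  assumes pal: "\<And>k. palindromic k (y k)" and bound: "\<And>k. KL_bounded k (all_words_sum y False k)"
    and y0: "y 0 = 1"
  shows "real_poly (inverse_Z_poly (fan_graph n)) = y n"
proof -
  define W where "W = {w. length w = n \<and> admissible False w}"
  define word where "word = inv_into W fan_flat"
  have inj: "inj_on fan_flat W"
    by (rule inj_onI) (auto simp: W_def intro: fan_flat_inj)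
  have flats: "flats (fan_graph n) = fan_flat ` W"
  proof (intro equalityI subsetI)
    fix F assume "F \<in> flats (fan_graph n)"
    then show "F \<in> fan_flat ` W"
      by (rule flat_of_fan_is_fan_flat) (auto simp: W_def)
  qed (auto simp: W_def intro: fan_flat_in_flats)
  have word [simp]: "word (fan_flat w) = w" if "w \<in> W" for w
    using that inj by (simp add: word_def)
  have rank: "edge_rank (fan_graph n) (fan_flat w) = word_rank w" if "w \<in> W" for w
    using that edge_rank_fan_flat[of w] by (auto simp: W_def)
  have "admissible j (replicate n Hub)" for j
    by (induction n arbitrary: j) auto
  then have top: "replicate n Hub \<in> W"
    by (simp add: W_def)
  have "real_poly (inverse_Z_poly (fan_graph n)) = weight y (word (edges (fan_graph n)))"
  proof (rule inverse_Z_poly_characterization[OF finite_loopless_fan])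
    fix F assume "F \<in> flats (fan_graph n)"
    then obtain w where w: "w \<in> W" "F = fan_flat w"
      by (auto simp: flats)
    show "palindromic (edge_rank (fan_graph n) F) (weight y (word F))"
      using w palindromic_weight[OF pal] by (simp add: rank)
    have "v \<in> words_below w \<longleftrightarrow> v \<in> W \<and> fan_flat v \<subseteq> F" for v
      using w fan_flat_subset_iff[of v w] by (auto simp: words_below_def W_def)
    then have "{A \<in> flats (fan_graph n). A \<subseteq> F} = fan_flat ` words_below w"
      unfolding flats by blast
    moreover have "words_below w \<subseteq> W"
      using w by (auto simp: words_below_def W_def)
    ultimately have "(\<Sum>A \<in> {A \<in> flats (fan_graph n). A \<subseteq> F}.
        [:0, -1:] ^ (edge_rank (fan_graph n) F - edge_rank (fan_graph n) A) * weight y (word A)) = below_sum y w"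
      using w inj unfolding below_sum_def
      by (subst sum.reindex_cong[of fan_flat "words_below w" _ _
            "\<lambda>v. [:0, -1:] ^ (word_rank w - word_rank v) * weight y v"])
        (auto simp: rank subset_iff intro: inj_on_subset)
    then show "KL_bounded (edge_rank (fan_graph n) F) (\<Sum>A \<in> {A \<in> flats (fan_graph n). A \<subseteq> F}.
        [:0, -1:] ^ (edge_rank (fan_graph n) F - edge_rank (fan_graph n) A) * weight y (word A))"
      using w KL_bounded_below_sum[OF bound, of w] by (simp add: rank W_def)
  qed
  also have "word (edges (fan_graph n)) = replicate n Hub"
    using word[OF top] by (simp add: fan_flat_replicate_Hub)
  also have "weight y (replicate n Hub) = y n"
    using y0 by (cases n) (simp_all add: takeWhile_replicate dropWhile_replicate)
  finally show ?thesis .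
qed

section \<open>Generating functions\<close>

unbundle fps_syntax

text \<open>The series \<open>p\<close> with \<open>p - p\<^sup>2 = v\<close>, that is, \<open>v\<close> times the generating function of the Catalan numbers.\<close>

definition catalan :: "real fps" where
  "catalan = fps_inv (fps_X - fps_X ^ 2)"

lemma catalan_nth_0 [simp]: "catalan $ 0 = 0"
  by (simp add: catalan_def fps_inv_def)

lemma catalan_equation: "catalan - catalan ^ 2 = fps_X"
proof -
  have "(fps_X - fps_X ^ 2) oo catalan = fps_X"
    unfolding catalan_def by (rule fps_inv_right) simp_all
  moreover have "(fps_X ^ 2 :: real fps) oo catalan = catalan ^ 2"
    by (simp add: power2_eq_square fps_compose_mult_distrib)
  ultimately show ?thesis
    by (simp add: fps_compose_sub_distrib)
qed

text \<open>The ballot numbers satisfy the recurrence that \<open>p\<^sup>r = p\<^bsup>r+1\<^esup> + v p\<^bsup>r-1\<^esup>\<close> imposes on the coefficients of powers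
  of \<open>p\<close>.\<close>

lemma ballot_step:
  assumes "1 \<le> r" "r < j"
  shows "real (r + 1) / real (2 * j - r - 1) * real ((2 * j - r - 1) choose j) +
      real (r - 1) / real (2 * j - r - 1) * real ((2 * j - r - 1) choose (j - 1)) =
    real r / real (2 * j - r) * real ((2 * j - r) choose j)"
proof -
  define N where "N = 2 * j - r - 1"
  define c where "c = real (Suc N choose j)"
  have N: "2 * j - r = Suc N" "j \<le> N" "1 \<le> j" "N + 1 + r = 2 * j"
    using assms by (auto simp: N_def)
  have "(Suc N - j) * (Suc N choose j) = Suc N * (N choose j)"
    using binomial_absorb_comp[of "Suc N" j] by simp
  then have "real (Suc N - j) * c = real (Suc N) * real (N choose j)"
    unfolding c_def by (metis of_nat_mult)
  then have 1: "real (N choose j) = real (j - r) * c / real (Suc N)"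
  proof -
    have "Suc N - j = j - r"
      using N by simp
    then show ?thesis
      using \<open>real (Suc N - j) * c = real (Suc N) * real (N choose j)\<close> by (simp add: field_simps)
  qed
  have "j * (Suc N choose j) = Suc N * (N choose (j - 1))"
    using N by (metis Suc_times_binomial_eq Suc_pred' less_eq_Suc_le One_nat_def mult.commute)
  then have "real j * c = real (Suc N) * real (N choose (j - 1))"
    unfolding c_def by (metis of_nat_mult)
  then have 2: "real (N choose (j - 1)) = real j * c / real (Suc N)"
    by (simp add: field_simps)
  have sum: "real (r + 1) * real (j - r) + real (r - 1) * real j = real r * real N"
    using N assms by (simp add: of_nat_diff algebra_simps N_def)
  have "real N > 0"
    using N by simp
  then have "(real (r + 1) * real (j - r) + real (r - 1) * real j) * c / (real N * real (Suc N)) =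
      real r * c / real (Suc N)"
    unfolding sum by simp
  then show ?thesis
    unfolding N_def[symmetric] unfolding N(1) c_def[symmetric] 1 2
    by (simp add: add_divide_distrib ring_distribs mult_ac)
qed

text \<open>The recurrence expresses the coefficient for \<open>(j, r)\<close> by those for \<open>(j, r + 1)\<close> and \<open>(j - 1, r - 1)\<close>, so the
  induction goes upwards in \<open>j\<close> and downwards from \<open>r = j\<close>.\<close>

lemma catalan_power_nth:
  "1 \<le> r \<Longrightarrow> r \<le> j \<Longrightarrow> (catalan ^ r) $ j = real r / real (2 * j - r) * real ((2 * j - r) choose j)"
proof (induction j arbitrary: r)
  case (Suc i)
  have prev: "(catalan ^ (r - 1)) $ i = real (r - 1) / real (2 * Suc i - r - 1) * real ((2 * Suc i - r - 1) choose i)"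
    if "1 \<le> r" "r \<le> i" for r
  proof (cases "r = 1")
    case True
    then show ?thesis
      using that by simp
  next
    case False
    then have "2 * i - (r - 1) = 2 * Suc i - r - 1" "1 \<le> r - 1" "r - 1 \<le> i"
      using that by auto
    then show ?thesis
      using Suc.IH[of "r - 1"] by simp
  qed
  have rec: "(catalan ^ r) $ Suc i = (catalan ^ Suc r) $ Suc i + (catalan ^ (r - 1)) $ i" if "1 \<le> r" for r
  proof -
    have "catalan ^ r = catalan ^ (r - 1) * (catalan ^ 2 + fps_X)"
      using that by (simp flip: catalan_equation power_Suc2)
    also have "\<dots> = catalan ^ Suc r + fps_X * catalan ^ (r - 1)"
      using that by (cases r) (simp_all add: algebra_simps power2_eq_square)
    finally show ?thesis
      using arg_cong[of "catalan ^ r" _ "\<lambda>f. f $ Suc i"] by (simp del: power_Suc)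
  qed
  from Suc.prems(2,1) show ?case
  proof (induction rule: inc_induct)
    case base
    have "(catalan ^ Suc (Suc i)) $ Suc i = 0"
      using startsby_zero_power_prefix[of catalan "Suc (Suc i)"] by simp
    moreover have "(catalan ^ i) $ i = 1"
    proof (cases "i = 0")
      case False
      then show ?thesis
        using Suc.IH[of i] by simp
    qed simp
    ultimately show ?case
      using rec[of "Suc i"] by simp
  next
    case (step r)
    then show ?case
      using rec[of r] prev[of r] ballot_step[of r "Suc i"] by simp
  qed
qed simp

text \<open>The expansion of \<open>(1 - z) / (1 + z)\<^bsup>m+1\<^esup>\<close>.\<close>

definition lucas_series :: "nat \<Rightarrow> real fps" where
  "lucas_series m = Abs_fps (\<lambda>r. (- 1) ^ r *
     (real ((r + m) choose r) + (if r = 0 then 0 else real ((r + m - 1) choose (r - 1)))))"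

lemma lucas_series_0: "lucas_series 0 * (1 + fps_X) = 1 - fps_X"
proof (rule fps_ext)
  fix r
  show "(lucas_series 0 * (1 + fps_X)) $ r = (1 - fps_X :: real fps) $ r"
  proof (cases r)
    case (Suc s)
    then show ?thesis
      by (cases s) (simp_all add: lucas_series_def ring_distribs)
  qed (simp add: lucas_series_def ring_distribs)
qed

lemma lucas_series_Suc: "lucas_series (Suc m) * (1 + fps_X) = lucas_series m"
proof (rule fps_ext)
  fix r
  show "(lucas_series (Suc m) * (1 + fps_X)) $ r = lucas_series m $ r"
  proof (cases r)
    case (Suc s)
    then show ?thesis
      by (cases s) (simp_all add: lucas_series_def ring_distribs)
  qed (simp add: lucas_series_def ring_distribs)
qed

lemma lucas_series_nth:
  assumes "1 \<le> r"
  shows "lucas_series m $ r = (- 1) ^ r * real (2 * r + m) / real (r + m) * real ((r + m) choose r)"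
proof -
  obtain s where r: "r = Suc s"
    using assms by (cases r) auto
  have "Suc s * (Suc (s + m) choose Suc s) = Suc (s + m) * ((s + m) choose s)"
    using Suc_times_binomial_eq[of "s + m" s] by (simp only: mult.commute)
  then have "real (Suc s) * real (Suc (s + m) choose Suc s) = real (Suc (s + m)) * real ((s + m) choose s)"
    by (metis of_nat_mult)
  then have "real (Suc (s + m) choose Suc s) + real ((s + m) choose s) =
      real (2 * Suc s + m) / real (Suc s + m) * real (Suc (s + m) choose Suc s)"
    by (simp add: field_simps del: binomial_Suc_Suc)
  then show ?thesis
    unfolding lucas_series_def r by (simp del: binomial_Suc_Suc)
qed

text \<open>The exponents of the monomials \<open>u\<^sup>a v\<^sup>b\<close> of degree \<open>n\<close> in \<open>x\<close>, where \<open>u = (1 + t) x\<close> and \<open>v = t x\<^sup>2\<close>.\<close>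

definition bidegree :: "nat \<Rightarrow> (nat \<times> nat) set" where
  "bidegree n = {(a, b). a + 2 * b = n}"

lemma finite_bidegree: "finite (bidegree n)"
  by (rule finite_subset[of _ "{..n} \<times> {..n}"]) (auto simp: bidegree_def)

text \<open>The substitution \<open>u \<mapsto> (1 + t) x\<close>, \<open>v \<mapsto> t x\<^sup>2\<close>. Its argument is a power series in \<open>u\<close> whose coefficients
  are power series in \<open>v\<close>.\<close>

definition to_fan_series :: "real fps fps \<Rightarrow> real poly fps" where
  "to_fan_series f = Abs_fps (\<lambda>n. \<Sum>(a, b) \<in> bidegree n. monom (f $ a $ b) b * [:1, 1:] ^ a)"

lemma to_fan_series_diff: "to_fan_series (f - g) = to_fan_series f - to_fan_series g"
  by (rule fps_ext)
    (simp add: to_fan_series_def case_prod_unfold diff_monom[symmetric] left_diff_distrib sum_subtractf)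

lemma to_fan_series_add: "to_fan_series (f + g) = to_fan_series f + to_fan_series g"
  by (rule fps_ext)
    (simp add: to_fan_series_def case_prod_unfold add_monom[symmetric] distrib_right sum.distrib)

text \<open>The substitution is a ring homomorphism; both sides sum over all pairs of bidegrees of total degree \<open>n\<close>.\<close>

lemma to_fan_series_mult: "to_fan_series (f * g) = to_fan_series f * to_fan_series g"
proof (rule fps_ext)
  fix n
  define h where "h f a b = monom (f $ a $ b) b * [:1, 1:] ^ a" for f :: "real fps fps" and a b
  define S where "S = (SIGMA ab : bidegree n. {..fst ab} \<times> {..snd ab})"
  define S' where "S' = (SIGMA i : {..n}. bidegree i \<times> bidegree (n - i))"
  have "to_fan_series (f * g) $ n = (\<Sum>(a, b) \<in> bidegree n. \<Sum>(i, j) \<in> {..a} \<times> {..b}. h f i j * h g (a - i) (b - j))"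
  proof -
    have "monom ((f * g) $ a $ b) b * [:1, 1:] ^ a = (\<Sum>(i, j) \<in> {..a} \<times> {..b}. h f i j * h g (a - i) (b - j))" for a b
    proof -
      have "monom ((f * g) $ a $ b) b * [:1, 1:] ^ a =
          (\<Sum>i\<le>a. \<Sum>j\<le>b. monom (f $ i $ j * g $ (a - i) $ (b - j)) b * [:1, 1:] ^ a)"
        by (simp add: fps_mult_nth fps_sum_nth monom_sum sum_distrib_right atMost_atLeast0)
      also have "\<dots> = (\<Sum>i\<le>a. \<Sum>j\<le>b. h f i j * h g (a - i) (b - j))"
      proof (intro sum.cong refl)
        fix i j assume "i \<in> {..a}" "j \<in> {..b}"
        then have "monom (f $ i $ j * g $ (a - i) $ (b - j)) b = monom (f $ i $ j) j * monom (g $ (a - i) $ (b - j)) (b - j)"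
          "[:1, 1 :: real:] ^ a = [:1, 1:] ^ i * [:1, 1:] ^ (a - i)"
          by (simp_all add: mult_monom flip: power_add)
        then show "monom (f $ i $ j * g $ (a - i) $ (b - j)) b * [:1, 1:] ^ a = h f i j * h g (a - i) (b - j)"
          unfolding h_def by (simp only: mult_ac)
      qed
      finally show ?thesis
        by (simp add: sum.cartesian_product)
    qed
    then show ?thesis
      by (simp add: to_fan_series_def)
  qed
  also have "\<dots> = (\<Sum>((a, b), (i, j)) \<in> S. h f i j * h g (a - i) (b - j))"
    unfolding S_def by (subst sum.Sigma[symmetric]) (auto simp: finite_bidegree case_prod_unfold)
  also have "\<dots> = (\<Sum>(i, (a, b), (a', b')) \<in> S'. h f a b * h g a' b')"
    by (rule sum.reindex_bij_witness[of _ "\<lambda>(i, (a, b), (a', b')). ((a + a', b + b'), (a, b))"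
          "\<lambda>((a, b), (i, j)). (i + 2 * j, (i, j), (a - i, b - j))"])
      (auto simp: S_def S'_def bidegree_def)
  also have "\<dots> = (\<Sum>i\<le>n. \<Sum>((a, b), (a', b')) \<in> bidegree i \<times> bidegree (n - i). h f a b * h g a' b')"
    unfolding S'_def by (subst sum.Sigma[symmetric]) (auto simp: finite_bidegree case_prod_unfold)
  also have "\<dots> = (to_fan_series f * to_fan_series g) $ n"
    by (simp add: fps_mult_nth to_fan_series_def h_def sum_product sum.cartesian_product case_prod_unfold atMost_atLeast0)
  finally show "to_fan_series (f * g) $ n = (to_fan_series f * to_fan_series g) $ n" .
qed

lemma to_fan_series_const_nth:
  "to_fan_series (fps_const c) $ n = (if even n then monom (c $ (n div 2)) (n div 2) else 0)"
proof -
  have "to_fan_series (fps_const c) $ n = (\<Sum>(a, b) \<in> bidegree n. if a = 0 then monom (c $ b) b else 0)"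
    unfolding to_fan_series_def by (auto intro!: sum.cong)
  also have "\<dots> = (\<Sum>(a, b) \<in> {(a, b) \<in> bidegree n. a = 0}. monom (c $ b) b)"
    by (rule sum.mono_neutral_cong_right[OF finite_bidegree]) (auto split: if_splits)
  also have "{(a, b) \<in> bidegree n. a = 0} = (if even n then {(0, n div 2)} else {})"
    by (auto simp: bidegree_def intro: odd_pos)
  finally show ?thesis
    by simp
qed

lemma to_fan_series_1: "to_fan_series 1 = 1"
  by (rule fps_ext) (auto simp: to_fan_series_const_nth[of 1, simplified] elim!: evenE)

lemma to_fan_series_U: "to_fan_series fps_X = fps_const [:1, 1:] * fps_X"
proof (rule fps_ext)
  fix n
  have "to_fan_series fps_X $ n = (\<Sum>(a, b) \<in> bidegree n. if a = 1 \<and> b = 0 then [:1, 1:] else 0)"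
    unfolding to_fan_series_def by (auto intro!: sum.cong)
  also have "\<dots> = (\<Sum>(a, b) \<in> {(a, b) \<in> bidegree n. a = 1 \<and> b = 0}. [:1, 1:])"
    by (rule sum.mono_neutral_cong_right[OF finite_bidegree]) (auto split: if_splits)
  also have "{(a, b) \<in> bidegree n. a = 1 \<and> b = 0} = (if n = 1 then {(1, 0)} else {})"
    by (auto simp: bidegree_def)
  also have "(\<Sum>(a, b) \<in> (if n = 1 then {(1, 0)} else {}). [:1, 1 :: real:]) = (if n = 1 then [:1, 1:] else 0)"
    by (cases "n = 1") simp_all
  finally show "to_fan_series fps_X $ n = (fps_const [:1, 1:] * fps_X) $ n"
    by (cases "n = 1") (simp_all add: one_pCons)
qed

lemma to_fan_series_V: "to_fan_series (fps_const fps_X) = fps_const [:0, 1:] * fps_X ^ 2"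
proof (rule fps_ext)
  fix n
  show "to_fan_series (fps_const fps_X) $ n = (fps_const [:0, 1:] * fps_X ^ 2) $ n"
    by (auto simp: to_fan_series_const_nth monom_altdef elim!: evenE)
qed

text \<open>\<open>t\<^sup>b (1 + t)\<^sup>a\<close> is palindromic with respect to \<open>a + 2b\<close>.\<close>

lemma palindromic_to_fan_series: "palindromic n (to_fan_series f $ n)"
proof -
  have "palindromic (2 * b) (monom c b)" for c :: real and b
    by (auto simp: palindromic_def poly_eq_iff coeff_reversal)
  moreover have "palindromic a ([:1, 1 :: real:] ^ a)" for a
  proof (induction a)
    case (Suc a)
    from palindromic_mult[OF palindromic_one_plus_X Suc] show ?case
      by simp
  qed (simp add: palindromic_1)
  ultimately have "palindromic (2 * b + a) (monom c b * [:1, 1 :: real:] ^ a)" for a b c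
    by (rule palindromic_mult)
  then show ?thesis
    unfolding to_fan_series_def by (auto simp: bidegree_def add.commute intro!: palindromic_sum)
qed

text \<open>The series \<open>(1 - p) / (1 + p - 2u)\<close>, expanded in powers of \<open>u\<close>.\<close>

definition Z_kernel :: "real fps fps" where
  "Z_kernel = Abs_fps (\<lambda>m. fps_const (2 ^ m) * (lucas_series m oo catalan))"

lemma Z_kernel_equation:
  "Z_kernel * (1 + fps_const catalan - (fps_X + fps_X)) = 1 - fps_const catalan"
proof (rule fps_ext)
  have compose: "(f * (1 + fps_X)) oo catalan = (f oo catalan) * (1 + catalan)" for f :: "real fps"
    by (simp add: fps_compose_mult_distrib fps_compose_add_distrib)
  have c0: "(lucas_series 0 oo catalan) * (1 + catalan) = 1 - catalan"
    using arg_cong[OF lucas_series_0, of "\<lambda>f. f oo catalan"] by (simp add: compose fps_compose_sub_distrib)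
  have cS: "(lucas_series (Suc m) oo catalan) * (1 + catalan) = lucas_series m oo catalan" for m
    using arg_cong[OF lucas_series_Suc, of "\<lambda>f. f oo catalan"] by (simp add: compose)
  fix m
  have *: "(Z_kernel * (1 + fps_const catalan - (fps_X + fps_X))) $ m =
      Z_kernel $ m * (1 + catalan) - (if m = 0 then 0 else 2 * Z_kernel $ (m - 1))"
    unfolding right_diff_distrib distrib_left fps_sub_nth fps_add_nth mult_1_right
    by (simp add: distrib_left)
  show "(Z_kernel * (1 + fps_const catalan - (fps_X + fps_X))) $ m = (1 - fps_const catalan) $ m"
  proof (cases m)
    case 0
    then show ?thesis
      unfolding * by (simp add: Z_kernel_def c0)
  next
    case (Suc l)
    have "fps_const (2 ^ Suc l) * (lucas_series (Suc l) oo catalan) * (1 + catalan) = 2 * (fps_const (2 ^ l) * (lucas_series l oo catalan))"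
      unfolding mult.assoc cS by (simp add: numeral_fps_const flip: mult.assoc)
    then show ?thesis
      unfolding * unfolding Suc by (simp add: Z_kernel_def)
  qed
qed

text \<open>The candidate \<open>(1 - u) / (1 + p - 2u)\<close>, written as \<open>1/2 + (1 - p) / (2 (1 + p - 2u))\<close> so that its coefficients
  can be read off.\<close>

definition fan_Z :: "real poly fps" where
  "fan_Z = fps_const [:1 / 2:] * (1 + to_fan_series Z_kernel)"

abbreviation catalan_x :: "real poly fps" where
  "catalan_x \<equiv> to_fan_series (fps_const catalan)"

lemma catalan_x_equation: "catalan_x - catalan_x ^ 2 = fps_const [:0, 1:] * fps_X ^ 2"
proof -
  have "fps_const catalan - fps_const catalan * fps_const catalan = fps_const (fps_X :: real fps)"
    using catalan_equation by (simp add: power2_eq_square)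
  then have "to_fan_series (fps_const catalan - fps_const catalan * fps_const catalan) = fps_const [:0, 1:] * fps_X ^ 2"
    by (simp only: to_fan_series_V)
  then show ?thesis
    by (simp only: to_fan_series_diff to_fan_series_mult power2_eq_square)
qed

lemma fan_Z_equation:
  defines "u \<equiv> fps_const [:1, 1:] * fps_X"
  shows "fan_Z * (1 + catalan_x - (u + u)) = 1 - u"
proof -
  have "to_fan_series Z_kernel * (1 + catalan_x - (u + u)) = 1 - catalan_x"
    using arg_cong[OF Z_kernel_equation, of to_fan_series]
    by (simp only: to_fan_series_diff to_fan_series_mult to_fan_series_add to_fan_series_1 to_fan_series_U u_def)
  then have "(1 + to_fan_series Z_kernel) * (1 + catalan_x - (u + u)) = (1 + catalan_x - (u + u)) + (1 - catalan_x)"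
    by (simp only: distrib_right mult_1_left)
  also have "\<dots> = fps_const [:2:] * (1 - u)"
    by (simp add: right_diff_distrib numeral_fps_const numeral_poly flip: mult_2)
  finally have "fan_Z * (1 + catalan_x - (u + u)) = (fps_const [:1 / 2:] * fps_const [:2:]) * (1 - u)"
    by (simp only: fan_Z_def mult.assoc)
  then show ?thesis
    by (simp flip: one_pCons)
qed

lemma fan_Z_0: "fan_Z $ 0 = 1"
proof -
  have "bidegree 0 = {(0, 0)}"
    by (auto simp: bidegree_def)
  then have "to_fan_series Z_kernel $ 0 = 1"
    by (simp add: to_fan_series_def Z_kernel_def lucas_series_def)
  then show ?thesis
    by (simp add: fan_Z_def one_pCons)
qed

lemma palindromic_fan_Z: "palindromic k (fan_Z $ k)"
proof (cases "k = 0")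
  case True
  then show ?thesis
    by (simp add: fan_Z_0 palindromic_1)
next
  case False
  then have "fan_Z $ k = smult (1 / 2) (to_fan_series Z_kernel $ k)"
    by (simp add: fan_Z_def)
  then show ?thesis
    by (simp add: palindromic_smult palindromic_to_fan_series)
qed

text \<open>The power series all of whose monomials \<open>t\<^sup>a x\<^sup>b\<close> satisfy \<open>2a \<le> b\<close> form a ring that is closed under geometric
  series.\<close>

lemma degree_bound_of_recurrence:
  fixes f g :: "'a::comm_ring_1 poly fps"
  assumes eq: "f = 1 + g * f" and g0: "g $ 0 = 0" and g: "\<And>n. 2 * degree (g $ n) \<le> n"
  shows "2 * degree (f $ n) \<le> n"
proof (induction n rule: less_induct)
  case (less n)
  have "degree (f $ n) \<le> n div 2"
  proof -
    have f_n: "f $ n = (1 :: 'a poly fps) $ n + (\<Sum>i=0..n. g $ i * f $ (n - i))"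
      by (subst eq) (simp add: fps_mult_nth)
    show ?thesis
      unfolding f_n
    proof (intro degree_add_le degree_sum_le)
      fix i assume i: "i \<in> {0..n}"
      show "degree (g $ i * f $ (n - i)) \<le> n div 2"
      proof (cases "i = 0")
        case False
        then have "2 * degree (f $ (n - i)) \<le> n - i"
          using less.IH[of "n - i"] i by (cases "n = 0") auto
        then show ?thesis
          using degree_mult_le[of "g $ i" "f $ (n - i)"] g[of i] i by simp
      qed (simp add: g0)
    qed (simp_all add: fps_one_nth)
  qed
  then show ?case
    by simp
qed

text \<open>Inserting \<open>y\<close> into the word equation and cancelling \<open>1 - u\<close> gives \<open>B (1 + p - 2u + t x) = 1 - u\<close>. Because of
  \<open>p - p\<^sup>2 = t x\<^sup>2\<close>, the product of \<open>1 - p - x\<close> and \<open>1 + p - 2u + t x\<close> is that of \<open>1 - p - 2x\<close> and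
  \<open>1 - u\<close>, whence \<open>B = (1 - p - x) / (1 - p - 2x)\<close>. The factor
  \<open>x\<close> in \<open>B - 1 = x / (1 - p - 2x)\<close> makes the degree bound strict.\<close>

lemma KL_bounded_fan: "KL_bounded k (all_words_sum (fps_nth fan_Z) False k)"
proof -
  define x :: "real poly fps" where "x = fps_X"
  define s where "s = fps_const [:0, 1:] * x"
  define u where "u = fps_const [:1, 1:] * x"
  define B where "B = Abs_fps (all_words_sum (fps_nth fan_Z) False)"
  define g where "g = catalan_x + (x + x)"
  define R where "R = fps_right_inverse (1 - g) 1"
  have u: "u = x + s"
    unfolding u_def s_def by (simp add: fps_eq_iff x_def one_pCons)
  have catalan_x: "catalan_x = catalan_x * catalan_x + s * x"
    using catalan_x_equation by (simp add: power2_eq_square s_def x_def mult.assoc algebra_simps)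
  have catalan_x_0: "catalan_x $ 0 = 0"
    by (simp add: to_fan_series_const_nth)
  have BZ: "B * (1 - u + s * fan_Z) = fan_Z * (1 - u)"
    using all_words_fps[of "fps_nth fan_Z"] fan_Z_0 by (simp add: B_def u_def s_def x_def fps_nth_inverse)
  define D where "D = 1 + catalan_x - (u + u)"
  have Z: "fan_Z * D = 1 - u"
    unfolding D_def u_def x_def by (rule fan_Z_equation)
  have "(1 - u) * (B * (D + s)) = D * (B * (1 - u)) + B * s * (fan_Z * D)"
    unfolding Z by (simp add: algebra_simps)
  also have "\<dots> = D * (B * (1 - u + s * fan_Z))"
    by (simp add: algebra_simps)
  also have "\<dots> = (1 - u) * (1 - u)"
  proof -
    have "D * (fan_Z * (1 - u)) = (fan_Z * D) * (1 - u)"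
      by (simp only: mult_ac)
    then show ?thesis
      by (simp only: BZ Z)
  qed
  finally have "(1 - u) * (B * (D + s)) = (1 - u) * (1 - u)" .
  moreover have "1 - u \<noteq> 0"
    by (auto simp: fps_eq_iff u_def x_def intro!: exI[of _ 0])
  ultimately have BD: "B * (D + s) = 1 - u"
    by simp
  have "(1 - g) * (1 - u) = (1 - catalan_x - x) * (D + s) - (catalan_x - (catalan_x * catalan_x + s * x))"
    unfolding g_def D_def u by (simp add: algebra_simps)
  \<comment> \<open>This polynomial identity contains the cancellation: the difference of its sides is a multiple
    of \<open>p - p\<^sup>2 - t x\<^sup>2\<close>.\<close>
  then have id: "(1 - g) * (1 - u) = (1 - catalan_x - x) * (D + s)"
    using catalan_x by simp
  have "((1 - g) * B) * (D + s) = (1 - catalan_x - x) * (D + s)"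
    using BD id by (simp add: mult.assoc)
  moreover have "(D + s) $ 0 = 1"
    by (simp add: D_def s_def u_def x_def catalan_x_0)
  then have "D + s \<noteq> 0"
    by (metis fps_zero_nth zero_neq_one)
  ultimately have gB: "(1 - g) * B = 1 - catalan_x - x"
    by simp
  have R: "(1 - g) * R = 1"
    unfolding R_def by (rule fps_right_inverse) (simp add: g_def x_def catalan_x_0)
  have "(1 - g) * (1 + x * R) = (1 - g) + x * ((1 - g) * R)"
    by (simp add: algebra_simps)
  also have "\<dots> = (1 - g) * B"
    unfolding gB R by (simp add: g_def)
  finally have "(1 - g) * (1 + x * R) = (1 - g) * B" .
  moreover have "(1 - g) $ 0 = 1"
    by (simp add: g_def x_def catalan_x_0)
  then have "1 - g \<noteq> 0"
    by (metis fps_zero_nth zero_neq_one)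
  ultimately have B: "B = 1 + x * R"
    by simp
  have "2 * degree (R $ n) \<le> n" for n
  proof (rule degree_bound_of_recurrence)
    show "R = 1 + g * R"
      using R by (simp add: algebra_simps)
    show "g $ 0 = 0"
      by (simp add: g_def x_def catalan_x_0)
    show "2 * degree (g $ n) \<le> n" for n
    proof -
      have "degree (catalan_x $ n) \<le> n div 2"
        by (auto simp: to_fan_series_const_nth degree_monom_le)
      moreover have "degree ((x + x) $ n) = 0"
        unfolding x_def fps_add_nth by (cases "n = 1") auto
      ultimately have "degree (g $ n) \<le> n div 2"
        unfolding g_def fps_add_nth[of catalan_x] by (intro degree_add_le) auto
      then show ?thesis
        by simp
    qed
  qed
  moreover have "all_words_sum (fps_nth fan_Z) False k = B $ k"
    by (simp add: B_def)
  ultimately show ?thesis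
    unfolding B by (cases k) (auto simp: KL_bounded_def x_def less_Suc_eq_le)
qed

lemma real_inverse_Z_poly_fan: "real_poly (inverse_Z_poly (fan_graph n)) = fan_Z $ n"
  by (rule inverse_Z_poly_fan[OF palindromic_fan_Z KL_bounded_fan fan_Z_0])

lemma coeff_one_plus_X_power: "coeff ([:1, 1 :: real:] ^ m) k = real (m choose k)"
  using coeff_linear_poly_power[of k m 1 1] by (cases "k \<le> m") (simp_all add: coeff_eq_0 degree_linear_power)

text \<open>The summand for \<open>j\<close> is the contribution of \<open>u\<^bsup>n-2j\<^esup> v\<^sup>j = t\<^sup>j (1 + t)\<^bsup>n-2j\<^esup> x\<^sup>n\<close>, and \<open>r\<close> is the exponent in the
  expansion by powers of \<open>p\<close>. For \<open>j = 0\<close> only \<open>r = 0\<close> contributes, which is the separate first term.\<close>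

lemma coeff_fan_Z:
  assumes n: "n \<ge> 1"
  shows "coeff (fan_Z $ n) k =
    2 ^ (n - 1) * real (n choose k) +
    (\<Sum>j = 1..n div 2. \<Sum>r = 1..j.
      2 powi (int n - 2 * int j - 1) *
      (((- 1) ^ r * real r * (2 * real r + real n - 2 * real j)) /
       ((2 * real j - real r) * (real r + real n - 2 * real j))) *
      real (choose_int (n - 2 * j) (int k - int j)) *
      real ((2 * j - r) choose j) *
      real ((r + n - 2 * j) choose r))"
    (is "_ = _ + (\<Sum>j = 1..n div 2. \<Sum>r = 1..j. ?s j r)")
proof -
  define c where "c j = 1 / 2 * Z_kernel $ (n - 2 * j) $ j * real (choose_int (n - 2 * j) (int k - int j))" for j
  have "coeff (monom z j * [:1, 1:] ^ m) k = z * real (choose_int m (int k - int j))" for z :: real and j m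
    by (auto simp: coeff_monom_mult coeff_one_plus_X_power choose_int_def nat_diff_distrib')
  then have "coeff (fan_Z $ n) k = (\<Sum>(a, j) \<in> bidegree n. 1 / 2 * (Z_kernel $ a $ j * real (choose_int a (int k - int j))))"
    using n by (simp add: fan_Z_def to_fan_series_def coeff_sum case_prod_unfold sum_distrib_left)
  also have "\<dots> = (\<Sum>j = 0..n div 2. c j)"
    by (rule sum.reindex_bij_witness[of _ "\<lambda>j. (n - 2 * j, j)" snd]) (auto simp: bidegree_def c_def)
  also have "\<dots> = c 0 + (\<Sum>j = 1..n div 2. c j)"
    by (simp add: sum.atLeast_Suc_atMost)
  also have "c 0 = 2 ^ (n - 1) * real (n choose k)"
    using n by (cases n) (simp_all add: c_def Z_kernel_def lucas_series_def choose_int_def)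
  also have "(\<Sum>j = 1..n div 2. c j) = (\<Sum>j = 1..n div 2. \<Sum>r = 1..j. ?s j r)"
  proof (intro sum.cong refl)
    fix j assume "j \<in> {1..n div 2}"
    then have j: "1 \<le> j" "2 * j \<le> n"
      by auto
    define m where "m = n - 2 * j"
    have "int n - 2 * int j - 1 = int m - 1"
      using j by (simp add: m_def of_nat_diff)
    then have pow: "2 powi (int n - 2 * int j - 1) = (1 / 2 * 2 ^ m :: real)"
      by (simp add: power_int_diff)
    have "(lucas_series m oo catalan) $ j = (\<Sum>r = 1..j. lucas_series m $ r * (catalan ^ r) $ j)"
      using j by (simp add: fps_compose_nth sum.atLeast_Suc_atMost)
    then have "c j = (\<Sum>r = 1..j. 1 / 2 * 2 ^ m * (lucas_series m $ r * (catalan ^ r) $ j) *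
        real (choose_int m (int k - int j)))"
      by (simp add: c_def Z_kernel_def flip: m_def) (simp add: sum_distrib_left sum_distrib_right mult.assoc)
    also have "\<dots> = (\<Sum>r = 1..j. ?s j r)"
    proof (intro sum.cong refl)
      fix r assume "r \<in> {1..j}"
      then have r: "1 \<le> r" "r \<le> j"
        by auto
      have eqs: "2 * real r + real n - 2 * real j = real (2 * r + m)" "2 * real j - real r = real (2 * j - r)"
        "real r + real n - 2 * real j = real (r + m)" "r + n - 2 * j = r + m"
        using j r by (simp_all add: m_def of_nat_diff)
      have rearrange: "A * (s * x / y * p * (q / z * t)) * h = A * (s * q * x / (z * y)) * h * t * p"
        for A s x y p q z t h :: real
        by (simp add: divide_inverse mult_ac)
      show "1 / 2 * 2 ^ m * (lucas_series m $ r * (catalan ^ r) $ j) * real (choose_int m (int k - int j)) =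
        ?s j r"
        unfolding pow eqs lucas_series_nth[OF r(1)] catalan_power_nth[OF r] m_def[symmetric] by (rule rearrange)
    qed
    finally show "c j = (\<Sum>r = 1..j. ?s j r)" .
  qed
  finally show ?thesis .
qed

theorem theorem1p3:
  fixes n :: nat
  assumes "n \<ge> 1"
  shows "degree (inverse_Z_poly (fan_graph n)) = n \<and>
    (\<forall>k \<le> n. real_of_int (coeff (inverse_Z_poly (fan_graph n)) k) =
       2 ^ (n - 1) * real (n choose k) +
       (\<Sum>j = 1..n div 2. \<Sum>r = 1..j.
          2 powi (int n - 2 * int j - 1) *
          (((- 1) ^ r * real r * (2 * real r + real n - 2 * real j)) /
           ((2 * real j - real r) * (real r + real n - 2 * real j))) *
          real (choose_int (n - 2 * j) (int k - int j)) *
          real ((2 * j - r) choose j) *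
          real ((r + n - 2 * j) choose r)))"
proof -
  have coeff: "real_of_int (coeff (inverse_Z_poly (fan_graph n)) k) = coeff (fan_Z $ n) k" for k
    using arg_cong[OF real_inverse_Z_poly_fan[of n], of "\<lambda>p. coeff p k"] by (simp add: coeff_map_poly)
  have "degree (inverse_Z_poly (fan_graph n)) \<le> n"
    using palindromic_degree[OF palindromic_fan_Z[of n]] real_inverse_Z_poly_fan[of n]
    by (metis degree_map_poly of_int_0 of_int_eq_0_iff)
  moreover have "coeff (fan_Z $ n) n = 2 ^ (n - 1)"
  proof -
    have "choose_int (n - 2 * j) (int n - int j) = 0" if "j \<in> {1..n div 2}" for j
    proof -
      have "1 \<le> j" "j \<le> n" "2 * j \<le> n"
        using that by auto
      then show ?thesis
        by (simp add: choose_int_def nat_diff_distrib')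
    qed
    then show ?thesis
      by (simp add: coeff_fan_Z[OF assms])
  qed
  then have "coeff (inverse_Z_poly (fan_graph n)) n \<noteq> 0"
    using coeff[of n] by auto
  then have "degree (inverse_Z_poly (fan_graph n)) \<ge> n"
    by (rule le_degree)
  ultimately show ?thesis
    using coeff_fan_Z[OF assms] by (simp add: coeff)
qed

end
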